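(* Let $G$ be a convex triangular grid and let $h:E(G)\to\mathbb{R}$ be a concave cocirculation in $G$. Let $O_h$ be the set of boundary edges $e$ of $G$ for which $h(e)$ is an integer, and let $I_h$ be the set of edges contained in little triangles $\Delta$ of $G$ such that $h$ takes integer values on all three edges of $\Delta$. Then there exists an integer-valued concave cocirculation $h'$ in $G$ such that $h'(e)=h(e)$ for all edges $e\in O_h\cup I_h$.
   Context: Fix the vectors $\xi_1=(1,0)$, $\xi_2=(-1,\sqrt3)/2$, $\xi_3=(-1,-\sqrt3)/2$ in $\mathbb{R}^2$ (so $\xi_1+\xi_2+\xi_3=0$). A convex (triangular) grid is a finite planar digraph $G=(V(G),E(G))$ embedded in the plane (edges are straight segments) such that (a) each bounded face is a triangle surrounded by three edges and each edge $(u,v)$ satisfies $v-u\in\{\xi_1,\xi_2,\xi_3\}$; and (b) the region $\mathcal{R}=\mathcal{R}(G)$ spanned by $G$ (the union of its bounded faces) is a convex polygon. Each bounded face is called a little triangle; it is an equilateral triangle surrounded by a directed circuit with three edges (a 3-circuit). The boundary edges of $G$ are the edges lying on the boundary of $\mathcal{R}$. A function $h:E(G)\to\mathbb{R}$ is a cocirculation if $h(e)+h(e')+h(e'')=0$ for each 3-circuit formed by edges $e,e',e''$. Equivalently, there is a function $g:\mathcal{R}\to\mathbb{R}$, affinely linear within each bounded face, with $h(e)=g(v)-g(u)$ for each edge $e=(u,v)$; such a $g$ is unique up to adding a constant. The cocirculation $h$ is called concave if $g$ is concave on $\mathcal{R}$. *)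

theory Defs
  imports "HOL-Analysis.Analysis" "Graph_Theory.Pair_Digraph"
begin

type_synonym point = "real^2"
type_synonym edge = "point \<times> point"

definition xi1 :: point where "xi1 = vector [1, 0]"
definition xi2 :: point where "xi2 = vector [- 1 / 2, sqrt 3 / 2]"
definition xi3 :: point where "xi3 = vector [- 1 / 2, - sqrt 3 / 2]"

text \<open>A digraph embedded in the plane is a digraph whose vertices are points of the plane;
  an edge \<open>(u, v)\<close> is drawn as the straight segment from \<open>u\<close> to \<open>v\<close>. Parallel edges would be
  drawn as the same segment, so edges may be taken to be pairs of vertices.\<close>

definition seg :: "edge \<Rightarrow> point set" where
  "seg e = closed_segment (fst e) (snd e)"

definition open_seg :: "edge \<Rightarrow> point set" where
  "open_seg e = open_segment (fst e) (snd e)"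

definition drawing :: "point pair_pre_digraph \<Rightarrow> point set" where
  "drawing G = pverts G \<union> (\<Union>e\<in>parcs G. seg e)"

definition plane_embedded :: "point pair_pre_digraph \<Rightarrow> bool" where
  "plane_embedded G \<longleftrightarrow>
     (\<forall>e\<in>parcs G. open_seg e \<inter> pverts G = {}) \<and>
     (\<forall>e\<in>parcs G. \<forall>e'\<in>parcs G. e \<noteq> e' \<longrightarrow> open_seg e \<inter> open_seg e' = {})"

definition bounded_faces :: "point pair_pre_digraph \<Rightarrow> point set set" where
  "bounded_faces G = {F \<in> components (- drawing G). bounded F}"

text \<open>Faces are connected components of the complement of the drawing, hence open; little
  triangles, and the region they make up, are taken closed.\<close>

definition little_triangles :: "point pair_pre_digraph \<Rightarrow> point set set" where
  "little_triangles G = closure ` bounded_faces G"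

definition region :: "point pair_pre_digraph \<Rightarrow> point set" where
  "region G = \<Union> (little_triangles G)"

text \<open>The orientation of the three surrounding edges is left open here: it is forced by the
  condition on the edge vectors.\<close>

definition triangular_face :: "point pair_pre_digraph \<Rightarrow> point set \<Rightarrow> bool" where
  "triangular_face G F \<longleftrightarrow>
     (\<exists>a b c. \<not> collinear {a, b, c} \<and> F = interior (convex hull {a, b, c}) \<and>
        {(a, b), (b, c), (c, a)} \<subseteq> parcs G \<union> (parcs G)\<inverse>)"

definition convex_polygon :: "point set \<Rightarrow> bool" where
  "convex_polygon P \<longleftrightarrow> polytope P \<and> aff_dim P = 2"

text \<open>The last conjunct is part of the region being spanned by \<open>G\<close>: no isolated vertices or
  dangling edges lie outside the union of the bounded faces, so that a function on the region
  has a value at every vertex.\<close>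

definition convex_grid :: "point pair_pre_digraph \<Rightarrow> bool" where
  "convex_grid G \<longleftrightarrow>
     pair_fin_digraph G \<and> plane_embedded G \<and>
     (\<forall>F\<in>bounded_faces G. triangular_face G F) \<and>
     (\<forall>(u, v)\<in>parcs G. v - u \<in> {xi1, xi2, xi3}) \<and>
     convex_polygon (region G) \<and>
     pverts G \<subseteq> region G"

definition edges_within :: "point pair_pre_digraph \<Rightarrow> point set \<Rightarrow> edge set" where
  "edges_within G S = {e \<in> parcs G. seg e \<subseteq> S}"

definition boundary_edges :: "point pair_pre_digraph \<Rightarrow> edge set" where
  "boundary_edges G = edges_within G (frontier (region G))"

text \<open>Functions on the edge set are total functions on pairs of points of which only the values
  on \<open>parcs G\<close> matter.\<close>

definition cocirculation :: "point pair_pre_digraph \<Rightarrow> (edge \<Rightarrow> real) \<Rightarrow> bool" where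
  "cocirculation G h \<longleftrightarrow>
     (\<forall>a b c. (a, b) \<in> parcs G \<and> (b, c) \<in> parcs G \<and> (c, a) \<in> parcs G \<longrightarrow>
        h (a, b) + h (b, c) + h (c, a) = 0)"

definition affine_fun_on :: "point set \<Rightarrow> (point \<Rightarrow> real) \<Rightarrow> bool" where
  "affine_fun_on S g \<longleftrightarrow> (\<exists>L c. linear L \<and> (\<forall>x\<in>S. g x = L x + c))"

definition potential :: "point pair_pre_digraph \<Rightarrow> (edge \<Rightarrow> real) \<Rightarrow> (point \<Rightarrow> real) \<Rightarrow> bool" where
  "potential G h g \<longleftrightarrow>
     (\<forall>\<Delta>\<in>little_triangles G. affine_fun_on \<Delta> g) \<and>
     (\<forall>(u, v)\<in>parcs G. h (u, v) = g v - g u)"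

text \<open>The potential \<open>g\<close> of a cocirculation on a convex grid is unique on the region up to an
  additive constant, so \<open>\<exists>g\<close> and \<open>\<forall>g\<close> agree below.\<close>

definition concave_cocirculation :: "point pair_pre_digraph \<Rightarrow> (edge \<Rightarrow> real) \<Rightarrow> bool" where
  "concave_cocirculation G h \<longleftrightarrow>
     cocirculation G h \<and> (\<exists>g. potential G h g \<and> concave_on (region G) g)"

definition O_edges :: "point pair_pre_digraph \<Rightarrow> (edge \<Rightarrow> real) \<Rightarrow> edge set" where
  "O_edges G h = {e \<in> boundary_edges G. h e \<in> \<int>}"

definition I_edges :: "point pair_pre_digraph \<Rightarrow> (edge \<Rightarrow> real) \<Rightarrow> edge set" where
  "I_edges G h =
     (\<Union>\<Delta>\<in>{\<Delta> \<in> little_triangles G. \<forall>e\<in>edges_within G \<Delta>. h e \<in> \<int>}. edges_within G \<Delta>)"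

end

theory Submission
  imports Defs
begin

text \<open>
  In coordinates with respect to \<^term>\<open>xi1\<close> and \<^term>\<open>xi2\<close> the vertices of a convex grid are the
  lattice points of a hexagon (some sides may be degenerate), and a concave cocirculation is the
  difference function of a function \<open>g\<close> on these points that satisfies
  \<open>g(p) + g(q) \<le> g(a) + g(b)\<close> whenever \<open>a b p\<close> and \<open>a b q\<close> are the two triangles at an edge \<open>a b\<close>.
  The maximal pieces on which \<open>g\<close> is affine, the tiles, are hexagons again. The dual picture is a
  honeycomb: its vertices are the tiles, and its edges are the sides of the tiles.

  Suppose that some slope of \<open>g\<close> is not an integer. On each tile the slopes in three directions with
  sum zero add up to zero, so if one of them is not an integer, then at least two are not. This is
  why a strand that enters a tile through a side of non-integral slope can always leave it through
  another such side: either through the opposite side or through a side at the angle of 120 degrees,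
  as at the branching of a Y (\<open>pass_exists\<close>). Pushing a strand aside adds to \<open>g\<close> on the tile a
  0/1-function which is concave there (\<open>shift_concave\<close>) and moves an edge on a side of the tile only
  if the strand passes through that side. A flow of strands therefore glues to a function \<open>\<delta>\<close> on the
  whole hexagon (\<open>follows_exists\<close>) such that \<open>g + \<epsilon> \<delta>\<close> stays concave for small \<open>\<epsilon> > 0\<close>
  (\<open>follows_concave\<close>) and keeps its values on integral triangles and on integral boundary edges
  (\<open>follows_int_tile\<close>, \<open>follows_int_boundary\<close>).

  Reversing all strands gives a second move. The two moves are nearly opposite: normalized to vanish
  at a corner of the hexagon, their sum is nonnegative everywhere (\<open>two_sided_move\<close>). Moreover the
  flow can be chosen so that the moves are not zero (\<open>unbalanced_circulation\<close>).

  Consider now all concave functions that agree with the given one on integral triangles and on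
  integral boundary edges, vanish at a fixed corner and have bounded differences. They form a compact
  set; let \<open>g\<close> be a member for which the sum of \<open>exp (g w)\<close> over all lattice points \<open>w\<close> is maximal. As
  \<open>exp\<close> is increasing and strictly convex, one of the two moves would increase this sum, unless there
  is no strand at all. Hence all slopes of \<open>g\<close> are integers (\<open>integer_lattice_function\<close>). The bounds on
  the differences have to survive the moves; this holds for integer bounds \<open>B\<close> on the boundary and
  \<open>2 * B + 1\<close> inside (\<open>follows_steep\<close>).

  Passing between the plane and the lattice uses the convexity of the region: one can walk from any
  little triangle to any point of the region through neighbouring little triangles
  (\<open>face_flags_cross\<close>, \<open>walk_to\<close>). Finally, an integral lattice function is extended to the region as
  the minimum of the affine functions that belong to its triangles (\<open>concave_extension\<close>).
\<close>

section \<open>Directions and hexagons of the triangular lattice\<close>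

text \<open>The pair \<open>(x, y)\<close> stands for the point \<open>c + x xi1 + y xi2\<close> with a fixed origin \<open>c\<close>.\<close>

type_synonym lpt = "int \<times> int"

text \<open>\<open>rot\<close> and \<open>ror\<close> are the rotations by 60 degrees, counterclockwise and clockwise, and \<open>nrm u\<close>
  is an outer normal of a convex polygon along a side that is traversed counterclockwise in
  direction \<open>u\<close>: it increases to the right of \<open>u\<close>. The identities \<open>rot (rot u) = rot u - u\<close> and
  \<open>ror u = u - rot u\<close> allow to express the six unit vectors by \<open>u\<close> and \<open>rot u\<close>.\<close>

definition rot :: "lpt \<Rightarrow> lpt" where "rot u = (fst u - snd u, fst u)"
definition ror :: "lpt \<Rightarrow> lpt" where "ror u = (snd u, snd u - fst u)"
definition nrm :: "lpt \<Rightarrow> lpt \<Rightarrow> int" where "nrm u z = snd u * fst z - fst u * snd z"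
definition units :: "lpt set" where
  "units = {(1,0), (1,1), (0,1), (-1,0), (-1,-1), (0,-1)}"

lemma rot_rot [simp]: "rot (rot u) = rot u - u"
  by (simp add: rot_def prod_eq_iff)
lemma ror_eq: "ror u = u - rot u"
  by (simp add: rot_def ror_def prod_eq_iff)
lemma rot_add [simp]: "rot (u + v) = rot u + rot v" and rot_diff [simp]: "rot (u - v) = rot u - rot v"
  and rot_minus [simp]: "rot (- u) = - rot u"
  by (simp_all add: rot_def prod_eq_iff)

lemma nrm_add [simp]: "nrm u (z + w) = nrm u z + nrm u w"
  and nrm_diff [simp]: "nrm u (z - w) = nrm u z - nrm u w"
  and nrm_minus [simp]: "nrm u (- z) = - nrm u z"
  and nrm_add_left [simp]: "nrm (u + v) z = nrm u z + nrm v z"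
  and nrm_diff_left [simp]: "nrm (u - v) z = nrm u z - nrm v z"
  and nrm_minus_left [simp]: "nrm (- u) z = - nrm u z"
  and nrm_self [simp]: "nrm u u = 0"
  and nrm_zero [simp]: "nrm u 0 = 0"
  by (simp_all add: nrm_def algebra_simps)

lemma finite_units [simp]: "finite units" by (simp add: units_def)
lemma rot_units [simp]: "u \<in> units \<Longrightarrow> rot u \<in> units"
  and minus_units [simp]: "u \<in> units \<Longrightarrow> - u \<in> units"
  and rot2_units [simp]: "u \<in> units \<Longrightarrow> rot u - u \<in> units"
  and ror_units [simp]: "u \<in> units \<Longrightarrow> u - rot u \<in> units"
  by (auto simp: units_def rot_def)

lemma nrm_rot [simp]: "u \<in> units \<Longrightarrow> nrm u (rot u) = -1" "u \<in> units \<Longrightarrow> nrm (rot u) u = 1"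
  by (auto simp: units_def nrm_def rot_def)

lemma units_frame:
  assumes "u \<in> units"
  shows "units = {u, rot u, rot u - u, - u, - rot u, u - rot u}"
proof -
  have "u = (1,0) \<or> u = (1,1) \<or> u = (0,1) \<or> u = (-1,0) \<or> u = (-1,-1) \<or> u = (0,-1)"
    using assms by (simp add: units_def)
  then show ?thesis
    unfolding units_def rot_def by (elim disjE; simp; blast)
qed

lemma frame_distinct:
  assumes "u \<in> units"
  shows "distinct [u, rot u, rot u - u, - u, - rot u, u - rot u]"
  using assms by (auto simp: units_def rot_def prod_eq_iff)

definition hex :: "(lpt \<Rightarrow> int) \<Rightarrow> lpt set" where "hex s = {z. \<forall>u\<in>units. nrm u z \<le> s u}"
text \<open>The signed lattice length of the side in direction \<open>u\<close> of the hexagon with support numbers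
  \<open>s\<close>.\<close>

definition len :: "(lpt \<Rightarrow> int) \<Rightarrow> lpt \<Rightarrow> int" where "len s u = s (rot u) + s (ror u) - s u"

text \<open>The inequalities of a hexagon for the coordinates \<open>a = nrm u z\<close> and \<open>b = nrm (rot u) z\<close>. The
  six directions are symmetric, so every question about a hexagon can be put in these coordinates
  with \<open>u\<close> chosen to fit the situation. The proofs then replace the coordinates and the support
  numbers by variables, and what remains is linear integer arithmetic.\<close>

definition hex_bounds :: "int \<Rightarrow> int \<Rightarrow> int \<Rightarrow> int \<Rightarrow> int \<Rightarrow> int \<Rightarrow> int \<Rightarrow> int \<Rightarrow> bool" where
  "hex_bounds S0 S1 S2 S3 S4 S5 a b \<longleftrightarrow> a \<le> S0 \<and> b \<le> S1 \<and> b - a \<le> S2 \<and> - a \<le> S3 \<and> - b \<le> S4 \<and> a - b \<le> S5"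

lemma hex_frame:
  assumes "u \<in> units"
  shows "z \<in> hex s \<longleftrightarrow> hex_bounds (s u) (s (rot u)) (s (rot u - u)) (s (- u)) (s (- rot u)) (s (u - rot u)) (nrm u z) (nrm (rot u) z)"
  unfolding hex_def units_frame[OF assms] hex_bounds_def by simp

text \<open>A strand may enter a hexagon through the side \<open>u\<close> and leave through the side \<open>v\<close>, both of
  positive length, if \<open>v\<close> is opposite to \<open>u\<close>, or if \<open>u\<close> and \<open>v\<close> are two of three alternate sides
  of which the third has positive length, too.\<close>

definition pass :: "(lpt \<Rightarrow> int) \<Rightarrow> lpt \<Rightarrow> lpt \<Rightarrow> bool" where
  "pass s u v \<longleftrightarrow> len s u \<ge> 1 \<and> len s v \<ge> 1 \<and>
     (v = - u \<or> v = rot (rot u) \<and> len s (- rot u) \<ge> 1 \<or> u = rot (rot v) \<and> len s (- rot v) \<ge> 1)"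

text \<open>The points that are raised when the strand from \<open>u\<close> to \<open>v\<close> is pushed aside. Going around the
  hexagon counterclockwise, the points that stay are those on the chain of sides from the end of
  side \<open>v\<close> to the start of side \<open>u\<close>; all other points are raised by one.\<close>

definition shift :: "lpt set \<Rightarrow> lpt \<Rightarrow> lpt \<Rightarrow> lpt \<Rightarrow> bool" where
  "shift T u v w \<longleftrightarrow> (if v = rot (rot u) then w - u \<in> T \<and> w + v \<in> T else w - u \<in> T \<or> w + v \<in> T)"

section \<open>Shifting a strand through a hexagon\<close>

lemma units_cases:
  assumes "u \<in> units" "d \<in> units"
  obtains "d = u" | "d = rot u" | "d = rot u - u" | "d = - u" | "d = - rot u" | "d = u - rot u"
  using assms(2) units_frame[OF assms(1)] by blast

lemma len_frame:
  "len s u = s (rot u) + s (u - rot u) - s u"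
  "len s (rot u) = s (rot u - u) + s u - s (rot u)"
  "len s (rot u - u) = s (- u) + s (rot u) - s (rot u - u)"
  "len s (- u) = s (- rot u) + s (rot u - u) - s (- u)"
  "len s (- rot u) = s (u - rot u) + s (- u) - s (- rot u)"
  "len s (u - rot u) = s u + s (- rot u) - s (u - rot u)"
  by (simp_all add: len_def ror_eq)

lemma pass_cases:
  assumes "pass s u v" "u \<in> units" "v \<in> units"
  obtains "v = - u" "len s u \<ge> 1" "len s (- u) \<ge> 1"
    | "v = rot u - u" "len s u \<ge> 1" "len s (rot u - u) \<ge> 1" "len s (- rot u) \<ge> 1"
    | "u = rot v - v" "len s v \<ge> 1" "len s (rot v - v) \<ge> 1" "len s (- rot v) \<ge> 1"
  using assms unfolding pass_def by auto

lemma rot_nz: assumes "u \<in> units"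
  shows "- u \<noteq> rot u - u" "rot u \<noteq> 0" "u \<noteq> 0" "rot u \<noteq> u" "rot u \<noteq> - u" "- rot u \<noteq> u" "u \<noteq> rot u" "u \<noteq> - rot u"
    "rot u - u \<noteq> - u"
    "u \<noteq> - u" "- u \<noteq> u" "u \<noteq> rot u - u" "rot u - u \<noteq> u"
  using assms unfolding units_def by (auto simp: rot_def prod_eq_iff)

lemma shift_straight:
  assumes "u \<in> units"
  shows "shift T u (- u) w \<longleftrightarrow> w - u \<in> T"
  using rot_nz[OF assms] by (simp add: shift_def)

lemma shift_right: "shift T u (rot u - u) w \<longleftrightarrow> w - u \<in> T \<and> w + (rot u - u) \<in> T"
  by (simp add: shift_def)

lemma shift_left:
  assumes "v \<in> units"
  shows "shift T (rot v - v) v w \<longleftrightarrow> w - (rot v - v) \<in> T \<or> w + v \<in> T"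
  using rot_nz[OF assms] by (simp add: shift_def)

lemmas frame_simps = ror_eq nrm_add nrm_diff nrm_self nrm_minus rot_diff rot_rot rot_minus
  nrm_add_left nrm_diff_left nrm_minus_left

lemma len_nonneg_frame:
  assumes "\<forall>m\<in>units. len s m \<ge> 0" "u \<in> units"
  shows "0 \<le> len s u \<and> 0 \<le> len s (rot u) \<and> 0 \<le> len s (rot u - u) \<and>
    0 \<le> len s (- u) \<and> 0 \<le> len s (- rot u) \<and> 0 \<le> len s (u - rot u)"
  using assms by simp

text \<open>Pushing a strand keeps the function concave on the tile, since it raises everything except a
  chain of the boundary. In each of the cases of \<open>pass\<close> this is a check of the hexagon
  inequalities for the six possible directions \<open>d\<close>.\<close>

lemma shift_concave:
  assumes u: "u \<in> units" and v: "v \<in> units" and d: "d \<in> units" and p: "pass s u v"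
    and T: "z \<in> hex s" "z + d \<in> hex s" "z + rot d \<in> hex s" "z + ror d \<in> hex s"
  shows "of_bool (shift (hex s) u v (z + rot d)) + of_bool (shift (hex s) u v (z + ror d))
     \<le> of_bool (shift (hex s) u v z) + (of_bool (shift (hex s) u v (z + d)) :: int)"
  using p u v
proof (cases rule: pass_cases)
  case 1
  obtain a b S0 S1 S2 S3 S4 S5 where e: "nrm u z = a" "nrm (rot u) z = b" "s u = S0" "s (rot u) = S1"
    "s (rot u - u) = S2" "s (- u) = S3" "s (- rot u) = S4" "s (u - rot u) = S5" by blast
  show ?thesis unfolding 1 shift_straight[OF u] using T
    by - (rule units_cases[OF u d],
        simp_all only: hex_frame[OF u] len_frame[of s u] e frame_simps nrm_rot[OF u] hex_bounds_def, auto)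
next
  case 2
  obtain a b S0 S1 S2 S3 S4 S5 where e: "nrm u z = a" "nrm (rot u) z = b" "s u = S0" "s (rot u) = S1"
    "s (rot u - u) = S2" "s (- u) = S3" "s (- rot u) = S4" "s (u - rot u) = S5" by blast
  show ?thesis unfolding 2 shift_right using T 2(4)
    by - (rule units_cases[OF u d],
        simp_all only: hex_frame[OF u] len_frame[of s u] e frame_simps nrm_rot[OF u] hex_bounds_def, auto)
next
  case 3
  obtain a b S0 S1 S2 S3 S4 S5 where e: "nrm v z = a" "nrm (rot v) z = b" "s v = S0" "s (rot v) = S1"
    "s (rot v - v) = S2" "s (- v) = S3" "s (- rot v) = S4" "s (v - rot v) = S5" by blast
  show ?thesis unfolding 3 shift_left[OF v] using T
    by - (rule units_cases[OF v d],
        simp_all only: hex_frame[OF v] len_frame[of s v] e frame_simps nrm_rot[OF v] hex_bounds_def, auto)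
qed

text \<open>A strand and its reverse keep complementary chains of the boundary fixed, so each point is
  raised by at least one of them. The points that both raise are the interior points and the inner
  points of the sides \<open>u\<close> and \<open>v\<close>; on the boundary this is \<open>shift_both_on_side\<close>.\<close>

lemma shift_cover:
  assumes u: "u \<in> units" and v: "v \<in> units" and p: "pass s u v"
    and pos: "\<forall>m\<in>units. len s m \<ge> 0" and z: "z \<in> hex s"
  shows "shift (hex s) u v z \<or> shift (hex s) v u z"
  using p u v
proof (cases rule: pass_cases)
  case 1
  obtain a b S0 S1 S2 S3 S4 S5 where e: "nrm u z = a" "nrm (rot u) z = b" "s u = S0" "s (rot u) = S1"
    "s (rot u - u) = S2" "s (- u) = S3" "s (- rot u) = S4" "s (u - rot u) = S5" by blast
  have "shift (hex s) v u z \<longleftrightarrow> z + u \<in> hex s"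
    unfolding 1 using shift_straight[of "- u" "hex s" z] u by simp
  then show ?thesis unfolding 1 shift_straight[OF u] using z 1(2,3) len_nonneg_frame[OF pos u]
    by (simp only: hex_frame[OF u] len_frame[of s u] e frame_simps nrm_rot[OF u] hex_bounds_def) linarith
next
  case 2
  obtain a b S0 S1 S2 S3 S4 S5 where e: "nrm u z = a" "nrm (rot u) z = b" "s u = S0" "s (rot u) = S1"
    "s (rot u - u) = S2" "s (- u) = S3" "s (- rot u) = S4" "s (u - rot u) = S5" by blast
  show ?thesis unfolding 2 shift_right shift_left[OF u] using z 2(2-) len_nonneg_frame[OF pos u]
    by (simp only: hex_frame[OF u] len_frame[of s u] e frame_simps nrm_rot[OF u] hex_bounds_def) linarith
next
  case 3
  obtain a b S0 S1 S2 S3 S4 S5 where e: "nrm v z = a" "nrm (rot v) z = b" "s v = S0" "s (rot v) = S1"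
    "s (rot v - v) = S2" "s (- v) = S3" "s (- rot v) = S4" "s (v - rot v) = S5" by blast
  show ?thesis unfolding 3 shift_right shift_left[OF v] using z 3(2-) len_nonneg_frame[OF pos v]
    by (simp only: hex_frame[OF v] len_frame[of s v] e frame_simps nrm_rot[OF v] hex_bounds_def) linarith
qed

text \<open>The two chains leave out exactly the relative interiors of the sides through which the
  strand passes.\<close>

lemma shift_both_on_side:
  assumes u: "u \<in> units" and v: "v \<in> units" and m: "m \<in> units" and p: "pass s u v"
    and pos: "\<forall>m\<in>units. len s m \<ge> 0" and z: "z \<in> hex s" and sd: "nrm m z = s m"
  shows "(shift (hex s) u v z \<and> shift (hex s) v u z) \<longleftrightarrow>
    (m = u \<or> m = v) \<and> z + m \<in> hex s \<and> z - m \<in> hex s"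
  using p u v
proof (cases rule: pass_cases)
  case 1
  obtain a b S0 S1 S2 S3 S4 S5 where e: "nrm u z = a" "nrm (rot u) z = b" "s u = S0" "s (rot u) = S1"
    "s (rot u - u) = S2" "s (- u) = S3" "s (- rot u) = S4" "s (u - rot u) = S5" by blast
  have 4: "shift (hex s) (- u) u z \<longleftrightarrow> z + u \<in> hex s"
    using shift_straight[of "- u" "hex s" z] u by simp
  show ?thesis unfolding 1 4 shift_straight[OF u] using z 1(2,3) len_nonneg_frame[OF pos u] sd frame_distinct[OF u]
    by - (rule units_cases[OF u m],
        simp_all only: hex_frame[OF u] len_frame[of s u] e frame_simps nrm_rot[OF u] hex_bounds_def, auto)
next
  case 2
  obtain a b S0 S1 S2 S3 S4 S5 where e: "nrm u z = a" "nrm (rot u) z = b" "s u = S0" "s (rot u) = S1"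
    "s (rot u - u) = S2" "s (- u) = S3" "s (- rot u) = S4" "s (u - rot u) = S5" by blast
  show ?thesis unfolding 2 shift_right shift_left[OF u] using z 2(2-) len_nonneg_frame[OF pos u] sd frame_distinct[OF u]
    by - (rule units_cases[OF u m],
        simp_all only: hex_frame[OF u] len_frame[of s u] e frame_simps nrm_rot[OF u] hex_bounds_def, auto)
next
  case 3
  obtain a b S0 S1 S2 S3 S4 S5 where e: "nrm v z = a" "nrm (rot v) z = b" "s v = S0" "s (rot v) = S1"
    "s (rot v - v) = S2" "s (- v) = S3" "s (- rot v) = S4" "s (v - rot v) = S5" by blast
  show ?thesis unfolding 3 shift_right shift_left[OF v] using z 3(2-) len_nonneg_frame[OF pos v] sd frame_distinct[OF v]
    by - (rule units_cases[OF v m],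
        simp_all only: hex_frame[OF v] len_frame[of s v] e frame_simps nrm_rot[OF v] hex_bounds_def, auto)
qed

text \<open>Along a side of the tile the shift changes only where the chain of fixed points starts or
  ends: at the first edge of the side through which the strand enters, and at the last edge of the
  side through which it leaves. That these changes do not depend on the rest of the tile is what
  makes shifts of neighbouring tiles fit together.\<close>

lemma shift_profile:
  assumes u: "u \<in> units" and v: "v \<in> units" and m: "m \<in> units" and p: "pass s u v"
    and pos: "\<forall>m\<in>units. len s m \<ge> 0" and z: "z \<in> hex s" "z + m \<in> hex s" and sd: "nrm m z = s m"
  shows "of_bool (shift (hex s) u v (z + m)) - (of_bool (shift (hex s) u v z) :: int) =
    of_bool (m = u \<and> z - m \<notin> hex s) - of_bool (m = v \<and> z + m + m \<notin> hex s)"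
  using p u v
proof (cases rule: pass_cases)
  case 1
  obtain a b S0 S1 S2 S3 S4 S5 where e: "nrm u z = a" "nrm (rot u) z = b" "s u = S0" "s (rot u) = S1"
    "s (rot u - u) = S2" "s (- u) = S3" "s (- rot u) = S4" "s (u - rot u) = S5" by blast
  show ?thesis unfolding 1 shift_straight[OF u] using z 1(2,3) len_nonneg_frame[OF pos u] sd frame_distinct[OF u]
    by - (rule units_cases[OF u m],
        simp_all only: hex_frame[OF u] len_frame[of s u] e frame_simps nrm_rot[OF u] hex_bounds_def, auto)
next
  case 2
  obtain a b S0 S1 S2 S3 S4 S5 where e: "nrm u z = a" "nrm (rot u) z = b" "s u = S0" "s (rot u) = S1"
    "s (rot u - u) = S2" "s (- u) = S3" "s (- rot u) = S4" "s (u - rot u) = S5" by blast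
  show ?thesis unfolding 2 shift_right shift_left[OF u] using z 2(2-) len_nonneg_frame[OF pos u] sd frame_distinct[OF u]
    by - (rule units_cases[OF u m],
        simp_all only: hex_frame[OF u] len_frame[of s u] e frame_simps nrm_rot[OF u] hex_bounds_def, auto)
next
  case 3
  obtain a b S0 S1 S2 S3 S4 S5 where e: "nrm v z = a" "nrm (rot v) z = b" "s v = S0" "s (rot v) = S1"
    "s (rot v - v) = S2" "s (- v) = S3" "s (- rot v) = S4" "s (v - rot v) = S5" by blast
  show ?thesis unfolding 3 shift_right shift_left[OF v] using z 3(2-) len_nonneg_frame[OF pos v] sd frame_distinct[OF v]
    by - (rule units_cases[OF v m],
        simp_all only: hex_frame[OF v] len_frame[of s v] e frame_simps nrm_rot[OF v] hex_bounds_def, auto)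
qed

text \<open>A shift increases along \<open>m\<close> only where \<open>m\<close> leads away from the chain of fixed points. For a
  strand that does not use the direction of \<open>m\<close>, this takes a tile with both sides whose outer
  normals point against \<open>m\<close>, so there is no increase if one of these two sides is degenerate. The
  lemma controls the steepest edges of a concave function.\<close>

lemma shift_antimono:
  assumes u: "u \<in> units" and v: "v \<in> units" and m: "m \<in> units" and p: "pass s u v"
    and pos: "\<forall>m\<in>units. len s m \<ge> 0" and z: "z \<in> hex s" "z + m \<in> hex s"
    and nm: "m \<noteq> u" "m \<noteq> v" "m \<noteq> - u" "m \<noteq> - v"
    and left: "len s (ror m) = 0 \<or> len s (ror (ror m)) = 0"
    and sh: "shift (hex s) u v (z + m)"
  shows "shift (hex s) u v z"
proof -
  have left: "s m + s (- rot m) = s (m - rot m) \<or> s (m - rot m) + s (- m) = s (- rot m)"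
    using left unfolding len_def ror_eq rot_diff rot_rot by (auto simp: algebra_simps)
  have canc: "\<And>a b :: lpt. a - (a - b) = b" "\<And>a b :: lpt. a - b - a = - b" "\<And>a b :: lpt. - (a - b) = b - a"
    "\<And>a b :: lpt. - a - (b - a) = - b"
    "\<And>a b :: lpt. - a - (- b) = b - a" "\<And>a::lpt. - (- a) = a"
    by simp_all
  show ?thesis using p u v
  proof (cases rule: pass_cases)
    case 1
    obtain a b S0 S1 S2 S3 S4 S5 where e: "nrm u z = a" "nrm (rot u) z = b" "s u = S0" "s (rot u) = S1"
      "s (rot u - u) = S2" "s (- u) = S3" "s (- rot u) = S4" "s (u - rot u) = S5" by blast
    show ?thesis using sh left nm unfolding 1 shift_straight[OF u]
      using z 1(2,3) len_nonneg_frame[OF pos u] frame_distinct[OF u]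
      by - (rule units_cases[OF u m],
          simp_all only: hex_frame[OF u] len_frame[of s u] e frame_simps canc nrm_rot[OF u] hex_bounds_def, auto)
  next
    case 2
    obtain a b S0 S1 S2 S3 S4 S5 where e: "nrm u z = a" "nrm (rot u) z = b" "s u = S0" "s (rot u) = S1"
      "s (rot u - u) = S2" "s (- u) = S3" "s (- rot u) = S4" "s (u - rot u) = S5" by blast
    show ?thesis using sh left nm unfolding 2 shift_right shift_left[OF u]
      using z 2(2-) len_nonneg_frame[OF pos u] frame_distinct[OF u]
      by - (rule units_cases[OF u m],
          simp_all only: hex_frame[OF u] len_frame[of s u] e frame_simps canc nrm_rot[OF u] hex_bounds_def, auto)
  next
    case 3
    obtain a b S0 S1 S2 S3 S4 S5 where e: "nrm v z = a" "nrm (rot v) z = b" "s v = S0" "s (rot v) = S1"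
      "s (rot v - v) = S2" "s (- v) = S3" "s (- rot v) = S4" "s (v - rot v) = S5" by blast
    show ?thesis using sh left nm unfolding 3 shift_right shift_left[OF v]
      using z 3(2-) len_nonneg_frame[OF pos v] frame_distinct[OF v]
      by - (rule units_cases[OF v m],
          simp_all only: hex_frame[OF v] len_frame[of s v] e frame_simps canc nrm_rot[OF v] hex_bounds_def, auto)
  qed
qed

lemma pass_sym: "pass s u v \<Longrightarrow> pass s v u"
  by (auto simp: pass_def)

text \<open>A strand can always be continued. Let \<open>X\<close> be the set of directions of non-integral slope,
  which contains at least two of the three lines. If the opposite side \<open>- u\<close> is present, the
  strand goes straight. Otherwise, as the hexagon closes up, the two sides at 120 degrees to \<open>u\<close>
  are both present, and one of them belongs to \<open>X\<close>.\<close>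

lemma pass_exists:
  assumes u: "u \<in> units" and pos: "\<forall>m\<in>units. len s m \<ge> 0" and l: "len s u \<ge> 1"
    and X: "\<And>m. X (- m) \<longleftrightarrow> X m" "X u" "X (rot u) \<or> X (rot u - u)"
  shows "\<exists>v\<in>units. X v \<and> pass s u v"
proof -
  have L: "len s u - len s (- u) = len s (rot u - u) - len s (u - rot u)"
    "len s u - len s (- u) = len s (- rot u) - len s (rot u)"
    unfolding len_frame[of s u] by simp_all
  have L0: "0 \<le> len s (u - rot u)" "0 \<le> len s (rot u)" "0 \<le> len s (- u)"
    using len_nonneg_frame[OF pos u] by simp_all
  consider "len s (- u) \<ge> 1" | "len s (- u) = 0" "X (rot u - u)" | "len s (- u) = 0" "X (rot u)"
    using X L0 by force
  then show ?thesis
  proof cases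
    case 1
    then show ?thesis using l X u by (intro bexI[of _ "- u"]) (auto simp: pass_def)
  next
    case 2
    then show ?thesis using l X u L L0 by (intro bexI[of _ "rot u - u"]) (auto simp: pass_def)
  next
    case 3
    then show ?thesis using l X u L L0 by (intro bexI[of _ "- rot u"]) (auto simp: pass_def)
  qed
qed

section \<open>Unbalanced circulations\<close>

text \<open>Think of the elements of \<open>D\<close> as sides of tiles, of \<open>R\<close> as passing through a tile and of
  \<open>opp\<close> as crossing to the neighbouring tile; do this alternately. The walk starts on the boundary
  \<open>B\<close> if \<open>B\<close> is not empty; it ends when it reaches \<open>B\<close>, or else it becomes periodic, and then a
  period is cut out.\<close>

lemma alternating_walk:
  fixes D B :: "'a set"
  assumes "finite D" "D \<noteq> {}" "B \<subseteq> D"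
    and R: "\<And>d. d \<in> D \<Longrightarrow> \<exists>x\<in>D. R d x"
    and opp: "\<And>d. d \<in> D - B \<Longrightarrow> opp d \<in> D - B"
  obtains d x :: "nat \<Rightarrow> 'a" and m :: nat
  where "\<And>i. i \<le> m \<Longrightarrow> d i \<in> D \<and> x i \<in> D \<and> R (d i) (x i)"
    "\<And>i. i < m \<Longrightarrow> x i \<notin> B \<and> d (Suc i) = opp (x i)"
    "x m \<notin> B \<and> opp (x m) = d 0 \<or> d 0 \<in> B \<and> x m \<in> B"
proof -
  obtain p where p: "\<And>d. d \<in> D \<Longrightarrow> p d \<in> D \<and> R d (p d)"
    using R by metis
  obtain d0 where d0: "d0 \<in> D" "B \<noteq> {} \<Longrightarrow> d0 \<in> B"
    using assms(2,3) by (cases "B = {}") blast+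
  define d where "d n = ((\<lambda>t. opp (p t)) ^^ n) d0" for n
  have dS: "d (Suc n) = opp (p (d n))" for n by (simp add: d_def)
  have dD: "(\<forall>i<n. p (d i) \<notin> B) \<Longrightarrow> d n \<in> D" for n
  proof (induction n)
    case 0 then show ?case using d0 by (simp add: d_def)
  next
    case (Suc n)
    then have "d n \<in> D" by auto
    then show ?case using Suc.prems p opp dS by auto
  qed
  \<comment> \<open>The first \<open>m\<close> with \<open>Q m\<close> is where the walk stops: at the boundary, or just
    before a repetition.\<close>
  define Q where "Q m \<longleftrightarrow> p (d m) \<in> B \<or> d (Suc m) \<in> d ` {..m}" for m
  have "\<exists>m. Q m"
  proof (rule ccontr)
    assume "\<nexists>m. Q m"
    then have nQ: "p (d m) \<notin> B" "d (Suc m) \<notin> d ` {..m}" for m by (auto simp: Q_def)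
    have "d i \<noteq> d j" if "i < j" for i j
      using nQ(2)[of "j - 1"] that by (cases j) (auto, metis atMost_iff imageI less_Suc_eq_le)
    then have "inj d" by (metis injI linorder_neqE_nat)
    moreover have "range d \<subseteq> D" using dD nQ by auto
    ultimately show False using \<open>finite D\<close> finite_imageD infinite_UNIV_nat finite_subset by blast
  qed
  define m where "m = (LEAST m. Q m)"
  have Qm: "Q m" and less: "\<And>i. i < m \<Longrightarrow> \<not> Q i"
    using \<open>\<exists>m. Q m\<close> unfolding m_def by (auto intro: LeastI dest: not_less_Least)
  have step: "p (d i) \<notin> B" if "i < m" for i using less[OF that] by (simp add: Q_def)
  have mem: "d i \<in> D" if "i \<le> m" for i using dD step that by auto
  show ?thesis
  proof (cases "p (d m) \<in> B")
    case True
    then have "d 0 \<in> B" using d0(2) by (auto simp: d_def)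
    then show ?thesis
      using True mem p step dS by (intro that[of m d "\<lambda>i. p (d i)"]) auto
  next
    case False
    then obtain i where i: "i \<le> m" "d (Suc m) = d i" using Qm by (auto simp: Q_def)
    show ?thesis
    proof (rule that[of "m - i" "\<lambda>k. d (i + k)" "\<lambda>k. p (d (i + k))"])
      fix k assume "k \<le> m - i"
      then have "i + k \<le> m" using i by simp
      then show "d (i + k) \<in> D \<and> p (d (i + k)) \<in> D \<and> R (d (i + k)) (p (d (i + k)))"
        using mem p by blast
    next
      fix k assume "k < m - i"
      then have "i + k < m" by simp
      then show "p (d (i + k)) \<notin> B \<and> d (i + Suc k) = opp (p (d (i + k)))"
        using step dS[of "i + k"] by simp
    next
      have "i + (m - i) = m" using i by simp
      then show "p (d (i + (m - i))) \<notin> B \<and> opp (p (d (i + (m - i)))) = d (i + 0)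
          \<or> d (i + 0) \<in> B \<and> p (d (i + (m - i))) \<in> B"
        using False i(2) dS[of m] by simp
    qed
  qed
qed

text \<open>The passes of an alternating walk form a circulation. It would be useless if every dart were
  traversed equally often inwards and outwards, for example if a walk returned on its own path. In
  that case there is a segment of the walk that leaves through the dart by which it entered;
  reverse the direction of a shortest such segment. The result is a circulation again, and by
  minimality the first dart by which the segment used to leave is now traversed more often in one
  direction.\<close>

lemma unbalanced_circulation:
  fixes D B :: "'a set"
  assumes fin: "finite D" and ne: "D \<noteq> {}" and BD: "B \<subseteq> D"
    and R: "\<And>d. d \<in> D \<Longrightarrow> \<exists>x\<in>D. R d x"
    and sym: "\<And>d x. R d x \<Longrightarrow> R x d" and irr: "\<And>d. \<not> R d d"
    and opp: "\<And>d. d \<in> D - B \<Longrightarrow> opp d \<in> D - B \<and> opp (opp d) = d \<and> opp d \<noteq> d"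
  obtains N :: "'a \<Rightarrow> 'a \<Rightarrow> int"
  where "\<And>d x. N d x \<ge> 0" "\<And>d x. N d x \<noteq> 0 \<Longrightarrow> d \<in> D \<and> x \<in> D \<and> R d x"
    "\<And>d. d \<in> D - B \<Longrightarrow> (\<Sum>x\<in>D. N d x) = (\<Sum>x\<in>D. N x (opp d))"
    "\<exists>d\<in>D. (\<Sum>x\<in>D. N d x) \<noteq> (\<Sum>x\<in>D. N x d)"
proof -
  obtain d x m where
    mem: "\<And>i. i \<le> m \<Longrightarrow> d i \<in> D \<and> x i \<in> D \<and> R (d i) (x i)"
    and step: "\<And>i. i < m \<Longrightarrow> x i \<notin> B \<and> d (Suc i) = opp (x i)"
    and close: "x m \<notin> B \<and> opp (x m) = d 0 \<or> d 0 \<in> B \<and> x m \<in> B"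
  proof (rule alternating_walk[of D B R opp, OF fin ne BD])
    show "\<And>d. d \<in> D \<Longrightarrow> \<exists>x\<in>D. R d x" by (rule R)
    show "\<And>d. d \<in> D - B \<Longrightarrow> opp d \<in> D - B" using opp by simp
  qed (rule that)
  \<comment> \<open>The sequence \<open>a\<close> lists the darts that are entered, and \<open>b\<close> those by which the
    walk leaves.\<close>
  define flow :: "(nat \<Rightarrow> 'a) \<Rightarrow> (nat \<Rightarrow> 'a) \<Rightarrow> 'a \<Rightarrow> 'a \<Rightarrow> int"
    where "flow a b p q = (\<Sum>i\<le>m. of_bool (a i = p \<and> b i = q))" for a b p q
  define cnt :: "(nat \<Rightarrow> 'a) \<Rightarrow> nat set \<Rightarrow> 'a \<Rightarrow> int"
    where "cnt a I p = (\<Sum>i\<in>I. of_bool (a i = p))" for a I p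
  have row: "(\<Sum>q\<in>D. flow a b p q) = cnt a {..m} p" if "\<And>i. i \<le> m \<Longrightarrow> b i \<in> D" for a b p
  proof -
    have "(\<Sum>q\<in>D. flow a b p q) = (\<Sum>i\<le>m. \<Sum>q\<in>D. of_bool (a i = p \<and> b i = q))"
      unfolding flow_def by (rule sum.swap)
    also have "\<dots> = (\<Sum>i\<le>m. of_bool (a i = p))"
    proof (rule sum.cong[OF refl])
      fix i assume "i \<in> {..m}"
      have "(\<Sum>q\<in>D. of_bool (a i = p \<and> b i = q)) = (\<Sum>q\<in>D. if b i = q then of_bool (a i = p) else (0::int))"
        by (rule sum.cong) auto
      then show "(\<Sum>q\<in>D. of_bool (a i = p \<and> b i = q)) = (of_bool (a i = p) :: int)"
        using that \<open>i \<in> {..m}\<close> fin by (simp add: sum.delta')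
    qed
    finally show ?thesis by (simp add: cnt_def)
  qed
  have flow_ex: "\<exists>i\<le>m. a i = p \<and> b i = q" if "flow a b p q \<noteq> 0" for a b p q
  proof (rule ccontr)
    assume "\<not> ?thesis"
    then have "flow a b p q = 0" unfolding flow_def by (intro sum.neutral) auto
    with that show False by simp
  qed
  have flow_swap: "flow a b p q = flow b a q p" for a b p q
    unfolding flow_def by (rule sum.cong) auto
  have col: "(\<Sum>p\<in>D. flow a b p q) = cnt b {..m} q" if "\<And>i. i \<le> m \<Longrightarrow> a i \<in> D" for a b q
    using row[of a b q] that by (simp add: flow_swap[of b a])
  have shift: "cnt x {i..<j} p = cnt d {Suc i..<Suc j} (opp p)"
    if "j \<le> m" "p \<in> D - B" for i j p
  proof -
    have "cnt d {Suc i..<Suc j} (opp p) = (\<Sum>k = i..<j. of_bool (d (Suc k) = opp p))"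
      unfolding cnt_def by (rule sum.shift_bounds_Suc_ivl)
    also have "\<dots> = cnt x {i..<j} p" unfolding cnt_def
    proof (rule sum.cong[OF refl])
      fix k assume "k \<in> {i..<j}"
      then have "k < m" using that by auto
      then have "x k \<in> D - B" "d (Suc k) = opp (x k)" using step mem[of k] by auto
      then have "d (Suc k) = opp p \<longleftrightarrow> x k = p" using opp that(2) by metis
      then show "of_bool (d (Suc k) = opp p) = (of_bool (x k = p) :: int)" by simp
    qed
    finally show ?thesis by simp
  qed
  have all: "cnt d {..m} p = cnt x {..m} (opp p)" if p: "p \<in> D - B" for p
  proof -
    have op: "opp p \<in> D - B" "opp (opp p) = p" using opp p by auto
    have "cnt d {..m} p = of_bool (d 0 = p) + cnt d {Suc 0..<Suc m} p"
    proof -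
      have "{..m} = insert 0 {Suc 0..<Suc m}" by auto
      then show ?thesis unfolding cnt_def by (simp del: sum_of_bool_eq)
    qed
    also have "cnt d {Suc 0..<Suc m} p = cnt x {0..<m} (opp p)"
      using shift[of m "opp p" 0] op by simp
    also have "of_bool (d 0 = p) = (of_bool (x m = opp p) :: int)"
    proof -
      have "d 0 = p \<longleftrightarrow> x m = opp p"
      proof (cases "x m \<in> B")
        case True
        then have "d 0 \<in> B" using close by auto
        then show ?thesis using True p op by auto
      next
        case False
        then have "x m \<in> D - B" "d 0 = opp (x m)" using close mem[of m] by auto
        then show ?thesis using opp[of "x m"] op by metis
      qed
      then show ?thesis by simp
    qed
    finally have e: "cnt d {..m} p = of_bool (x m = opp p) + cnt x {0..<m} (opp p)" .
    have "{..m} = insert m {0..<m}" by auto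
    then have "cnt x {..m} (opp p) = of_bool (x m = opp p) + cnt x {0..<m} (opp p)"
      by (simp add: cnt_def del: sum_of_bool_eq)
    with e show ?thesis by simp
  qed
  show ?thesis
  proof (cases "\<exists>p\<in>D. cnt d {..m} p \<noteq> cnt x {..m} p")
    case True
    show ?thesis
    proof (rule that[of "flow d x"])
      show "flow d x p q \<ge> 0" for p q unfolding flow_def by (rule sum_nonneg) simp
      show "p \<in> D \<and> q \<in> D \<and> R p q" if "flow d x p q \<noteq> 0" for p q
      proof -
        obtain i where "i \<le> m" "d i = p" "x i = q"
          using \<open>flow d x p q \<noteq> 0\<close> using flow_ex by blast
        then show ?thesis using mem by auto
      qed
    qed (use True all mem in \<open>auto simp: row col\<close>)
  next
    case False
    then have bal: "\<And>p. p \<in> D \<Longrightarrow> cnt d {..m} p = cnt x {..m} p" by auto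
    \<comment> \<open>The segment from \<open>i\<close> to \<open>j\<close> leaves through the dart by which it entered.\<close>
    define P where "P i j \<longleftrightarrow> i < j \<and> j \<le> m \<and> d i = x j" for i j
    have "\<exists>j. P 0 j"
    proof -
      have "cnt d {..m} (d 0) \<noteq> 0"
      proof -
        have "cnt d {..m} (d 0) \<ge> (\<Sum>i\<in>{0}. of_bool (d i = d 0))"
          unfolding cnt_def by (rule sum_mono2) auto
        then show ?thesis by simp
      qed
      then have "cnt x {..m} (d 0) \<noteq> 0" using bal mem[of 0] by auto
      then obtain j where "j \<le> m" "x j = d 0"
        unfolding cnt_def by (meson atMost_iff of_bool_eq_0_iff sum.not_neutral_contains_not_neutral)
      moreover have "j \<noteq> 0" using irr[of "d 0"] mem[of 0] \<open>x j = d 0\<close> by (cases "j = 0") auto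
      ultimately show ?thesis unfolding P_def by auto
    qed
    then obtain j0 where "P 0 (0 + j0)" by auto
    then have "\<exists>l i. P i (i + l)" by blast
    then obtain l where "\<exists>i. P i (i + l)" and lmin: "\<And>l'. l' < l \<Longrightarrow> \<not> (\<exists>i. P i (i + l'))"
      using exists_least_iff[of "\<lambda>l. \<exists>i. P i (i + l)"] by auto
    then obtain i where Pi: "P i (i + l)" by blast
    define j where "j = i + l"
    have ij: "i < j" "j \<le> m" "d i = x j" using Pi by (auto simp: P_def j_def)
    \<comment> \<open>Otherwise a shorter segment would start right after \<open>i\<close>.\<close>
    have none: "d t \<noteq> x i" if t: "i \<le> t" "t \<le> j" for t
    proof
      assume e: "d t = x i"
      have "t \<noteq> i" using e irr[of "d i"] mem[of i] ij by (cases "t = i") auto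
      then obtain t' where t': "t = Suc t'" "i \<le> t'" using t by (cases t) auto
      have lt: "t' < m" "i < m" using t t' ij by auto
      have xB: "x t' \<in> D - B" "x i \<in> D - B" using step[OF lt(1)] step[OF lt(2)] mem[of t'] mem[of i] lt by auto
      have s1: "opp (x t') = x i" using step[OF lt(1)] e t'(1) by simp
      have s2: "d (Suc i) = opp (x i)" using step[OF lt(2)] by simp
      have e2: "x t' = d (Suc i)" "opp (x i) \<noteq> x i" using opp[OF xB(1)] opp[OF xB(2)] s1 s2 by auto
      have "t' \<noteq> i" using e2 s2 by auto
      moreover have "t' \<noteq> Suc i" using e2 irr[of "d t'"] mem[of t'] t t' ij by (cases "t' = Suc i") auto
      ultimately have "Suc i < t'" using t' by auto
      then have "P (Suc i) t'" using e2 t t' ij by (auto simp: P_def)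
      then have "P (Suc i) (Suc i + (t' - Suc i))" using \<open>Suc i < t'\<close> by simp
      moreover have "t' - Suc i < l" using t t' \<open>Suc i < t'\<close> by (auto simp: j_def)
      ultimately show False using lmin by blast
    qed
    define I where "I = {i..<Suc j}"
    have I: "I \<subseteq> {..m}" using ij by (auto simp: I_def)
    \<comment> \<open>Reversing the segment exchanges the roles of entering and leaving.\<close>
    define a where "a k = (if k \<in> I then x k else d k)" for k
    define b where "b k = (if k \<in> I then d k else x k)" for k
    have ca: "cnt a {..m} p = cnt d {..m} p + (cnt x I p - cnt d I p)" for p
    proof -
      have "cnt a {..m} p = cnt a ({..m} - I) p + cnt a I p"
        unfolding cnt_def using I by (intro sum.subset_diff) auto
      moreover have "cnt d {..m} p = cnt d ({..m} - I) p + cnt d I p"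
        unfolding cnt_def using I by (intro sum.subset_diff) auto
      moreover have "cnt a ({..m} - I) p = cnt d ({..m} - I) p" "cnt a I p = cnt x I p"
        unfolding cnt_def by (auto simp: a_def intro!: sum.cong)
      ultimately show ?thesis by simp
    qed
    have cb: "cnt b {..m} p = cnt x {..m} p - (cnt x I p - cnt d I p)" for p
    proof -
      have "cnt b {..m} p = cnt b ({..m} - I) p + cnt b I p"
        unfolding cnt_def using I by (intro sum.subset_diff) auto
      moreover have "cnt x {..m} p = cnt x ({..m} - I) p + cnt x I p"
        unfolding cnt_def using I by (intro sum.subset_diff) auto
      moreover have "cnt b ({..m} - I) p = cnt x ({..m} - I) p" "cnt b I p = cnt d I p"
        unfolding cnt_def by (auto simp: b_def intro!: sum.cong)
      ultimately show ?thesis by simp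
    qed
    have ends: "cnt x I p - cnt d I p = cnt x {i..<j} p - cnt d {Suc i..<Suc j} p" for p
    proof -
      have "cnt x I p = cnt x {i..<j} p + of_bool (x j = p)"
        unfolding cnt_def I_def using ij by (simp del: sum_of_bool_eq)
      moreover have "cnt d I p = of_bool (d i = p) + cnt d {Suc i..<Suc j} p"
        unfolding cnt_def I_def using ij by (simp add: sum.atLeast_Suc_lessThan del: sum_of_bool_eq)
      ultimately show ?thesis using ij by simp
    qed
    have anti: "cnt x I (opp p) - cnt d I (opp p) = - (cnt x I p - cnt d I p)" if p: "p \<in> D - B" for p
      using shift[of j p i] shift[of j "opp p" i] opp[OF p] p ij by (simp add: ends)
    have memab: "a k \<in> D \<and> b k \<in> D \<and> R (a k) (b k)" if "k \<le> m" for k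
      using mem[OF that] sym by (auto simp: a_def b_def)
    show ?thesis
    proof (rule that[of "flow a b"])
      show "flow a b p q \<ge> 0" for p q unfolding flow_def by (rule sum_nonneg) simp
      show "p \<in> D \<and> q \<in> D \<and> R p q" if "flow a b p q \<noteq> 0" for p q
      proof -
        obtain k where "k \<le> m" "a k = p" "b k = q"
          using \<open>flow a b p q \<noteq> 0\<close> using flow_ex by blast
        then show ?thesis using memab by auto
      qed
      show "(\<Sum>q\<in>D. flow a b p q) = (\<Sum>q\<in>D. flow a b q (opp p))" if p: "p \<in> D - B" for p
        using all[OF p] anti[OF p] memab by (simp add: row col ca cb)
      have "cnt d I (x i) = 0" unfolding cnt_def I_def using none by (intro sum.neutral) auto
      moreover have "cnt x I (x i) \<ge> 1"
      proof -
        have "cnt x I (x i) \<ge> (\<Sum>k\<in>{i}. of_bool (x k = x i))"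
          unfolding cnt_def I_def using ij by (intro sum_mono2) auto
        then show ?thesis by simp
      qed
      moreover have "x i \<in> D" using mem ij by auto
      ultimately have "cnt a {..m} (x i) \<noteq> cnt b {..m} (x i)" using bal[of "x i"] by (simp add: ca cb)
      then show "\<exists>p\<in>D. (\<Sum>q\<in>D. flow a b p q) \<noteq> (\<Sum>q\<in>D. flow a b q p)"
        using \<open>x i \<in> D\<close> memab by (auto simp: row col)
    qed
  qed
qed

section \<open>Walking from triangle to triangle\<close>

text \<open>The flag \<open>(z, u)\<close> is the triangle \<open>z\<close>, \<open>z + u\<close>, \<open>z + rot u\<close> together with its edge from \<open>z\<close>
  to \<open>z + u\<close>, which has the triangle on its left. The triangle on the other side of this edge has
  the flag \<open>(z + u, - u)\<close>, and turning a flag to the next edge of the same triangle gives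
  \<open>(z + u, rot u - u)\<close>.\<close>

definition flags :: "lpt set \<Rightarrow> (lpt \<times> lpt) set" where
  "flags V = {(z, u). u \<in> units \<and> z \<in> V \<and> z + u \<in> V \<and> z + rot u \<in> V}"

lemma flagsD:
  assumes "(z, u) \<in> flags V"
  shows "u \<in> units" "z \<in> V" "z + u \<in> V" "z + rot u \<in> V"
  using assms by (auto simp: flags_def)

lemma flags_rot: "(z, u) \<in> flags V \<Longrightarrow> (z + u, rot u - u) \<in> flags V"
  by (auto simp: flags_def)

lemma nrm_decomp:
  assumes "u \<in> units"
  shows "nrm c x = nrm (rot u) x * nrm c u - nrm u x * nrm c (rot u)"
  using assms unfolding units_def by (auto simp: nrm_def rot_def algebra_simps)

lemma point_eqI:
  assumes "u \<in> units" "nrm u w = nrm u z" "nrm (rot u) w = nrm (rot u) z"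
  shows "w = z"
  using assms unfolding units_def by (auto simp: nrm_def rot_def prod_eq_iff)

lemma triangle_lattice_point:
  assumes u: "u \<in> units" and "nrm u w \<le> nrm u z" "nrm (rot u) w \<ge> nrm (rot u) z"
    "nrm (rot u - u) w \<le> nrm (rot u - u) z + 1"
  shows "w = z \<or> w = z + u \<or> w = z + rot u"
proof -
  consider "nrm u w = nrm u z" "nrm (rot u) w = nrm (rot u) z"
    | "nrm u w = nrm u z" "nrm (rot u) w = nrm (rot u) z + 1"
    | "nrm u w = nrm u z - 1" "nrm (rot u) w = nrm (rot u) z"
    using assms(2-4) by fastforce
  then show ?thesis
  proof cases
    case 1 then show ?thesis using point_eqI[OF u] by simp
  next
    case 2 then have "w = z + u" using point_eqI[OF u] u by simp
    then show ?thesis by simp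
  next
    case 3 then have "w = z + rot u" using point_eqI[OF u] u by simp
    then show ?thesis by simp
  qed
qed

definition nrmR :: "lpt \<Rightarrow> real \<times> real \<Rightarrow> real" where
  "nrmR u t = real_of_int (snd u) * fst t - real_of_int (fst u) * snd t"

lemma nrmR_simps [simp]:
  "nrmR (u + v) t = nrmR u t + nrmR v t"
  "nrmR (u - v) t = nrmR u t - nrmR v t"
  "nrmR (- u) t = - nrmR u t"
  by (simp_all add: nrmR_def algebra_simps)

text \<open>The number of unit strips between \<open>x\<close> and the strip from \<open>l\<close> to \<open>l + 1\<close>.\<close>

definition gap :: "real \<Rightarrow> int \<Rightarrow> nat" where
  "gap x l = nat \<lceil>of_int l - x\<rceil> + nat \<lceil>x - of_int l - 1\<rceil>"

lemma gap_minus: "gap (- x) (- 1 - l) = gap x l"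
  by (simp add: gap_def algebra_simps)

lemma gap_less:
  assumes "x > of_int l + 1"
  shows "gap x (l + 1) < gap x l"
proof -
  have "x - of_int (l + 1) - 1 = (x - of_int l - 1) - of_int 1" by simp
  then have "\<lceil>x - of_int (l + 1) - 1\<rceil> = \<lceil>x - of_int l - 1\<rceil> - 1"
    by (simp only: ceiling_diff_of_int)
  moreover have "\<lceil>x - of_int l - 1\<rceil> \<ge> 1" using assms by linarith
  moreover have "\<lceil>of_int (l + 1) - x\<rceil> \<le> 0" using assms by simp
  ultimately show ?thesis unfolding gap_def by linarith
qed

text \<open>A walk towards the target \<open>t\<close>: as long as \<open>t\<close> lies strictly beyond an edge of the current
  triangle, cross that edge. A triangle lies in one strip in each of the three directions of
  lines, and crossing an edge towards \<open>t\<close> reduces the distance to \<open>t\<close> counted in strips of one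
  direction, while the other two distances do not change. Suitable choices of \<open>F\<close> turn local
  properties of neighbouring triangles into global ones.\<close>

lemma triangle_walk:
  fixes t :: "real \<times> real"
  assumes "f \<in> F" and U: "\<And>z u. (z, u) \<in> F \<Longrightarrow> u \<in> units"
    and rotc: "\<And>z u. (z, u) \<in> F \<Longrightarrow> (z + u, rot u - u) \<in> F"
    and cross: "\<And>z u. (z, u) \<in> F \<Longrightarrow> nrmR u t > nrm u z \<Longrightarrow> (z + u, - u) \<in> F"
  obtains z u where "(z, u) \<in> F" "nrmR u t \<le> nrm u z"
    "nrmR (rot u) t \<ge> nrm (rot u) z" "nrmR (rot u - u) t \<le> nrm (rot u - u) z + 1"
proof -
  \<comment> \<open>The distance to \<open>t\<close>, counted in strips, summed over the three directions. It is
    independent of the choice of the flag within a triangle. The triangle lies on the side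
    \<open>nrm u \<le> nrm u z\<close> of its edge, which explains the offset \<open>- 1\<close>.\<close>
  define \<mu> where "\<mu> f = (case f of (z, u) \<Rightarrow> gap (nrmR u t) (nrm u z - 1) +
    gap (nrmR (rot u) t) (nrm (rot u) z) + gap (nrmR (rot u - u) t) (nrm (rot u - u) z))" for f
  have \<mu>_rot: "\<mu> (z + u, rot u - u) = \<mu> (z, u)" if "u \<in> units" for z u
  proof -
    have "gap (- nrmR u t) (- nrm u z) = gap (nrmR u t) (nrm u z - 1)"
      using gap_minus[of "nrmR u t" "nrm u z - 1"] by simp
    moreover have "gap (- nrmR (rot u) t) (- 1 - nrm (rot u) z) = gap (nrmR (rot u) t) (nrm (rot u) z)"
      by (rule gap_minus)
    ultimately show ?thesis using that by (simp add: \<mu>_def algebra_simps)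
  qed
  have \<mu>_cross: "\<mu> (z + u, - u) < \<mu> (z, u)" if "u \<in> units" "nrmR u t > nrm u z" for z u
  proof -
    have "gap (- nrmR u t) (- nrm u z - 1) = gap (nrmR u t) (nrm u z)"
      using gap_minus[of "nrmR u t" "nrm u z"] by (simp add: gap_def algebra_simps)
    moreover have "gap (- nrmR (rot u) t) (- 1 - nrm (rot u) z) = gap (nrmR (rot u) t) (nrm (rot u) z)"
      by (rule gap_minus)
    moreover have "gap (- nrmR (rot u - u) t) (- 1 - nrm (rot u - u) z) = gap (nrmR (rot u - u) t) (nrm (rot u - u) z)"
      by (rule gap_minus)
    moreover have "gap (nrmR u t) (nrm u z) < gap (nrmR u t) (nrm u z - 1)"
      using gap_less[of "nrm u z - 1" "nrmR u t"] that by simp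
    ultimately show ?thesis using that by (simp add: \<mu>_def algebra_simps)
  qed
  from \<open>f \<in> F\<close> show ?thesis
  proof (induction "\<mu> f" arbitrary: f rule: less_induct)
    case less
    obtain z u where f: "f = (z, u)" by (cases f)
    have zu: "(z, u) \<in> F" "u \<in> units" using less.prems f U by auto
    have step: ?thesis if "(y, v) \<in> F" "\<mu> (y, v) = \<mu> f" "nrmR v t > nrm v y" for y v
      using less.hyps[of "(y + v, - v)"] \<mu>_cross[of v y] cross[of y v] U[of y v] that by simp
    have r1: "(z + u, rot u - u) \<in> F" using rotc[OF zu(1)] .
    have r2: "(z + rot u, - rot u) \<in> F" using rotc[OF r1] by simp
    have m1: "\<mu> (z + u, rot u - u) = \<mu> f" using \<mu>_rot zu f by simp
    have m2: "\<mu> (z + rot u, - rot u) = \<mu> f"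
      using \<mu>_rot[of "rot u - u" "z + u"] zu m1 by simp
    consider "nrmR u t > nrm u z" | "nrmR (rot u - u) t > nrm (rot u - u) (z + u)"
      | "nrmR (- rot u) t > nrm (- rot u) (z + rot u)"
      | "nrmR u t \<le> nrm u z" "nrmR (rot u - u) t \<le> nrm (rot u - u) (z + u)"
        "nrmR (- rot u) t \<le> nrm (- rot u) (z + rot u)" by linarith
    then show ?thesis
    proof cases
      case 1 then show ?thesis using step zu f by blast
    next
      case 2 then show ?thesis using step[OF r1 m1] by blast
    next
      case 3 then show ?thesis using step[OF r2 m2] by blast
    next
      case 4 then show ?thesis using that[OF zu(1)] zu(2) by simp
    qed
  qed
qed

lemma triangle_walk_lattice:
  fixes w :: lpt
  assumes "f \<in> F" and U: "\<And>z u. (z, u) \<in> F \<Longrightarrow> u \<in> units"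
    and rotc: "\<And>z u. (z, u) \<in> F \<Longrightarrow> (z + u, rot u - u) \<in> F"
    and cross: "\<And>z u. (z, u) \<in> F \<Longrightarrow> nrm u w > nrm u z \<Longrightarrow> (z + u, - u) \<in> F"
  shows "\<exists>u. (w, u) \<in> F"
proof -
  define t where "t = (real_of_int (fst w), real_of_int (snd w))"
  have t: "nrmR u t = nrm u w" for u by (simp add: t_def nrmR_def nrm_def)
  obtain z u where zu: "(z, u) \<in> F" "nrmR u t \<le> nrm u z"
    "nrmR (rot u) t \<ge> nrm (rot u) z" "nrmR (rot u - u) t \<le> nrm (rot u - u) z + 1"
    proof (rule triangle_walk[where t = t, OF assms(1) U rotc])
    fix z u assume "(z, u) \<in> F" "nrmR u t > nrm u z"
    then show "(z + u, - u) \<in> F" using cross t by simp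
  qed (auto intro: that)
  then have i: "nrm u w \<le> nrm u z" "nrm (rot u) w \<ge> nrm (rot u) z"
    "nrm (rot u - u) w \<le> nrm (rot u - u) z + 1"
    unfolding t by linarith+
  have u: "u \<in> units" using U zu(1) by blast
  have r1: "(z + u, rot u - u) \<in> F" using rotc[OF zu(1)] .
  have r2: "(z + rot u, - rot u) \<in> F" using rotc[OF r1] by simp
  show ?thesis using triangle_lattice_point[OF u i] zu(1) r1 r2 by blast
qed

section \<open>Concave lattice functions\<close>

lemma flags_cross:
  assumes "(z, u) \<in> flags (hex S)" "w \<in> hex S" "nrm u w > nrm u z"
  shows "(z + u, - u) \<in> flags (hex S)"
proof -
  note f = flagsD[OF assms(1)]
  have "z + u - rot u \<in> hex S"
    using f(2-4) assms(2,3)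
    by (simp only: hex_frame[OF f(1)] frame_simps nrm_rot[OF f(1)] hex_bounds_def) linarith
  then show ?thesis using f by (auto simp: flags_def)
qed

text \<open>Concavity of the piecewise affine interpolation, tested on the two triangles at each inner
  edge.\<close>

definition lattice_concave :: "lpt set \<Rightarrow> (lpt \<Rightarrow> real) \<Rightarrow> bool" where
  "lattice_concave V g \<longleftrightarrow> (\<forall>z u. (z, u) \<in> flags V \<and> (z + u, - u) \<in> flags V \<longrightarrow>
     g (z + rot u) + g (z + ror u) \<le> g z + g (z + u))"

text \<open>The affine function that agrees with \<open>g\<close> on the triangle of the flag \<open>(z, u)\<close>.\<close>

definition aff :: "(lpt \<Rightarrow> real) \<Rightarrow> lpt \<Rightarrow> lpt \<Rightarrow> lpt \<Rightarrow> real" where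
  "aff g z u w = g z + of_int (nrm (rot u) (w - z)) * (g (z + u) - g z)
     - of_int (nrm u (w - z)) * (g (z + rot u) - g z)"

lemma aff_vertex:
  assumes "u \<in> units"
  shows "aff g z u z = g z" "aff g z u (z + u) = g (z + u)" "aff g z u (z + rot u) = g (z + rot u)"
  using assms by (simp_all add: aff_def)

lemma aff_rot:
  assumes "u \<in> units"
  shows "aff g (z + u) (rot u - u) w = aff g z u w"
  using assms by (simp add: aff_def algebra_simps)

text \<open>The affine functions of two neighbouring triangles agree on the line through the common
  edge, and their difference is governed by the concavity defect of that edge.\<close>

lemma aff_cross:
  assumes "u \<in> units"
  shows "aff g (z + u) (- u) w = aff g z u w
    - of_int (nrm u (w - z)) * (g z + g (z + u) - g (z + rot u) - g (z + ror u))"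
  using assms by (simp add: aff_def ror_eq algebra_simps)

lemma aff_diff:
  "aff g z u (w + v) - aff g z u w = of_int (nrm (rot u) v) * (g (z + u) - g z)
     - of_int (nrm u v) * (g (z + rot u) - g z)"
  by (simp add: aff_def algebra_simps)

lemma aff_aff:
  assumes v: "v \<in> units"
  shows "aff (aff g z u) y v = aff g z u"
proof
  fix w
  define p where "p = g (z + u) - g z"
  define q where "q = g (z + rot u) - g z"
  have A: "aff g z u (y + x) - aff g z u y = of_int (nrm (rot u) x) * p - of_int (nrm u x) * q" for x
    unfolding p_def q_def by (rule aff_diff)
  have d: "nrm (rot u) (w - y) = nrm (rot v) (w - y) * nrm (rot u) v - nrm v (w - y) * nrm (rot u) (rot v)"
    "nrm u (w - y) = nrm (rot v) (w - y) * nrm u v - nrm v (w - y) * nrm u (rot v)"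
    by (rule nrm_decomp[OF v])+
  have "aff (aff g z u) y v w - aff g z u y =
      of_int (nrm (rot v) (w - y)) * (aff g z u (y + v) - aff g z u y)
      - of_int (nrm v (w - y)) * (aff g z u (y + rot v) - aff g z u y)"
    unfolding aff_def[of "aff g z u"] by simp
  also have "\<dots> = of_int (nrm (rot u) (w - y)) * p - of_int (nrm u (w - y)) * q"
    unfolding A d by (simp add: algebra_simps)
  also have "\<dots> = aff g z u w - aff g z u y" using A[of "w - y"] by simp
  finally show "aff (aff g z u) y v w = aff g z u w" by simp
qed

lemma aff_cong:
  assumes "g y = h y" "g (y + v) = h (y + v)" "g (y + rot v) = h (y + rot v)"
  shows "aff g y v = aff h y v"
  using assms by (simp add: aff_def fun_eq_iff)

text \<open>Local concavity implies global concavity: walk from the triangle of \<open>(z, u)\<close> to the point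
  \<open>w\<close>. At each crossing the value at \<open>w\<close> of the current affine function does not increase, and at
  the end it is \<open>g w\<close>.\<close>

lemma lattice_concave_below_aff:
  assumes g: "lattice_concave (hex S) g" and f: "(z, u) \<in> flags (hex S)" and w: "w \<in> hex S"
  shows "g w \<le> aff g z u w"
proof -
  \<comment> \<open>The triangles whose affine functions are at \<open>w\<close> at most as large as that of the
    first triangle.\<close>
  define F where "F = {(y, v). (y, v) \<in> flags (hex S) \<and> aff g y v w \<le> aff g z u w}"
  have "\<exists>v. (w, v) \<in> F"
  proof (rule triangle_walk_lattice[of "(z, u)"])
    show "(z, u) \<in> F" using f by (simp add: F_def)
    show "\<And>y v. (y, v) \<in> F \<Longrightarrow> v \<in> units" by (auto simp: F_def flags_def)
    show "(y + v, rot v - v) \<in> F" if "(y, v) \<in> F" for y v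
    proof -
      have fl: "(y, v) \<in> flags (hex S)" "aff g y v w \<le> aff g z u w" using that unfolding F_def by blast+
      then show ?thesis using flags_rot[OF fl(1)] aff_rot[OF flagsD(1)[OF fl(1)], of g y w] by (simp add: F_def)
    qed
    show "(y + v, - v) \<in> F" if yv: "(y, v) \<in> F" "nrm v w > nrm v y" for y v
    proof -
      have fl: "(y, v) \<in> flags (hex S)" "aff g y v w \<le> aff g z u w" using yv unfolding F_def by blast+
      have c: "(y + v, - v) \<in> flags (hex S)" by (rule flags_cross[OF fl(1) w yv(2)])
      then have "g (y + rot v) + g (y + ror v) \<le> g y + g (y + v)"
        using g fl(1) unfolding lattice_concave_def by blast
      then have "0 \<le> of_int (nrm v (w - y)) * (g y + g (y + v) - g (y + rot v) - g (y + ror v))"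
        using yv(2) by (intro mult_nonneg_nonneg) auto
      then show ?thesis using c fl aff_cross[OF flagsD(1)[OF fl(1)], of g y w] by (simp add: F_def)
    qed
  qed
  then obtain v where "(w, v) \<in> flags (hex S)" "aff g w v w \<le> aff g z u w" by (auto simp: F_def)
  then show ?thesis using aff_vertex(1)[OF flagsD(1)[of w v], of "hex S" g w] by simp
qed

text \<open>The piece of linearity of \<open>g\<close> that contains the triangle of the flag \<open>f\<close>.\<close>

definition tile :: "lpt set \<Rightarrow> (lpt \<Rightarrow> real) \<Rightarrow> lpt \<times> lpt \<Rightarrow> lpt set" where
  "tile V g f = {w \<in> V. g w = aff g (fst f) (snd f) w}"

definition supp :: "lpt set \<Rightarrow> lpt \<Rightarrow> int" where "supp T u = Max (nrm u ` T)"

lemma supp_ge: "finite T \<Longrightarrow> w \<in> T \<Longrightarrow> nrm u w \<le> supp T u"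
  unfolding supp_def by (rule Max_ge) auto

lemma supp_attained:
  assumes "finite T" "T \<noteq> {}"
  obtains w where "w \<in> T" "nrm u w = supp T u"
proof -
  have "supp T u \<in> nrm u ` T" unfolding supp_def using assms by (intro Max_in) auto
  then show ?thesis using that by auto
qed

lemma len_supp_nonneg:
  assumes "finite T" "T \<noteq> {}"
  shows "len (supp T) u \<ge> 0"
proof -
  obtain w where w: "w \<in> T" "nrm u w = supp T u" using supp_attained[OF assms] .
  have "nrm u w = nrm (rot u) w + nrm (ror u) w" by (simp add: ror_eq)
  then show ?thesis using supp_ge[OF assms(1) w(1), of "rot u"] supp_ge[OF assms(1) w(1), of "ror u"] w(2)
    by (simp add: len_def)
qed

lemma finite_hex: "finite (hex S)"
proof (rule finite_subset)
  show "hex S \<subseteq> {- S (0,-1) .. S (0,1)} \<times> {- S (1,0) .. S (-1,0)}"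
    unfolding hex_def units_def nrm_def by auto
qed simp

section \<open>The hexagonal tiles of a concave function\<close>

lemma point_exists:
  assumes "u \<in> units"
  obtains z where "nrm u z = a" "nrm (rot u) z = b"
proof
  show "nrm u (b * fst u - a * fst (rot u), b * snd u - a * snd (rot u)) = a"
    "nrm (rot u) (b * fst u - a * fst (rot u), b * snd u - a * snd (rot u)) = b"
    using assms unfolding units_def by (auto simp: nrm_def rot_def)
qed

lemma flag_thick:
  assumes f: "(y, v) \<in> flags T" and u: "u \<in> units" and fin: "finite T"
  shows "supp T u + supp T (- u) \<ge> 1"
proof -
  note d = flagsD[OF f]
  have "nrm u v \<noteq> 0 \<or> nrm u (rot v) \<noteq> 0"
    using d(1) u nrm_rot[OF d(1)] by (cases rule: units_cases[OF u d(1)]) auto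
  moreover have "nrm u p - nrm u q \<le> supp T u + supp T (- u)" if "p \<in> T" "q \<in> T" for p q
    using supp_ge[OF fin that(1), of u] supp_ge[OF fin that(2), of "- u"] by simp
  from this[OF d(2,3)] this[OF d(3,2)] this[OF d(2,4)] this[OF d(4,2)]
  show ?thesis using calculation by auto
qed

text \<open>If neither neighbour of an edge were in the hexagon, the hexagon would be contained in a
  line, but it contains a triangle.\<close>

lemma edge_in_flag:
  assumes ne: "flags (hex S) \<noteq> {}" and u: "u \<in> units" and z: "z \<in> hex S" "z + u \<in> hex S"
  shows "(z, u) \<in> flags (hex S) \<or> (z + u, - u) \<in> flags (hex S)"
proof (rule ccontr)
  assume no: "\<not> ?thesis"
  obtain y0 v0 where f0: "(y0, v0) \<in> flags (hex S)" using ne by auto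
  have w: "nrm u w = nrm u z" if "w \<in> hex S" for w
  proof (rule ccontr)
    assume "nrm u w \<noteq> nrm u z"
    then consider "nrm u w > nrm u z" | "nrm u w < nrm u z" by linarith
    then have "z + rot u \<in> hex S \<or> z + u - rot u \<in> hex S"
    proof cases
      case 1
      have "z + u - rot u \<in> hex S" using z \<open>w \<in> hex S\<close> 1
        by (simp only: hex_frame[OF u] frame_simps nrm_rot[OF u] hex_bounds_def) linarith
      then show ?thesis ..
    next
      case 2
      have "z + rot u \<in> hex S" using z \<open>w \<in> hex S\<close> 2
        by (simp only: hex_frame[OF u] frame_simps nrm_rot[OF u] hex_bounds_def) linarith
      then show ?thesis ..
    qed
    then show False using no u z by (auto simp: flags_def)
  qed
  have "supp (hex S) u + supp (hex S) (- u) \<ge> 1" by (rule flag_thick[OF f0 u finite_hex])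
  moreover obtain p where "p \<in> hex S" "nrm u p = supp (hex S) u"
    using supp_attained[OF finite_hex, of S u] z by blast
  moreover obtain q where "q \<in> hex S" "nrm (- u) q = supp (hex S) (- u)"
    using supp_attained[OF finite_hex, of S "- u"] z by blast
  ultimately show False using w[of p] w[of q] by simp
qed

locale concave_grid =
  fixes S :: "lpt \<Rightarrow> int" and g :: "lpt \<Rightarrow> real"
  assumes conc: "lattice_concave (hex S) g"
begin

abbreviation "V \<equiv> hex S"

definition tiles :: "lpt set set" where "tiles = tile V g ` flags V"
text \<open>The affine function of a tile. Each flag of the tile gives the same function (\<open>tile_eq\<close>), so
  it does not matter which one is chosen.\<close>

definition tile_aff :: "lpt set \<Rightarrow> lpt \<Rightarrow> real" where
  "tile_aff T = (let f = SOME f. f \<in> flags T in aff g (fst f) (snd f))"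
definition slope :: "lpt set \<Rightarrow> lpt \<Rightarrow> real" where "slope T v = tile_aff T v - tile_aff T 0"

lemma tile_subset: "tile V g f \<subseteq> V" by (auto simp: tile_def)

lemma finite_tile: "finite (tile V g f)"
  using finite_subset[OF tile_subset finite_hex] .

lemma flags_tile:
  assumes "f \<in> flags V"
  shows "f \<in> flags (tile V g f)"
  using assms aff_vertex by (cases f) (auto simp: flags_def tile_def)

lemma flags_mono: "A \<subseteq> B \<Longrightarrow> flags A \<subseteq> flags B"
  by (auto simp: flags_def)

lemma aff_in_tile:
  assumes f: "(y, v) \<in> flags (tile V g (z, u))"
  shows "aff g y v = aff g z u"
proof -
  note d = flagsD[OF f]
  have "aff g y v = aff (aff g z u) y v"
    using d by (intro aff_cong) (auto simp: tile_def)
  then show ?thesis using aff_aff[OF d(1)] by simp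
qed

lemma tile_in_tile:
  assumes "f' \<in> flags (tile V g f)"
  shows "tile V g f' = tile V g f"
  using aff_in_tile[of "fst f'" "snd f'" "fst f" "snd f"] assms by (simp add: tile_def)

lemma tilesD:
  assumes "T \<in> tiles"
  shows "T \<subseteq> V" "finite T" "T \<noteq> {}" "flags T \<noteq> {}"
proof -
  obtain f where f: "f \<in> flags V" "T = tile V g f" using assms by (auto simp: tiles_def)
  have fT: "f \<in> flags T" using flags_tile f by simp
  then show "flags T \<noteq> {}" by auto
  show "T \<subseteq> V" "finite T" using f tile_subset finite_tile by simp_all
  show "T \<noteq> {}" using fT by (auto simp: flags_def)
qed

lemma tile_eq:
  assumes T: "T \<in> tiles" and f: "f \<in> flags T"
  shows "f \<in> flags V" "tile V g f = T" "aff g (fst f) (snd f) = tile_aff T"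
proof -
  obtain f0 where f0: "f0 \<in> flags V" "T = tile V g f0" using T by (auto simp: tiles_def)
  show "f \<in> flags V" using f flags_mono[OF tilesD(1)[OF T]] by auto
  show "tile V g f = T" using tile_in_tile f f0 by simp
  have "(SOME f. f \<in> flags T) \<in> flags T" using f by (rule someI)
  then have "aff g (fst (SOME f. f \<in> flags T)) (snd (SOME f. f \<in> flags T)) = aff g (fst f0) (snd f0)"
    using aff_in_tile[of "fst (SOME f. f \<in> flags T)" "snd (SOME f. f \<in> flags T)" "fst f0" "snd f0"] f0 by simp
  moreover have "aff g (fst f) (snd f) = aff g (fst f0) (snd f0)"
    using aff_in_tile[of "fst f" "snd f" "fst f0" "snd f0"] f f0 by simp
  ultimately show "aff g (fst f) (snd f) = tile_aff T" by (simp add: tile_aff_def Let_def)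
qed

lemma tile_mem: "f \<in> flags V \<Longrightarrow> tile V g f \<in> tiles" by (simp add: tiles_def)

lemma tile_aff_tile:
  assumes "(z, u) \<in> flags V"
  shows "tile_aff (tile V g (z, u)) = aff g z u"
  using tile_eq(3)[OF tile_mem flags_tile, OF assms assms] by simp

lemma mem_tile_iff:
  assumes T: "T \<in> tiles"
  shows "w \<in> T \<longleftrightarrow> w \<in> V \<and> g w = tile_aff T w"
proof -
  obtain f where f: "f \<in> flags T" using tilesD(4)[OF T] by auto
  show ?thesis using tile_eq[OF T f] by (auto simp: tile_def)
qed

lemma below_tile_aff:
  assumes T: "T \<in> tiles" and w: "w \<in> V"
  shows "g w \<le> tile_aff T w"
proof -
  obtain z u where f: "(z, u) \<in> flags T" using tilesD(4)[OF T] by auto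
  show ?thesis using lattice_concave_below_aff[OF conc tile_eq(1)[OF T f] w] tile_eq(3)[OF T f] by simp
qed

lemma tile_aff_slope:
  assumes T: "T \<in> tiles"
  shows "tile_aff T (w + v) = tile_aff T w + slope T v" "slope T (v + v') = slope T v + slope T v'"
    "slope T (v - v') = slope T v - slope T v'" "slope T (- v) = - slope T v"
proof -
  obtain z u where f: "(z, u) \<in> flags T" using tilesD(4)[OF T] by auto
  have A: "tile_aff T (w + v) - tile_aff T w = of_int (nrm (rot u) v) * (g (z + u) - g z)
     - of_int (nrm u v) * (g (z + rot u) - g z)" for w v
    using aff_diff tile_eq(3)[OF T f] by (metis fst_conv snd_conv)
  have s: "slope T v = of_int (nrm (rot u) v) * (g (z + u) - g z)
     - of_int (nrm u v) * (g (z + rot u) - g z)" for v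
    using A[of 0 v] by (simp add: slope_def)
  show "tile_aff T (w + v) = tile_aff T w + slope T v" using A[of w v] s[of v] by simp
  show "slope T (v + v') = slope T v + slope T v'" "slope T (v - v') = slope T v - slope T v'"
    "slope T (- v) = - slope T v"
    by (simp_all add: s algebra_simps)
qed

lemma slope_edge:
  assumes T: "T \<in> tiles" and "z \<in> T" "z + u \<in> T"
  shows "g (z + u) - g z = slope T u"
  using tile_aff_slope(1)[OF T, of z u] mem_tile_iff[OF T] assms by auto

text \<open>To see that a point \<open>w\<close> of the surrounding hexagon belongs to the tile, walk to \<open>w\<close> inside
  the tile. When the walk has to cross an edge, there is a point \<open>x\<close> of the tile beyond it. Beyond
  the edge \<open>g\<close> lies below the affine function of the neighbouring triangle, and \<open>x\<close> lies on that
  of the tile, so the two functions coincide, and the neighbouring triangle belongs to the tile.\<close>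

lemma tile_hex:
  assumes T: "T \<in> tiles"
  shows "T = hex (supp T)"
proof
  note fin = tilesD(2)[OF T]
  show "T \<subseteq> hex (supp T)" using supp_ge[OF fin] by (auto simp: hex_def)
  show "hex (supp T) \<subseteq> T"
  proof
    fix w assume w: "w \<in> hex (supp T)"
    obtain f where f: "f \<in> flags T" using tilesD(4)[OF T] by auto
    have "\<exists>v. (w, v) \<in> flags T"
    proof (rule triangle_walk_lattice[OF f])
      fix y v assume yv: "(y, v) \<in> flags T"
      show "v \<in> units" using flagsD(1)[OF yv] .
      show "(y + v, rot v - v) \<in> flags T" using flags_rot[OF yv] .
      assume gt: "nrm v w > nrm v y"
      note tq = tile_eq[OF T yv] note v = flagsD(1)[OF yv]
      obtain x where x: "x \<in> T" "nrm v x = supp T v" using supp_attained[OF fin tilesD(3)[OF T]] .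
      have xv: "nrm v x > nrm v y" using w v gt x(2) by (auto simp: hex_def)
      have xV: "x \<in> V" using x tilesD(1)[OF T] by auto
      have c: "(y + v, - v) \<in> flags V" by (rule flags_cross[OF tq(1) xV xv])
      define \<kappa> where "\<kappa> = g y + g (y + v) - g (y + rot v) - g (y + ror v)"
      have ac: "aff g (y + v) (- v) p = tile_aff T p - of_int (nrm v (p - y)) * \<kappa>" for p
        using aff_cross[OF v, of g y p] tq(3) by (simp add: \<kappa>_def)
      have "g (y + rot v) + g (y + ror v) \<le> g y + g (y + v)"
        using conc tq(1) c unfolding lattice_concave_def by blast
      then have "\<kappa> \<ge> 0" by (simp add: \<kappa>_def)
      moreover have "tile_aff T x \<le> tile_aff T x - of_int (nrm v (x - y)) * \<kappa>"
        using lattice_concave_below_aff[OF conc c xV] x(1) mem_tile_iff[OF T] by (simp add: ac)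
      then have "of_int (nrm v (x - y)) * \<kappa> \<le> 0" by simp
      then have "\<kappa> \<le> 0" using xv by (simp add: mult_le_0_iff)
      ultimately have "\<kappa> = 0" by simp
      then have "aff g (y + v) (- v) = tile_aff T" using ac by (simp add: fun_eq_iff)
      then have "tile V g (y + v, - v) = T" using tq by (auto simp: tile_def)
      then show "(y + v, - v) \<in> flags T" using flags_tile[OF c] by simp
    qed
    then show "w \<in> T" by (auto simp: flags_def)
  qed
qed

lemma tile_len: "T \<in> tiles \<Longrightarrow> \<forall>m\<in>units. len (supp T) m \<ge> 0"
  by (simp add: len_supp_nonneg tilesD)

end

section \<open>Neighbouring tiles\<close>

text \<open>Lattice points are treated as vectors, so quantifiers over them must not be split into
  quantifiers over coordinates.\<close>

declare split_paired_All [simp del] split_paired_Ex [simp del]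

context concave_grid begin

lemma thick: "T \<in> tiles \<Longrightarrow> u \<in> units \<Longrightarrow> supp T u + supp T (- u) \<ge> 1"
  using flag_thick tilesD by (metis ex_in_conv surj_pair)

lemma side_flag:
  assumes T: "T \<in> tiles" and u: "u \<in> units" and z: "z \<in> T" "z + u \<in> T" "nrm u z = supp T u"
  shows "(z, u) \<in> flags T"
proof -
  have zh: "z \<in> hex (supp T)" "z + u \<in> hex (supp T)" using z tile_hex[OF T] by auto
  have "z + rot u \<in> hex (supp T)"
    using zh thick[OF T u] z(3)
    by (simp only: hex_frame[OF u] frame_simps nrm_rot[OF u] hex_bounds_def) linarith
  then show ?thesis using z u tile_hex[OF T] by (simp add: flags_def)
qed

lemma side_edge_exists:
  assumes T: "T \<in> tiles" and u: "u \<in> units" and l: "len (supp T) u \<ge> 1"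
  obtains z where "z \<in> T" "z + u \<in> T" "nrm u z = supp T u" "z - u \<notin> T"
proof -
  obtain z where z: "nrm u z = supp T u" "nrm (rot u) z = supp T u - supp T (u - rot u)"
    using point_exists[OF u] .
  have "z \<in> hex (supp T)" "z + u \<in> hex (supp T)" "z - u \<notin> hex (supp T)"
    using l len_nonneg_frame[OF tile_len[OF T] u] z
    by (simp_all only: hex_frame[OF u] len_frame[of _ u] frame_simps nrm_rot[OF u] hex_bounds_def) linarith+
  then show ?thesis using that z tile_hex[OF T] by auto
qed

lemma side_len:
  assumes T: "T \<in> tiles" and u: "u \<in> units" and z: "z \<in> T" "z + u \<in> T" "nrm u z = supp T u"
  shows "len (supp T) u \<ge> 1"
proof -
  have "z \<in> hex (supp T)" "z + u \<in> hex (supp T)" using z tile_hex[OF T] by auto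
  then show ?thesis using z(3)
    by (simp only: hex_frame[OF u] len_frame[of _ u] frame_simps nrm_rot[OF u] hex_bounds_def) linarith
qed

lemma edge_inner_or_side:
  assumes T: "T \<in> tiles" and u: "u \<in> units" and z: "z \<in> T" "z + u \<in> T"
    and n: "(z + u, - u) \<notin> flags T"
  shows "nrm u z = supp T u"
proof (rule ccontr)
  assume ne: "nrm u z \<noteq> supp T u"
  have zh: "z \<in> hex (supp T)" "z + u \<in> hex (supp T)" using z tile_hex[OF T] by auto
  have "z + u + rot (- u) \<in> hex (supp T)" using zh ne
    by (simp only: hex_frame[OF u] frame_simps nrm_rot[OF u] hex_bounds_def) linarith
  then show False using n z u tile_hex[OF T] by (simp add: flags_def)
qed

text \<open>Across an inner side the slope decreases strictly in the outer normal direction, by \<open>\<kappa> > 0\<close>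
  per unit. Since both tiles are cut out of the grid by equality with their affine functions, they
  meet the common line in the same set: neighbouring tiles share a whole side.\<close>

lemma across:
  assumes T: "T \<in> tiles" and u: "u \<in> units" and z: "z \<in> T" "z + u \<in> T" "nrm u z = supp T u"
    and f: "(z + u, - u) \<in> flags V"
  defines "T' \<equiv> tile V g (z + u, - u)"
  shows "T' \<in> tiles" "z \<in> T'" "z + u \<in> T'" "supp T' (- u) = - supp T u"
    "\<And>w. nrm u w = supp T u \<Longrightarrow> w \<in> T' \<longleftrightarrow> w \<in> T"
    "\<exists>\<kappa>>0. \<forall>v. slope T' v = slope T v - of_int (nrm u v) * \<kappa>"
proof -
  show T': "T' \<in> tiles" unfolding T'_def by (rule tile_mem[OF f])
  have fT: "(z, u) \<in> flags T" by (rule side_flag[OF T u z])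
  define \<kappa> where "\<kappa> = g z + g (z + u) - g (z + rot u) - g (z + ror u)"
  have A': "tile_aff T' p = tile_aff T p - of_int (nrm u p - supp T u) * \<kappa>" for p
    using tile_aff_tile[OF f] aff_cross[OF u, of g z p] tile_eq(3)[OF T fT] z(3)
    by (simp add: T'_def \<kappa>_def)
  show zT: "z \<in> T'" "z + u \<in> T'"
    using flagsD[OF flags_tile[OF f]] by (simp_all add: T'_def)
  \<comment> \<open>The third vertex of the triangle beyond the edge is not in the tile, so \<open>g\<close> is
    strictly below there.\<close>
  have apex: "z + ror u \<in> T'"
    using flagsD(4)[OF flags_tile[OF f]] by (simp add: T'_def ror_eq algebra_simps)
  have na: "nrm u (z + ror u) = supp T u + 1" using z u by (simp add: ror_eq)
  have notT: "w \<notin> T" if "nrm u w > supp T u" for w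
    using supp_ge[OF tilesD(2)[OF T], of w u] that by auto
  have apexV: "z + ror u \<in> V" using apex mem_tile_iff[OF T'] by simp
  moreover have "z + ror u \<notin> T" using notT na by simp
  ultimately have "g (z + ror u) < tile_aff T (z + ror u)"
    using below_tile_aff[OF T apexV] mem_tile_iff[OF T, of "z + ror u"] by simp
  moreover have "g (z + ror u) = tile_aff T (z + ror u) - \<kappa>"
    using mem_tile_iff[OF T', of "z + ror u"] apex A'[of "z + ror u"] na by simp
  ultimately have \<kappa>: "\<kappa> > 0" by simp
  have "slope T' v = slope T v - of_int (nrm u v) * \<kappa>" for v
    unfolding slope_def A' by (simp add: algebra_simps)
  then show "\<exists>\<kappa>>0. \<forall>v. slope T' v = slope T v - of_int (nrm u v) * \<kappa>" using \<kappa> by blast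
  show "w \<in> T' \<longleftrightarrow> w \<in> T" if "nrm u w = supp T u" for w
    using that mem_tile_iff[OF T] mem_tile_iff[OF T'] A'[of w] by simp
  show "supp T' (- u) = - supp T u"
    unfolding supp_def[of T']
  proof (rule Max_eqI)
    show "finite (nrm (- u) ` T')" using tilesD(2)[OF T'] by simp
    show "- supp T u \<in> nrm (- u) ` T'" using zT(1) z(3) by force
    show "y \<le> - supp T u" if y: "y \<in> nrm (- u) ` T'" for y
    proof -
      obtain w where w: "w \<in> T'" "y = - nrm u w" using y by (elim imageE) simp
      have "tile_aff T' w \<le> tile_aff T w" using below_tile_aff[OF T, of w] mem_tile_iff[OF T'] w by auto
      then have "of_int (nrm u w - supp T u) * \<kappa> \<ge> 0" using A'[of w] by simp
      then have "nrm u w \<ge> supp T u" using \<kappa> by (simp add: zero_le_mult_iff)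
      then show ?thesis using w by simp
    qed
  qed
qed

lemma across_unique:
  assumes T: "T \<in> tiles" and u: "u \<in> units"
    and z: "z \<in> T" "z + u \<in> T" "nrm u z = supp T u" and f: "(z + u, - u) \<in> flags V"
    and y: "y \<in> T" "y + u \<in> T" "nrm u y = supp T u"
  shows "(y + u, - u) \<in> flags V" "tile V g (y + u, - u) = tile V g (z + u, - u)"
proof -
  define T' where "T' = tile V g (z + u, - u)"
  note a = across[OF T u z f, folded T'_def]
  have "(y + u, - u) \<in> flags T'"
    using a y u by (intro side_flag[OF a(1)]) auto
  then show "(y + u, - u) \<in> flags V" "tile V g (y + u, - u) = tile V g (z + u, - u)"
    using tile_eq[OF a(1)] by (auto simp: T'_def)
qed

lemma across_back:
  assumes T: "T \<in> tiles" and u: "u \<in> units"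
    and z: "z \<in> T" "z + u \<in> T" "nrm u z = supp T u"
  shows "(z, u) \<in> flags V" "tile V g (z, u) = T"
  using tile_eq[OF T side_flag[OF T u z]] by auto

lemma finite_tiles: "finite tiles"
proof -
  have "flags V \<subseteq> V \<times> units" by (auto simp: flags_def)
  then have "finite (flags V)" by (rule finite_subset) (simp add: finite_hex)
  then show ?thesis by (simp add: tiles_def)
qed

text \<open>Some edge on the side of the tile in direction \<open>u\<close>. The neighbouring tile does not depend on
  the choice (\<open>nbr_eq\<close>).\<close>

definition side :: "lpt set \<Rightarrow> lpt \<Rightarrow> lpt" where
  "side T u = (SOME z. z \<in> T \<and> z + u \<in> T \<and> nrm u z = supp T u)"
definition nbr :: "lpt set \<Rightarrow> lpt \<Rightarrow> lpt set" where
  "nbr T u = tile V g (side T u + u, - u)"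
definition inner_side :: "lpt set \<Rightarrow> lpt \<Rightarrow> bool" where
  "inner_side T u \<longleftrightarrow> (side T u + u, - u) \<in> flags V"

lemma side_mem:
  assumes T: "T \<in> tiles" and u: "u \<in> units" and l: "len (supp T) u \<ge> 1"
  shows "side T u \<in> T" "side T u + u \<in> T" "nrm u (side T u) = supp T u"
proof -
  obtain z where "z \<in> T \<and> z + u \<in> T \<and> nrm u z = supp T u"
    using side_edge_exists[OF T u l] by metis
  then have "side T u \<in> T \<and> side T u + u \<in> T \<and> nrm u (side T u) = supp T u"
    unfolding side_def by (rule someI)
  then show "side T u \<in> T" "side T u + u \<in> T" "nrm u (side T u) = supp T u" by simp_all
qed

lemma nbr_eq:
  assumes T: "T \<in> tiles" and u: "u \<in> units"
    and z: "z \<in> T" "z + u \<in> T" "nrm u z = supp T u"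
  shows "inner_side T u \<longleftrightarrow> (z + u, - u) \<in> flags V"
    "inner_side T u \<Longrightarrow> nbr T u = tile V g (z + u, - u)"
proof -
  note s = side_mem[OF T u side_len[OF T u z]]
  show "inner_side T u \<longleftrightarrow> (z + u, - u) \<in> flags V"
    unfolding inner_side_def using across_unique(1)[OF T u z _ s] across_unique(1)[OF T u s _ z] by blast
  show "nbr T u = tile V g (z + u, - u)" if "inner_side T u"
    using across_unique(2)[OF T u s _ z] that unfolding inner_side_def nbr_def by simp
qed

lemma nbr:
  assumes T: "T \<in> tiles" and u: "u \<in> units" and l: "len (supp T) u \<ge> 1" and i: "inner_side T u"
  shows "nbr T u \<in> tiles" "len (supp (nbr T u)) (- u) \<ge> 1" "inner_side (nbr T u) (- u)"
    "nbr (nbr T u) (- u) = T" "slope (nbr T u) (- u) = - slope T u"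
proof -
  note s = side_mem[OF T u l]
  note a = across[OF T u s i[unfolded inner_side_def], folded nbr_def]
  show 1: "nbr T u \<in> tiles" by (rule a(1))
  define y where "y = side T u + u"
  have y: "y \<in> nbr T u" "y + - u \<in> nbr T u" "nrm (- u) y = supp (nbr T u) (- u)"
    using a(2,3,4) s(3) by (simp_all add: y_def)
  have mu: "- u \<in> units" using u by simp
  show "len (supp (nbr T u)) (- u) \<ge> 1" by (rule side_len[OF 1 mu y])
  show i': "inner_side (nbr T u) (- u)"
    using nbr_eq(1)[OF 1 mu y] across_back[OF T u s] by (simp add: y_def)
  show "nbr (nbr T u) (- u) = T"
    using nbr_eq(2)[OF 1 mu y i'] across_back[OF T u s] by (simp add: y_def)
  show "slope (nbr T u) (- u) = - slope T u"
  proof -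
    obtain \<kappa> where "\<forall>v. slope (nbr T u) v = slope T v - of_int (nrm u v) * \<kappa>" using a(6) by blast
    then have "slope (nbr T u) u = slope T u" by simp
    then show ?thesis using tile_aff_slope(4)[OF 1, of u] by simp
  qed
qed

section \<open>Flows of strands through the honeycomb\<close>

text \<open>The sides of tiles with non-integral slope. These are the sides through which strands may
  run.\<close>

definition darts :: "(lpt set \<times> lpt) set" where
  "darts = {(T, u). T \<in> tiles \<and> u \<in> units \<and> len (supp T) u \<ge> 1 \<and> slope T u \<notin> \<int>}"

lemma other_nonint:
  assumes T: "T \<in> tiles" and n: "slope T u \<notin> \<int>"
  shows "slope T (rot u) \<notin> \<int> \<or> slope T (rot u - u) \<notin> \<int>"
proof (rule ccontr)
  assume "\<not> ?thesis"
  then have "slope T (rot u) - slope T (rot u - u) \<in> \<int>" by (intro Ints_diff) auto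
  then show False using n tile_aff_slope(3)[OF T, of "rot u" u] by simp
qed

lemma slope_minus_int:
  assumes T: "T \<in> tiles"
  shows "slope T (- u) \<in> \<int> \<longleftrightarrow> slope T u \<in> \<int>"
  using tile_aff_slope(4)[OF T] by simp

text \<open>If all sides of non-integral slope were degenerate, then by \<open>other_nonint\<close> two of the three
  pairs of opposite sides of the tile would be missing, and the tile would be a segment.\<close>

lemma darts_nonempty:
  assumes T: "T \<in> tiles" and u: "u \<in> units" and n: "slope T u \<notin> \<int>"
  shows "darts \<noteq> {}"
proof
  assume e: "darts = {}"
  note pos = len_nonneg_frame[OF tile_len[OF T] u]
  have z: "len (supp T) v = 0" if "v \<in> units" "slope T v \<notin> \<int>" for v
  proof -
    have "len (supp T) v \<ge> 0" using tile_len[OF T] that by simp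
    moreover have "\<not> len (supp T) v \<ge> 1" using e T that unfolding darts_def by blast
    ultimately show ?thesis by simp
  qed
  have "len (supp T) u = 0 \<and> len (supp T) (- u) = 0" using z[of u] z[of "- u"] slope_minus_int[OF T, of u] u n by simp
  moreover have "len (supp T) (rot u) = 0 \<and> len (supp T) (- rot u) = 0
      \<or> len (supp T) (rot u - u) = 0 \<and> len (supp T) (u - rot u) = 0"
    using other_nonint[OF T n] z[of "rot u"] z[of "- rot u"] z[of "rot u - u"] z[of "u - rot u"] u
      slope_minus_int[OF T, of "rot u"] slope_minus_int[OF T, of "rot u - u"] by auto
  moreover have "supp T u + supp T (- u) \<ge> 1" "supp T (rot u) + supp T (- rot u) \<ge> 1"
    "supp T (rot u - u) + supp T (u - rot u) \<ge> 1"
    using thick[OF T u] thick[OF T, of "rot u"] thick[OF T, of "rot u - u"] u by simp_all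
  ultimately show False using pos unfolding len_frame[of "supp T" u] by linarith
qed

definition inflow :: "(lpt set \<Rightarrow> lpt \<Rightarrow> lpt \<Rightarrow> real) \<Rightarrow> lpt set \<Rightarrow> lpt \<Rightarrow> real" where
  "inflow n T u = (\<Sum>v\<in>units. n T u v)"
definition outflow :: "(lpt set \<Rightarrow> lpt \<Rightarrow> lpt \<Rightarrow> real) \<Rightarrow> lpt set \<Rightarrow> lpt \<Rightarrow> real" where
  "outflow n T u = (\<Sum>v\<in>units. n T v u)"

text \<open>The number \<open>n T u v\<close> says how much enters the tile \<open>T\<close> through the side \<open>u\<close> and leaves it
  through the side \<open>v\<close>. What enters through a side comes from the neighbouring tile; on the
  boundary of the grid strands may start and end freely.\<close>

definition honeycomb_flow :: "(lpt set \<Rightarrow> lpt \<Rightarrow> lpt \<Rightarrow> real) \<Rightarrow> bool" where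
  "honeycomb_flow n \<longleftrightarrow> (\<forall>T u v. n T u v \<ge> 0) \<and>
    (\<forall>T u v. n T u v \<noteq> 0 \<longrightarrow> (T, u) \<in> darts \<and> (T, v) \<in> darts \<and> pass (supp T) u v) \<and>
    (\<forall>T u. (T, u) \<in> darts \<and> inner_side T u \<longrightarrow> inflow n T u = outflow n (nbr T u) (- u))"

lemma flow_exists:
  assumes "darts \<noteq> {}"
  obtains n T u where "honeycomb_flow n" "(T, u) \<in> darts" "inflow n T u \<noteq> outflow n T u"
proof -
  \<comment> \<open>Crossing a side turns a dart of a tile into a dart of the neighbouring tile; the
    darts in \<open>B\<close> are on the boundary of the grid.\<close>
  define B where "B = {(T, u). (T, u) \<in> darts \<and> \<not> inner_side T u}"
  define opp where "opp d = (nbr (fst d) (snd d), - snd d)" for d :: "lpt set \<times> lpt"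
  define R where "R d x \<longleftrightarrow> d \<in> darts \<and> x \<in> darts \<and> fst d = fst x \<and> pass (supp (fst d)) (snd d) (snd x)" for d x
  have fin: "finite darts"
    by (rule finite_subset[of _ "tiles \<times> units"]) (auto simp: darts_def finite_tiles)
  have "\<exists>N :: lpt set \<times> lpt \<Rightarrow> lpt set \<times> lpt \<Rightarrow> int. (\<forall>d x. N d x \<ge> 0) \<and> (\<forall>d x. N d x \<noteq> 0 \<longrightarrow> d \<in> darts \<and> x \<in> darts \<and> R d x) \<and>
    (\<forall>d\<in>darts - B. (\<Sum>x\<in>darts. N d x) = (\<Sum>x\<in>darts. N x (opp d))) \<and>
    (\<exists>d\<in>darts. (\<Sum>x\<in>darts. N d x) \<noteq> (\<Sum>x\<in>darts. N x d))"
  proof (rule unbalanced_circulation[of darts B R opp])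
    show "finite darts" by (rule fin)
    show "darts \<noteq> {}" by (rule assms)
    show "B \<subseteq> darts" by (auto simp: B_def)
    show "R x d" if "R d x" for d x using that pass_sym[of "supp (fst d)" "snd d" "snd x"] by (auto simp: R_def)
    show "\<not> R d d" for d
      using rot_nz[of "snd d"] by (cases d) (auto simp: R_def pass_def darts_def)
    show "\<exists>x\<in>darts. R d x" if d: "d \<in> darts" for d
    proof -
      obtain T u where Tu: "d = (T, u)" "T \<in> tiles" "u \<in> units" "len (supp T) u \<ge> 1" "slope T u \<notin> \<int>"
        using d by (auto simp: darts_def)
      obtain v where v: "v \<in> units" "slope T v \<notin> \<int>" "pass (supp T) u v"
        using pass_exists[OF Tu(3) tile_len[OF Tu(2)] Tu(4), of "\<lambda>m. slope T m \<notin> \<int>"]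
          slope_minus_int[OF Tu(2)] Tu(5) other_nonint[OF Tu(2,5)] by auto
      then have "(T, v) \<in> darts" using Tu by (auto simp: darts_def pass_def)
      then show ?thesis using v d Tu by (intro bexI[of _ "(T, v)"]) (auto simp: R_def)
    qed
    show "opp d \<in> darts - B \<and> opp (opp d) = d \<and> opp d \<noteq> d" if d: "d \<in> darts - B" for d
    proof -
      obtain T u where Tu: "d = (T, u)" "T \<in> tiles" "u \<in> units" "len (supp T) u \<ge> 1" "slope T u \<notin> \<int>"
          "inner_side T u"
        using d by (auto simp: darts_def B_def)
      show ?thesis using nbr[OF Tu(2,3,4,6)] Tu rot_nz(11)[OF Tu(3)]
        by (auto simp: opp_def darts_def B_def)
    qed
  qed blast
  then obtain N :: "lpt set \<times> lpt \<Rightarrow> lpt set \<times> lpt \<Rightarrow> int" where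
    N: "\<And>d x. N d x \<ge> 0" "\<And>d x. N d x \<noteq> 0 \<Longrightarrow> d \<in> darts \<and> x \<in> darts \<and> R d x"
    "\<And>d. d \<in> darts - B \<Longrightarrow> (\<Sum>x\<in>darts. N d x) = (\<Sum>x\<in>darts. N x (opp d))"
    "\<exists>d\<in>darts. (\<Sum>x\<in>darts. N d x) \<noteq> (\<Sum>x\<in>darts. N x d)"
    by blast
  define n where "n T u v = real_of_int (N (T, u) (T, v))" for T u v
  have P: "{T} \<times> units = Pair T ` units" for T :: "lpt set" by auto
  have row: "inflow n T u = real_of_int (\<Sum>x\<in>darts. N (T, u) x)" if "T \<in> tiles" for T u
  proof -
    have "(\<Sum>x\<in>darts. N (T, u) x) = (\<Sum>x\<in>{T} \<times> units. N (T, u) x)"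
    proof (rule sum.mono_neutral_cong)
      show "N (T, u) i = 0" if "i \<in> {T} \<times> units - darts" for i using that N(2) by blast
      show "N (T, u) i = 0" if "i \<in> darts - {T} \<times> units" for i
        using that N(2)[of "(T, u)" i] by (cases i) (auto simp: R_def darts_def)
    qed (use fin in auto)
    also have "\<dots> = (\<Sum>v\<in>units. N (T, u) (T, v))"
      unfolding P by (simp add: sum.reindex inj_on_def)
    finally show ?thesis by (simp add: inflow_def n_def)
  qed
  have col: "outflow n T u = real_of_int (\<Sum>x\<in>darts. N x (T, u))" if "T \<in> tiles" for T u
  proof -
    have "(\<Sum>x\<in>darts. N x (T, u)) = (\<Sum>x\<in>{T} \<times> units. N x (T, u))"
    proof (rule sum.mono_neutral_cong)
      show "N i (T, u) = 0" if "i \<in> {T} \<times> units - darts" for i using that N(2) by blast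
      show "N i (T, u) = 0" if "i \<in> darts - {T} \<times> units" for i
        using that N(2)[of i "(T, u)"] by (cases i) (auto simp: R_def darts_def)
    qed (use fin in auto)
    also have "\<dots> = (\<Sum>v\<in>units. N (T, v) (T, u))"
      unfolding P by (simp add: sum.reindex inj_on_def)
    finally show ?thesis by (simp add: outflow_def n_def)
  qed
  have "honeycomb_flow n"
    unfolding honeycomb_flow_def
  proof (intro conjI allI impI)
    fix T u v
    show "n T u v \<ge> 0" using N(1) by (simp add: n_def)
  next
    fix T u v assume "n T u v \<noteq> 0"
    then have "N (T, u) (T, v) \<noteq> 0" by (simp add: n_def)
    from N(2)[OF this] show "(T, u) \<in> darts" "(T, v) \<in> darts" "pass (supp T) u v" by (auto simp: R_def)
  next
    fix T u assume a: "(T, u) \<in> darts \<and> inner_side T u"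
    then have Tu: "T \<in> tiles" "u \<in> units" "len (supp T) u \<ge> 1" by (auto simp: darts_def)
    have "nbr T u \<in> tiles" using nbr(1)[OF Tu] a by simp
    moreover have "(T, u) \<in> darts - B" using a by (auto simp: B_def)
    ultimately show "inflow n T u = outflow n (nbr T u) (- u)"
      by (simp only: row[OF Tu(1)] col N(3) opp_def fst_conv snd_conv)
  qed
  moreover obtain T u where "(T, u) \<in> darts" "(\<Sum>x\<in>darts. N (T, u) x) \<noteq> (\<Sum>x\<in>darts. N x (T, u))"
    using N(4) by auto
  moreover have "T \<in> tiles" using calculation(2) by (auto simp: darts_def)
  ultimately show ?thesis using that[of n T u] by (simp only: row col of_int_eq_iff not_False_eq_True)
qed

end

section \<open>The potential of a flow\<close>

lemma hex_closed:
  assumes u: "u \<in> units" and z: "w + u \<in> hex S" "w + (rot u - u) \<in> hex S"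
  shows "w + rot u \<in> hex S"
  using z by (simp only: hex_frame[OF u] frame_simps nrm_rot[OF u] hex_bounds_def) linarith

text \<open>Differences that are consistent on each triangle have a potential, since a hexagon is simply
  connected. The proof adds the lines \<open>x + y = const\<close> of points one after the other. A new point
  is joined to earlier ones by at most three edges, in consecutive directions \<open>a\<close>, \<open>rot a\<close> and
  \<open>rot (rot a)\<close>, and if the outer two of them are in the hexagon, then so is the middle one
  (\<open>hex_closed\<close>), so that the triangles between them force the prescribed values to agree.\<close>

lemma potential_exists:
  fixes E :: "lpt \<Rightarrow> lpt \<Rightarrow> real"
  assumes anti: "\<And>z u. u \<in> units \<Longrightarrow> z \<in> hex S \<Longrightarrow> z + u \<in> hex S \<Longrightarrow> E (z + u) (- u) = - E z u"
    and tri: "\<And>z u. (z, u) \<in> flags (hex S) \<Longrightarrow> E z (rot u) = E z u + E (z + u) (rot u - u)"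
  obtains \<delta> where "\<And>z u. u \<in> units \<Longrightarrow> z \<in> hex S \<Longrightarrow> z + u \<in> hex S \<Longrightarrow> \<delta> (z + u) - \<delta> z = E z u"
proof -
  \<comment> \<open>The line of \<open>z\<close>. No unit vector is parallel to these lines, and those leading to
    earlier ones are \<open>a\<close>, \<open>rot a\<close> and \<open>rot (rot a)\<close>.\<close>
  define lev :: "lpt \<Rightarrow> int" where "lev z = fst z + snd z" for z
  define a :: lpt where "a = (-1, 0)"
  have au: "a \<in> units" by (simp add: a_def units_def)
  have low: "lev u < 0 \<Longrightarrow> u = a \<or> u = rot a \<or> u = rot (rot a)" "lev u \<noteq> 0" if "u \<in> units" for u
    using that by (auto simp: units_def lev_def a_def rot_def)
  have lev_add: "lev (z + u) = lev z + lev u" for z u by (simp add: lev_def)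
  have lev_a: "lev a = -1" "lev (rot a) = -2" "lev (rot a - a) = -1"
    by (auto simp: lev_def a_def rot_def)
  obtain L K where L: "\<And>z. z \<in> hex S \<Longrightarrow> L < lev z" and K: "\<And>z. z \<in> hex S \<Longrightarrow> lev z \<le> K"
  proof (cases "hex S = {}")
    case True then show ?thesis using that by auto
  next
    case False
    have fi: "finite (lev ` hex S)" using finite_hex by simp
    show ?thesis
    proof (rule that[of "Min (lev ` hex S) - 1" "Max (lev ` hex S)"])
      fix z assume "z \<in> hex S"
      from Min_le[OF fi imageI[OF this]] Max_ge[OF fi imageI[OF this]]
      show "Min (lev ` hex S) - 1 < lev z" "lev z \<le> Max (lev ` hex S)" by simp_all
    qed
  qed
  have "\<exists>\<delta>. \<forall>z u. u \<in> units \<longrightarrow> z \<in> hex S \<longrightarrow> z + u \<in> hex S \<longrightarrow> lev z \<le> L + int n \<longrightarrow>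
      lev (z + u) \<le> L + int n \<longrightarrow> \<delta> (z + u) - \<delta> z = E z u" for n
  proof (induction n)
    case 0
    then show ?case using L by force
  next
    case (Suc n)
    then obtain \<delta> where IH: "\<And>z u. u \<in> units \<Longrightarrow> z \<in> hex S \<Longrightarrow> z + u \<in> hex S \<Longrightarrow> lev z \<le> L + int n \<Longrightarrow>
      lev (z + u) \<le> L + int n \<Longrightarrow> \<delta> (z + u) - \<delta> z = E z u" by blast
    define \<delta>' where "\<delta>' z = (if lev z \<le> L + int n then \<delta> z
      else if z + rot a \<in> hex S then \<delta> (z + rot a) - E z (rot a)
      else if z + a \<in> hex S then \<delta> (z + a) - E z a
      else \<delta> (z + (rot a - a)) - E z (rot a - a))" for z
    have new: "\<delta>' z = \<delta> (z + u) - E z u"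
      if z: "z \<in> hex S" "lev z = L + int (Suc n)" and u: "u \<in> units" "z + u \<in> hex S" "lev u < 0" for z u
    proof -
      have 1: "\<delta> (z + rot a) - E z (rot a) = \<delta> (z + a) - E z a"
        if "z + a \<in> hex S" "z + rot a \<in> hex S"
      proof -
        have "(z, a) \<in> flags (hex S)" using that z au by (simp add: flags_def)
        from tri[OF this] IH[of "rot a - a" "z + a"] z that au lev_a
        show ?thesis by (simp add: lev_add)
      qed
      have 2: "\<delta> (z + (rot a - a)) - E z (rot a - a) = \<delta> (z + rot a) - E z (rot a)"
        if "z + rot a \<in> hex S" "z + (rot a - a) \<in> hex S"
      proof -
        have "(z, rot a) \<in> flags (hex S)" using that z au by (simp add: flags_def)
        from tri[OF this] IH[of "- a" "z + rot a"] z that au lev_a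
        show ?thesis by (simp add: lev_add lev_def algebra_simps)
      qed
      have 3: "z + rot a \<in> hex S" if "z + a \<in> hex S" "z + (rot a - a) \<in> hex S"
        using hex_closed[OF au that] .
      have "u = a \<or> u = rot a \<or> u = rot a - a" using low[OF u(1)] u(3) by simp
      then show ?thesis using 1 2 3 u(2) z(2) unfolding \<delta>'_def by auto
    qed
    show ?case
    proof (intro exI[of _ \<delta>'] allI impI)
      fix z u
      assume u: "u \<in> units" and z: "z \<in> hex S" "z + u \<in> hex S"
        and l: "lev z \<le> L + int (Suc n)" "lev (z + u) \<le> L + int (Suc n)"
      consider "lev z \<le> L + int n" "lev (z + u) \<le> L + int n" | "lev z = L + int (Suc n)" "lev u < 0"
        | "lev (z + u) = L + int (Suc n)" "lev (- u) < 0"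
        using l low(2)[OF u] by (force simp: lev_add lev_def)
      then show "\<delta>' (z + u) - \<delta>' z = E z u"
      proof cases
        case 1 then show ?thesis using IH[OF u z] by (simp add: \<delta>'_def)
      next
        case 2
        then have "\<delta>' (z + u) = \<delta> (z + u)" by (simp add: \<delta>'_def lev_add)
        then show ?thesis using new[OF z(1) 2(1) u z(2) 2(2)] by simp
      next
        case 3
        then have "lev z \<le> L + int n" by (simp add: lev_add lev_def)
        then have "\<delta>' z = \<delta> z" by (simp add: \<delta>'_def)
        then show ?thesis using new[OF z(2) 3(1), of "- u"] u z 3(2) anti[OF u z] by simp
      qed
    qed
  qed
  from this[of "nat (K - L)"] obtain \<delta> where d: "\<forall>z u. u \<in> units \<longrightarrow> z \<in> hex S \<longrightarrow> z + u \<in> hex S \<longrightarrow>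
      lev z \<le> L + int (nat (K - L)) \<longrightarrow> lev (z + u) \<le> L + int (nat (K - L)) \<longrightarrow> \<delta> (z + u) - \<delta> z = E z u" by blast
  show ?thesis
  proof (rule that)
    fix z u assume "u \<in> units" "z \<in> hex S" "z + u \<in> hex S"
    then show "\<delta> (z + u) - \<delta> z = E z u"
      using d K[of z] K[of "z + u"] L[of z] by force
  qed
qed

context concave_grid begin

text \<open>The change of the function on the tile \<open>T\<close> when all strands of the flow are pushed aside.\<close>

definition Phi :: "(lpt set \<Rightarrow> lpt \<Rightarrow> lpt \<Rightarrow> real) \<Rightarrow> lpt set \<Rightarrow> lpt \<Rightarrow> real" where
  "Phi n T w = (\<Sum>u\<in>units. \<Sum>v\<in>units. n T u v * of_bool (shift T u v w))"

text \<open>On each tile, \<open>\<delta>\<close> is the displacement by the flow, up to a constant.\<close>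

definition follows :: "(lpt set \<Rightarrow> lpt \<Rightarrow> lpt \<Rightarrow> real) \<Rightarrow> (lpt \<Rightarrow> real) \<Rightarrow> bool" where
  "follows n \<delta> \<longleftrightarrow> (\<forall>T z u. T \<in> tiles \<longrightarrow> (z, u) \<in> flags T \<longrightarrow> \<delta> (z + u) - \<delta> z = Phi n T (z + u) - Phi n T z)"

lemma flow_nonneg: "honeycomb_flow n \<Longrightarrow> n T u v \<ge> 0"
  unfolding honeycomb_flow_def by blast

lemma flow_pass:
  assumes "honeycomb_flow n" "n T u v \<noteq> 0"
  shows "(T, u) \<in> darts" "(T, v) \<in> darts" "pass (supp T) u v" "T \<in> tiles" "u \<in> units" "v \<in> units"
    "slope T u \<notin> \<int>" "slope T v \<notin> \<int>"
proof -
  show 1: "(T, u) \<in> darts" "(T, v) \<in> darts" "pass (supp T) u v"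
    using assms unfolding honeycomb_flow_def by blast+
  then show "T \<in> tiles" "u \<in> units" "v \<in> units" "slope T u \<notin> \<int>" "slope T v \<notin> \<int>"
    unfolding darts_def by blast+
qed

lemma flow_zero:
  assumes "honeycomb_flow n" "(T, u) \<notin> darts"
  shows "inflow n T u = 0" "outflow n T u = 0"
proof -
  have "n T u v = 0" "n T v u = 0" for v
    using flow_pass(1)[OF assms(1), of T u v] flow_pass(2)[OF assms(1), of T v u] assms(2) by blast+
  then show "inflow n T u = 0" "outflow n T u = 0" unfolding inflow_def outflow_def by simp_all
qed

lemma flow_across:
  assumes n: "honeycomb_flow n" and T: "T \<in> tiles" and u: "u \<in> units" and l: "len (supp T) u \<ge> 1"
    and i: "inner_side T u"
  shows "inflow n T u = outflow n (nbr T u) (- u)" "outflow n T u = inflow n (nbr T u) (- u)"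
proof -
  note b = nbr[OF T u l i]
  have mu: "- u \<in> units" using u by simp
  have d: "(nbr T u, - u) \<in> darts \<longleftrightarrow> (T, u) \<in> darts"
    using b(1,2,5) T u l by (auto simp: darts_def)
  show "inflow n T u = outflow n (nbr T u) (- u)" "outflow n T u = inflow n (nbr T u) (- u)"
  proof -
    have *: "\<And>T u. (T, u) \<in> darts \<Longrightarrow> inner_side T u \<Longrightarrow> inflow n T u = outflow n (nbr T u) (- u)"
      using n unfolding honeycomb_flow_def by blast
    show "inflow n T u = outflow n (nbr T u) (- u)"
      using *[of T u] i d flow_zero[OF n, of T u] flow_zero[OF n, of "nbr T u" "- u"] by auto
    show "outflow n T u = inflow n (nbr T u) (- u)"
      using *[of "nbr T u" "- u"] b(3,4) d flow_zero[OF n, of T u] flow_zero[OF n, of "nbr T u" "- u"] by auto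
  qed
qed

lemma flow_reverse:
  assumes n: "honeycomb_flow n"
  shows "honeycomb_flow (\<lambda>T u v. n T v u)"
  unfolding honeycomb_flow_def
proof (intro conjI allI impI)
  fix T u v
  show "n T v u \<ge> 0" by (rule flow_nonneg[OF n])
next
  fix T u v assume "n T v u \<noteq> 0"
  from flow_pass[OF n this] show "(T, u) \<in> darts" "(T, v) \<in> darts" "pass (supp T) u v"
    using pass_sym by blast+
next
  fix T u assume "(T, u) \<in> darts \<and> inner_side T u"
  then show "inflow (\<lambda>T u v. n T v u) T u = outflow (\<lambda>T u v. n T v u) (nbr T u) (- u)"
    using flow_across(2)[OF n, of T u] by (simp add: darts_def inflow_def outflow_def)
qed

lemma sum_units_at:
  assumes "m \<in> units"
  shows "(\<Sum>u\<in>units. \<Sum>v\<in>units. f u v * of_bool (m = u \<and> P)) = (\<Sum>v\<in>units. f m v) * (of_bool P :: real)"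
    "(\<Sum>u\<in>units. \<Sum>v\<in>units. f u v * of_bool (m = v \<and> P)) = (\<Sum>u\<in>units. f u m) * (of_bool P :: real)"
proof -
  have "(\<Sum>u\<in>units. \<Sum>v\<in>units. f u v * of_bool (m = u \<and> P))
      = (\<Sum>u\<in>units. if m = u then (\<Sum>v\<in>units. f u v) * of_bool P else 0)"
    by (rule sum.cong) (auto simp: sum_distrib_right)
  then show "(\<Sum>u\<in>units. \<Sum>v\<in>units. f u v * of_bool (m = u \<and> P)) = (\<Sum>v\<in>units. f m v) * (of_bool P :: real)"
    using assms by simp
  have "(\<Sum>v\<in>units. f u v * of_bool (m = v \<and> P)) = f u m * of_bool P" for u
  proof -
    have "(\<Sum>v\<in>units. f u v * of_bool (m = v \<and> P)) = (\<Sum>v\<in>units. if m = v then f u v * of_bool P else 0)"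
      by (rule sum.cong) auto
    then show ?thesis using assms by simp
  qed
  then show "(\<Sum>u\<in>units. \<Sum>v\<in>units. f u v * of_bool (m = v \<and> P)) = (\<Sum>u\<in>units. f u m) * (of_bool P :: real)"
    by (simp add: sum_distrib_right)
qed

text \<open>By \<open>shift_profile\<close> the displacement on a side depends only on the total inflow and outflow
  through that side.\<close>

lemma Phi_profile:
  assumes n: "honeycomb_flow n" and T: "T \<in> tiles" and m: "m \<in> units"
    and z: "z \<in> T" "z + m \<in> T" "nrm m z = supp T m"
  shows "Phi n T (z + m) - Phi n T z = inflow n T m * of_bool (z - m \<notin> T) - outflow n T m * of_bool (z + m + m \<notin> T)"
proof -
  have e: "n T u v * of_bool (shift T u v (z + m)) - n T u v * of_bool (shift T u v z)
      = n T u v * of_bool (m = u \<and> z - m \<notin> T) - n T u v * of_bool (m = v \<and> z + m + m \<notin> T)" for u v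
  proof (cases "n T u v = 0")
    case False
    note p = flow_pass[OF n False]
    have "of_bool (shift T u v (z + m)) - (of_bool (shift T u v z) :: int)
        = of_bool (m = u \<and> z - m \<notin> T) - of_bool (m = v \<and> z + m + m \<notin> T)"
      using shift_profile[OF p(5,6) m p(3) tile_len[OF T], of z] z tile_hex[OF T] by simp
    then have "of_int (of_bool (shift T u v (z + m)) - of_bool (shift T u v z))
        = (of_int (of_bool (m = u \<and> z - m \<notin> T) - of_bool (m = v \<and> z + m + m \<notin> T)) :: real)"
      by (rule arg_cong)
    then have "of_bool (shift T u v (z + m)) - (of_bool (shift T u v z) :: real)
        = of_bool (m = u \<and> z - m \<notin> T) - of_bool (m = v \<and> z + m + m \<notin> T)"
      by simp
    then show ?thesis by (metis right_diff_distrib)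
  qed simp
  show ?thesis
    unfolding Phi_def sum_subtractf[symmetric] e
    unfolding sum_subtractf sum_units_at[OF m] inflow_def outflow_def by simp
qed

lemma nbr_cases:
  assumes T: "T \<in> tiles" and z: "(z, u) \<in> flags T" and f: "(z + u, - u) \<in> flags V"
  obtains "(z + u, - u) \<in> flags T" "tile V g (z + u, - u) = T"
    | "nrm u z = supp T u" "inner_side T u" "tile V g (z + u, - u) = nbr T u" "len (supp T) u \<ge> 1"
      "nrm (- u) (z + u) = supp (nbr T u) (- u)" "\<And>w. nrm u w = supp T u \<Longrightarrow> w \<in> nbr T u \<longleftrightarrow> w \<in> T"
proof (cases "(z + u, - u) \<in> flags T")
  case True
  then show ?thesis using that(1) tile_eq(2)[OF T True] by simp
next
  case False
  note d = flagsD[OF z]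
  have s: "nrm u z = supp T u" by (rule edge_inner_or_side[OF T d(1,2,3) False])
  have i: "inner_side T u" using nbr_eq(1)[OF T d(1,2,3) s] f by simp
  have nb: "nbr T u = tile V g (z + u, - u)" by (rule nbr_eq(2)[OF T d(1,2,3) s i])
  note a = across[OF T d(1,2,3) s f, folded nb]
  show ?thesis
    by (rule that(2)) (use s i nb a(4,5) side_len[OF T d(1,2,3) s] in auto)
qed

text \<open>On a common side, what enters one tile leaves the other one. The first edge of the side, as
  seen from one tile, is the last edge as seen from the other, so by \<open>Phi_profile\<close> both tiles
  prescribe the same differences.\<close>

lemma Phi_compat:
  assumes n: "honeycomb_flow n" and T: "T \<in> tiles" and z: "(z, u) \<in> flags T" and f: "(z + u, - u) \<in> flags V"
  shows "Phi n (tile V g (z + u, - u)) (z + u) - Phi n (tile V g (z + u, - u)) z = Phi n T (z + u) - Phi n T z"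
  using T z f
proof (cases rule: nbr_cases)
  case 2
  note d = flagsD[OF z] note u = d(1)
  define T' where "T' = nbr T u"
  have T': "T' \<in> tiles" using nbr(1)[OF T u 2(4,2)] by (simp add: T'_def)
  have line: "w \<in> T' \<longleftrightarrow> w \<in> T" if "nrm u w = supp T u" for w using 2(6) that by (simp add: T'_def)
  have z': "z + u \<in> T'" "z + u + - u \<in> T'" "nrm (- u) (z + u) = supp T' (- u)" "- u \<in> units"
    using line[of z] line[of "z + u"] 2(1,5) d by (auto simp: T'_def)
  have "Phi n T' z - Phi n T' (z + u) =
      inflow n T' (- u) * of_bool (z + u + u \<notin> T') - outflow n T' (- u) * of_bool (z - u \<notin> T')"
    using Phi_profile[OF n T' z'(4,1,2,3)] by simp
  moreover have "Phi n T (z + u) - Phi n T z =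
      inflow n T u * of_bool (z - u \<notin> T) - outflow n T u * of_bool (z + u + u \<notin> T)"
    by (rule Phi_profile[OF n T u d(2,3) 2(1)])
  moreover have "inflow n T u = outflow n T' (- u)" "outflow n T u = inflow n T' (- u)"
    using flow_across[OF n T u 2(4,2)] by (simp_all add: T'_def)
  moreover have "z + u + u \<in> T' \<longleftrightarrow> z + u + u \<in> T" "z - u \<in> T' \<longleftrightarrow> z - u \<in> T"
    by (rule line; use 2(1) in simp)+
  ultimately show ?thesis unfolding 2(3) T'_def[symmetric] by simp
qed simp

lemma follows_exists:
  assumes n: "honeycomb_flow n"
  obtains \<delta> where "follows n \<delta>"
proof -
  \<comment> \<open>A tile that contains the edge from \<open>z\<close> to \<open>z + u\<close>.\<close>
  define Tf where "Tf z u = tile V g (if (z, u) \<in> flags V then (z, u) else (z + u, - u))" for z u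
  define E where "E z u = Phi n (Tf z u) (z + u) - Phi n (Tf z u) z" for z u
  have E: "E z u = Phi n T (z + u) - Phi n T z" "E (z + u) (- u) = - (Phi n T (z + u) - Phi n T z)"
    if T: "T \<in> tiles" and f: "(z, u) \<in> flags T" for z u T
  proof -
    have fV: "(z, u) \<in> flags V" "tile V g (z, u) = T" using tile_eq[OF T f] by simp_all
    then show "E z u = Phi n T (z + u) - Phi n T z" by (simp add: E_def Tf_def)
    show "E (z + u) (- u) = - (Phi n T (z + u) - Phi n T z)"
      using Phi_compat[OF n T f] fV by (auto simp: E_def Tf_def)
  qed
  obtain \<delta>
    where d: "\<And>z u. u \<in> units \<Longrightarrow> z \<in> V \<Longrightarrow> z + u \<in> V \<Longrightarrow> (z, u) \<in> flags V \<or> (z + u, - u) \<in> flags V \<Longrightarrow> \<delta> (z + u) - \<delta> z = E z u"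
  proof (cases "flags V = {}")
    case True
    then show ?thesis using that by blast
  next
    case False
    have edge: "(z, u) \<in> flags V \<or> (z + u, - u) \<in> flags V" if "u \<in> units" "z \<in> V" "z + u \<in> V" for z u
      by (rule edge_in_flag[OF False that])
    have anti: "E (z + u) (- u) = - E z u" if u: "u \<in> units" and z: "z \<in> V" "z + u \<in> V" for z u
      using edge[OF u z]
    proof
      assume f: "(z, u) \<in> flags V"
      show ?thesis using E[OF tile_mem flags_tile, OF f f] by simp
    next
      assume f: "(z + u, - u) \<in> flags V"
      show ?thesis using E[OF tile_mem flags_tile, OF f f] by simp
    qed
    have tri: "E z (rot u) = E z u + E (z + u) (rot u - u)" if f: "(z, u) \<in> flags V" for z u
    proof -
      let ?T = "tile V g (z, u)"
      have f1: "(z, u) \<in> flags ?T" by (rule flags_tile[OF f])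
      have f2: "(z + u, rot u - u) \<in> flags ?T" by (rule flags_rot[OF f1])
      have f3: "(z + rot u, - rot u) \<in> flags ?T" using flags_rot[OF f2] by simp
      show ?thesis using E(1)[OF tile_mem[OF f] f1] E(1)[OF tile_mem[OF f] f2] E(2)[OF tile_mem[OF f] f3]
        by (simp add: algebra_simps)
    qed
    obtain \<delta> where "\<And>z u. u \<in> units \<Longrightarrow> z \<in> V \<Longrightarrow> z + u \<in> V \<Longrightarrow> \<delta> (z + u) - \<delta> z = E z u"
      using potential_exists[of S E] anti tri by blast
    then show ?thesis using that by blast
  qed
  have "follows n \<delta>"
    unfolding follows_def
  proof (intro allI impI)
    fix T z u assume T: "T \<in> tiles" and f: "(z, u) \<in> flags T"
    show "\<delta> (z + u) - \<delta> z = Phi n T (z + u) - Phi n T z"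
      using d[of u z] flagsD[OF tile_eq(1)[OF T f]] tile_eq(1)[OF T f] E(1)[OF T f] by simp
  qed
  then show ?thesis by (rule that)
qed

lemma followsD:
  assumes d: "follows n \<delta>" and T: "T \<in> tiles" and f: "(z, u) \<in> flags T"
  shows "\<delta> (z + u) - \<delta> z = Phi n T (z + u) - Phi n T z"
    "\<delta> (z + rot u) - \<delta> z = Phi n T (z + rot u) - Phi n T z"
proof -
  show "\<delta> (z + u) - \<delta> z = Phi n T (z + u) - Phi n T z" using d T f unfolding follows_def by blast
  have "(z + rot u, - rot u) \<in> flags T" using flags_rot[OF flags_rot[OF f]] by simp
  then have "\<delta> (z + rot u + - rot u) - \<delta> (z + rot u) = Phi n T (z + rot u + - rot u) - Phi n T (z + rot u)"
    using d T unfolding follows_def by blast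
  then show "\<delta> (z + rot u) - \<delta> z = Phi n T (z + rot u) - Phi n T z" by simp
qed

lemma Phi_concave:
  assumes n: "honeycomb_flow n" and T: "T \<in> tiles" and d: "d \<in> units"
    and z: "z \<in> T" "z + d \<in> T" "z + rot d \<in> T" "z + ror d \<in> T"
  shows "Phi n T (z + rot d) + Phi n T (z + ror d) \<le> Phi n T z + Phi n T (z + d)"
  unfolding Phi_def sum.distrib[symmetric]
proof (intro sum_mono)
  fix u v assume "u \<in> units" "v \<in> units"
  show "n T u v * of_bool (shift T u v (z + rot d)) + n T u v * of_bool (shift T u v (z + ror d))
      \<le> n T u v * of_bool (shift T u v z) + n T u v * of_bool (shift T u v (z + d))"
  proof (cases "n T u v = 0")
    case False
    note p = flow_pass[OF n False]
    have "of_bool (shift T u v (z + rot d)) + of_bool (shift T u v (z + ror d))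
      \<le> of_bool (shift T u v z) + (of_bool (shift T u v (z + d)) :: int)"
      using shift_concave[OF p(5,6) d p(3), of z] z tile_hex[OF T] by simp
    then have "of_int (of_bool (shift T u v (z + rot d)) + of_bool (shift T u v (z + ror d)))
      \<le> (of_int (of_bool (shift T u v z) + of_bool (shift T u v (z + d))) :: real)"
      by (simp only: of_int_le_iff)
    then have "n T u v * (of_bool (shift T u v (z + rot d)) + of_bool (shift T u v (z + ror d)))
      \<le> n T u v * (of_bool (shift T u v z) + of_bool (shift T u v (z + d)))"
      using flow_nonneg[OF n, of T u v] by (intro mult_left_mono) simp_all
    then show ?thesis by (simp only: distrib_left)
  qed simp
qed

text \<open>Concavity can only be lost at edges where it is tight. Such an edge lies inside a tile, and
  there the displacement is concave.\<close>

lemma follows_concave: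
  assumes n: "honeycomb_flow n" and d: "follows n \<delta>"
    and f: "(z, u) \<in> flags V" "(z + u, - u) \<in> flags V"
    and tight: "g (z + rot u) + g (z + ror u) = g z + g (z + u)"
  shows "\<delta> (z + rot u) + \<delta> (z + ror u) \<le> \<delta> z + \<delta> (z + u)"
proof -
  define T where "T = tile V g (z, u)"
  have T: "T \<in> tiles" "(z, u) \<in> flags T" using tile_mem[OF f(1)] flags_tile[OF f(1)] by (simp_all add: T_def)
  have u: "u \<in> units" using flagsD(1)[OF f(1)] .
  have "aff g (z + u) (- u) = aff g z u"
    using aff_cross[OF u, of g z] tight by (simp add: fun_eq_iff)
  then have "tile V g (z + u, - u) = T" by (simp add: tile_def T_def)
  then have f2: "(z + u, - u) \<in> flags T" using flags_tile[OF f(2)] by simp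
  have ap: "z + u + rot (- u) = z + ror u" by (simp add: ror_eq)
  have "z + ror u \<in> T" using flagsD(4)[OF f2] unfolding ap .
  then have "Phi n T (z + rot u) + Phi n T (z + ror u) \<le> Phi n T z + Phi n T (z + u)"
    using flagsD[OF T(2)] by (intro Phi_concave[OF n T(1) u]) auto
  then show ?thesis using followsD[OF d T] followsD[OF d T(1) f2] unfolding ap by simp
qed

text \<open>On a tile with integral slopes there are no strands.\<close>

lemma follows_int_tile:
  assumes n: "honeycomb_flow n" and d: "follows n \<delta>" and f: "(z, u) \<in> flags V"
    and i: "g (z + u) - g z \<in> \<int>" "g (z + rot u) - g z \<in> \<int>"
  shows "\<delta> (z + u) = \<delta> z"
proof -
  define T where "T = tile V g (z, u)"
  have T: "T \<in> tiles" "(z, u) \<in> flags T" using tile_mem[OF f(1)] flags_tile[OF f(1)] by (simp_all add: T_def)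
  note fl = flagsD[OF T(2)]
  have s: "slope T u \<in> \<int>" "slope T (rot u) \<in> \<int>"
    using i slope_edge[OF T(1) fl(2,3)] slope_edge[OF T(1) fl(2,4)] by simp_all
  have "slope T v \<in> \<int>" if "v \<in> units" for v
    using s tile_aff_slope(3,4)[OF T(1)] by (cases rule: units_cases[OF fl(1) that]) auto
  then have "n T v w = 0" for v w using flow_pass(5,7)[OF n, of T v w] by blast
  then show ?thesis using followsD(1)[OF d T] by (simp add: Phi_def)
qed

text \<open>On the boundary the displacement changes only along sides of non-integral slope, by
  \<open>Phi_profile\<close>.\<close>

lemma follows_int_boundary:
  assumes n: "honeycomb_flow n" and d: "follows n \<delta>" and f: "(z, u) \<in> flags V" "(z + u, - u) \<notin> flags V"
    and i: "g (z + u) - g z \<in> \<int>"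
  shows "\<delta> (z + u) = \<delta> z"
proof -
  define T where "T = tile V g (z, u)"
  have T: "T \<in> tiles" "(z, u) \<in> flags T" using tile_mem[OF f(1)] flags_tile[OF f(1)] by (simp_all add: T_def)
  note fl = flagsD[OF T(2)]
  have "(z + u, - u) \<notin> flags T" using f(2) tile_eq(1)[OF T(1)] by blast
  then have s: "nrm u z = supp T u" by (rule edge_inner_or_side[OF T(1) fl(1,2,3)])
  have "slope T u \<in> \<int>" using i slope_edge[OF T(1) fl(2,3)] by simp
  then have "(T, u) \<notin> darts" by (simp add: darts_def)
  then show ?thesis
    using followsD(1)[OF d T] Phi_profile[OF n T(1) fl(1,2,3) s] flow_zero[OF n] by simp
qed

section \<open>Bounds on the slopes\<close>

text \<open>Let \<open>K\<close> be an integer that bounds all slopes, and let the tile attain it in the direction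
  \<open>m\<close>. As \<open>K\<close> is an integer, no strand uses the direction of \<open>m\<close>, so \<open>shift_antimono\<close> applies once
  one of the two sides facing against \<open>m\<close> is degenerate. An inner such side is impossible, because
  the slope in direction \<open>m\<close> would be even larger beyond it. If both were boundary sides, their
  slopes would be at most \<open>B\<close> in absolute value, but their difference is \<open>K > 2 * B\<close>.\<close>

lemma Phi_antimono_steep:
  fixes K B :: real
  assumes n: "honeycomb_flow n" and T: "T \<in> tiles" and m: "m \<in> units" and w: "w \<in> T" "w + m \<in> T"
    and K: "slope T m = K" "K \<in> \<int>" "2 * B < K"
    and all: "\<And>T' v. T' \<in> tiles \<Longrightarrow> v \<in> units \<Longrightarrow> slope T' v \<le> K"
    and bd: "\<And>z u. (z, u) \<in> flags V \<Longrightarrow> (z + u, - u) \<notin> flags V \<Longrightarrow> \<bar>g (z + u) - g z\<bar> \<le> B"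
  shows "Phi n T (w + m) \<le> Phi n T w"
proof -
  have side_bound: "\<bar>slope T u\<bar> \<le> B" if u: "u \<in> units" "nrm u m = -1" "len (supp T) u \<ge> 1" for u
  proof -
    note s = side_mem[OF T u(1,3)]
    note b = across_back[OF T u(1) s]
    have "(side T u + u, - u) \<notin> flags V"
    proof
      assume f: "(side T u + u, - u) \<in> flags V"
      note a = across[OF T u(1) s f]
      obtain \<kappa> where "\<kappa> > 0" "slope (tile V g (side T u + u, - u)) m = slope T m - of_int (nrm u m) * \<kappa>"
        using a(6) by blast
      then show False using all[OF a(1) m] u(2) K by simp
    qed
    then show ?thesis using bd[OF b(1)] slope_edge[OF T s(1,2)] by simp
  qed
  have left: "len (supp T) (ror m) = 0 \<or> len (supp T) (ror (ror m)) = 0"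
  proof (rule ccontr)
    assume "\<not> ?thesis"
    moreover have r: "ror m \<in> units" "ror (ror m) \<in> units" "ror (ror m) = - rot m" using m by (simp_all add: ror_eq)
    ultimately have "len (supp T) (ror m) \<ge> 1" "len (supp T) (ror (ror m)) \<ge> 1"
      using tile_len[OF T] by (metis int_one_le_iff_zero_less order_le_less)+
    then have "\<bar>slope T (ror m)\<bar> \<le> B" "\<bar>slope T (ror (ror m))\<bar> \<le> B"
      using m r by (auto intro!: side_bound simp: ror_eq)
    moreover have "slope T m = slope T (ror m) - slope T (ror (ror m))"
      using tile_aff_slope(3)[OF T, of m "rot m"] tile_aff_slope(4)[OF T, of "rot m"] by (simp add: ror_eq)
    ultimately show False using K by linarith
  qed
  show ?thesis
    unfolding Phi_def
  proof (intro sum_mono)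
    fix u v assume "u \<in> units" "v \<in> units"
    show "n T u v * of_bool (shift T u v (w + m)) \<le> n T u v * of_bool (shift T u v w)"
    proof (cases "n T u v = 0")
      case False
      note p = flow_pass[OF n False]
      have "m \<noteq> u" "m \<noteq> v" using K p by auto
      moreover have "m \<noteq> - u" "m \<noteq> - v" using K p tile_aff_slope(4)[OF T] by (metis Ints_minus minus_minus)+
      ultimately have "shift T u v (w + m) \<Longrightarrow> shift T u v w"
        using shift_antimono[OF p(5,6) m p(3) tile_len[OF T], of w] w left tile_hex[OF T] by simp
      then show ?thesis using flow_nonneg[OF n, of T u v] by (simp add: of_bool_def)
    qed simp
  qed
qed

lemma follows_steep:
  fixes K B :: real
  assumes n: "honeycomb_flow n" and d: "follows n \<delta>" and f: "(z, u) \<in> flags V"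
    and K: "K \<in> \<int>" "2 * B < K"
    and all: "\<And>z u. (z, u) \<in> flags V \<Longrightarrow> \<bar>g (z + u) - g z\<bar> \<le> K"
    and bd: "\<And>z u. (z, u) \<in> flags V \<Longrightarrow> (z + u, - u) \<notin> flags V \<Longrightarrow> \<bar>g (z + u) - g z\<bar> \<le> B"
  shows "g (z + u) - g z = K \<Longrightarrow> \<delta> (z + u) \<le> \<delta> z" "g (z + u) - g z = - K \<Longrightarrow> \<delta> (z + u) \<ge> \<delta> z"
proof -
  have all': "slope T' v \<le> K" if T': "T' \<in> tiles" and v: "v \<in> units" for T' v
  proof -
    obtain y w where yw: "(y, w) \<in> flags T'" using tilesD(4)[OF T'] by auto
    have f1: "\<bar>slope T' x\<bar> \<le> K" if x: "(y, x) \<in> flags T'" for y x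
      using all[OF tile_eq(1)[OF T' x]] slope_edge[OF T' flagsD(2,3)[OF x]] by simp
    have r1: "\<bar>slope T' w\<bar> \<le> K" by (rule f1[OF yw])
    have r2: "\<bar>slope T' (rot w - w)\<bar> \<le> K" by (rule f1[OF flags_rot[OF yw]])
    have "(y + rot w, - rot w) \<in> flags T'" using flags_rot[OF flags_rot[OF yw]] by simp
    then have r3: "\<bar>slope T' (- rot w)\<bar> \<le> K" by (rule f1)
    show ?thesis using r1 r2 r3 tile_aff_slope(3,4)[OF T']
      by (cases rule: units_cases[OF flagsD(1)[OF yw] v]) auto
  qed
  define T where "T = tile V g (z, u)"
  have T: "T \<in> tiles" "(z, u) \<in> flags T" using tile_mem[OF f] flags_tile[OF f] by (simp_all add: T_def)
  note fl = flagsD[OF T(2)]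
  have s: "slope T u = g (z + u) - g z" using slope_edge[OF T(1) fl(2,3)] by simp
  show "\<delta> (z + u) \<le> \<delta> z" if "g (z + u) - g z = K"
    using Phi_antimono_steep[OF n T(1) fl(1,2,3) _ K all' bd] s that followsD(1)[OF d T] by simp
  show "\<delta> (z + u) \<ge> \<delta> z" if "g (z + u) - g z = - K"
  proof -
    have "- u \<in> units" "z + u \<in> T" "z + u + - u \<in> T" "slope T (- u) = K"
      using fl s that tile_aff_slope(4)[OF T(1)] by simp_all
    from Phi_antimono_steep[OF n T(1) this K all' bd] followsD(1)[OF d T] show ?thesis by simp
  qed
qed

section \<open>Opposite moves\<close>

text \<open>The sum of the displacements of the flow and of the reversed flow, normalized by a constant
  (\<open>bump_eq\<close>).\<close>

definition bump :: "(lpt set \<Rightarrow> lpt \<Rightarrow> lpt \<Rightarrow> real) \<Rightarrow> lpt set \<Rightarrow> lpt \<Rightarrow> real" where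
  "bump n T w = (\<Sum>u\<in>units. \<Sum>v\<in>units. n T u v * (of_bool (shift T u v w) + of_bool (shift T v u w) - 1))"

lemma bump_eq: "bump n T w = Phi n T w + Phi (\<lambda>T u v. n T v u) T w - (\<Sum>u\<in>units. \<Sum>v\<in>units. n T u v)"
proof -
  have "Phi (\<lambda>T u v. n T v u) T w = (\<Sum>u\<in>units. \<Sum>v\<in>units. n T u v * of_bool (shift T v u w))"
    unfolding Phi_def by (rule sum.swap)
  then show ?thesis
    unfolding bump_def Phi_def by (simp add: algebra_simps sum.distrib sum_subtractf)
qed

lemma bump_nonneg:
  assumes n: "honeycomb_flow n" and T: "T \<in> tiles" and w: "w \<in> T"
  shows "bump n T w \<ge> 0"
  unfolding bump_def
proof (intro sum_nonneg)
  fix u v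
  show "n T u v * (of_bool (shift T u v w) + of_bool (shift T v u w) - 1) \<ge> 0"
  proof (cases "n T u v = 0")
    case False
    note p = flow_pass[OF n False]
    have "shift T u v w \<or> shift T v u w"
      using shift_cover[OF p(5,6,3) tile_len[OF T], of w] w tile_hex[OF T] by simp
    then show ?thesis using flow_nonneg[OF n, of T u v] by (auto intro!: mult_nonneg_nonneg)
  qed simp
qed

lemma bump_side:
  assumes n: "honeycomb_flow n" and T: "T \<in> tiles" and w: "w \<in> T" and m: "m \<in> units" "nrm m w = supp T m"
  shows "bump n T w = (inflow n T m + outflow n T m) * of_bool (w + m \<in> T \<and> w - m \<in> T)"
proof -
  let ?P = "w + m \<in> T \<and> w - m \<in> T"
  have e: "n T u v * (of_bool (shift T u v w) + of_bool (shift T v u w) - 1)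
      = n T u v * of_bool (m = u \<and> ?P) + n T u v * of_bool (m = v \<and> ?P)" for u v
  proof (cases "n T u v = 0")
    case False
    note p = flow_pass[OF n False]
    have c: "shift T u v w \<or> shift T v u w"
      using shift_cover[OF p(5,6,3) tile_len[OF T], of w] w tile_hex[OF T] by simp
    have b: "(shift T u v w \<and> shift T v u w) \<longleftrightarrow> (m = u \<or> m = v) \<and> ?P"
      using shift_both_on_side[OF p(5,6) m(1) p(3) tile_len[OF T], of w] w m(2) tile_hex[OF T] by simp
    have "u \<noteq> v" using p(3) rot_nz[OF p(5)] by (auto simp: pass_def)
    then have "of_bool (shift T u v w) + of_bool (shift T v u w) - 1
        = (of_bool (m = u \<and> ?P) + of_bool (m = v \<and> ?P) :: real)"
      using b c by auto
    then show ?thesis by (metis distrib_left)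
  qed simp
  show ?thesis
    unfolding bump_def e sum.distrib sum_units_at[OF m(1)] inflow_def outflow_def by (simp add: distrib_right)
qed

lemma bump_adjacent:
  assumes n: "honeycomb_flow n" and f: "(w, u) \<in> flags V" "(w, rot u) \<in> flags V"
  shows "bump n (tile V g (w, u)) w = bump n (tile V g (w, rot u)) w"
proof -
  define T where "T = tile V g (w, u)"
  have T: "T \<in> tiles" "(w, u) \<in> flags T" using tile_mem[OF f(1)] flags_tile[OF f(1)] by (simp_all add: T_def)
  have z: "(w + rot u, - rot u) \<in> flags T" using flags_rot[OF flags_rot[OF T(2)]] by simp
  have f': "(w + rot u + - rot u, - (- rot u)) \<in> flags V" using f(2) by simp
  show ?thesis
    using T(1) z f'
  proof (cases rule: nbr_cases)
    case 1
    then show ?thesis by (simp add: T_def)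
  next
    case 2
    define m where "m = - rot u"
    have m: "m \<in> units" using flagsD(1)[OF z] by (simp add: m_def)
    define T' where "T' = nbr T m"
    have T': "T' \<in> tiles" using nbr(1)[OF T(1) m 2(4,2)[folded m_def]] by (simp add: T'_def)
    have line: "x \<in> T' \<longleftrightarrow> x \<in> T" if "nrm m x = supp T m" for x using 2(6) that by (simp add: T'_def m_def)
    have w: "nrm m w = supp T m" using 2(1) m by (simp add: m_def)
    have w': "nrm (- m) w = supp T' (- m)" using 2(5) by (simp add: m_def T'_def)
    have wT: "w \<in> T" using flagsD[OF T(2)] by simp
    have "bump n T w = (inflow n T m + outflow n T m) * of_bool (w + m \<in> T \<and> w - m \<in> T)"
      by (rule bump_side[OF n T(1) wT m w])
    moreover have "bump n T' w = (inflow n T' (- m) + outflow n T' (- m)) * of_bool (w + - m \<in> T' \<and> w - (- m) \<in> T')"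
      by (rule bump_side[OF n T' _ _ w']) (use line[OF w] wT m in auto)
    moreover have "w + m \<in> T' \<longleftrightarrow> w + m \<in> T" "w - m \<in> T' \<longleftrightarrow> w - m \<in> T"
      by (rule line; use w in simp)+
    moreover have "inflow n T m = outflow n T' (- m)" "outflow n T m = inflow n T' (- m)"
      using flow_across[OF n T(1) m 2(4,2)[folded m_def]] by (simp_all add: T'_def)
    ultimately have "bump n T w = bump n T' w" by (auto simp: add.commute)
    then show ?thesis using 2(3) by (simp add: T_def T'_def m_def)
  qed
qed

text \<open>Neighbouring tiles see the same value of \<open>bump\<close> at a common point, because it is determined
  there by the total flow through the common side (\<open>bump_side\<close>). Hence \<open>bump\<close> is a well-defined
  function of the point, although the displacements of the two flows are defined only up to
  constants.\<close>

lemma bump_unique: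
  assumes n: "honeycomb_flow n" and f: "(w, u) \<in> flags V" "(w, v) \<in> flags V"
  shows "bump n (tile V g (w, u)) w = bump n (tile V g (w, v)) w"
proof -
  note u = flagsD[OF f(1)] note v = flagsD[OF f(2)]
  have adj: "bump n (tile V g (w, x)) w = bump n (tile V g (w, rot x)) w"
    if "x \<in> units" "w + x \<in> V" "w + rot x \<in> V" "w + rot (rot x) \<in> V" for x
    using that u(2) by (intro bump_adjacent[OF n]) (auto simp: flags_def)
  show ?thesis
  proof (cases rule: units_cases[OF u(1) v(1)])
    case 1 then show ?thesis by simp
  next
    case 2 then show ?thesis using adj[of u] u v by simp
  next
    case 3 then show ?thesis using adj[of u] adj[of "rot u"] u v by simp
  next
    case 4
    have "w + rot (rot u) \<in> V"
      using hex_closed[of "rot u" w S] u v 4 by simp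
    then show ?thesis using adj[of u] adj[of "rot u"] adj[of "rot (rot u)"] u v 4 by simp
  next
    case 5
    then show ?thesis using adj[of v] adj[of "rot v"] u v by simp
  next
    case 6
    then show ?thesis using adj[of v] u v by simp
  qed
qed

end

lemma vertex_in_flag:
  assumes "flags (hex S) \<noteq> {}" "w \<in> hex S"
  obtains u where "(w, u) \<in> flags (hex S)"
proof -
  obtain f where f: "f \<in> flags (hex S)" using assms by auto
  have "\<exists>u. (w, u) \<in> flags (hex S)"
  proof (rule triangle_walk_lattice[OF f])
    fix z u assume "(z, u) \<in> flags (hex S)"
    then show "u \<in> units" "(z + u, rot u - u) \<in> flags (hex S)"
      "nrm u z < nrm u w \<Longrightarrow> (z + u, - u) \<in> flags (hex S)"
      using flagsD(1) flags_rot flags_cross[OF _ assms(2)] by blast+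
  qed
  then show ?thesis using that by blast
qed

context concave_grid begin

text \<open>The displacement changes by the inflow at the first edge of a side and by minus the outflow
  at the last one, or by the difference if the side has only one edge. Not all of these changes
  vanish.\<close>

lemma follows_nonconstant:
  assumes n: "honeycomb_flow n" and d: "follows n \<delta>" and D: "(T, u) \<in> darts" and ne: "inflow n T u \<noteq> outflow n T u"
  shows "\<exists>z\<in>V. \<exists>y\<in>V. \<delta> y \<noteq> \<delta> z"
proof -
  have T: "T \<in> tiles" and u: "u \<in> units" and l: "len (supp T) u \<ge> 1" using D by (auto simp: darts_def)
  have diff: "\<delta> (z + u) - \<delta> z = inflow n T u * of_bool (z - u \<notin> T) - outflow n T u * of_bool (z + u + u \<notin> T)"
    and V: "z \<in> V" "z + u \<in> V"
    if z: "z \<in> T" "z + u \<in> T" "nrm u z = supp T u" for z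
    using followsD(1)[OF d T side_flag[OF T u z]] Phi_profile[OF n T u z] tilesD(1)[OF T] z by auto
  obtain a where a: "a \<in> T" "a + u \<in> T" "nrm u a = supp T u" "a - u \<notin> T"
    using side_edge_exists[OF T u l] .
  \<comment> \<open>The last edge of the side; the first one is \<open>a\<close>.\<close>
  obtain b where b: "b \<in> T" "b + u \<in> T" "nrm u b = supp T u" "b + u + u \<notin> T"
  proof -
    let ?A = "{b \<in> T. b + u \<in> T \<and> nrm u b = supp T u}"
    have fin: "finite ?A" "?A \<noteq> {}" using tilesD(2)[OF T] a by auto
    have "Max (nrm (rot u) ` ?A) \<in> nrm (rot u) ` ?A" using fin by (intro Max_in) simp_all
    then obtain b where b: "Max (nrm (rot u) ` ?A) = nrm (rot u) b" "b \<in> ?A" by (rule imageE)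
    have "b + u + u \<notin> T"
    proof
      assume "b + u + u \<in> T"
      then have bA: "b + u \<in> ?A" using b(2) u by simp
      have "nrm (rot u) (b + u) \<le> Max (nrm (rot u) ` ?A)"
        by (rule Max_ge[OF finite_imageI[OF fin(1)] imageI[OF bA]])
      then show False using b(1) u by simp
    qed
    then show ?thesis using b(2) by (intro that) simp_all
  qed
  have "\<delta> (a + u) \<noteq> \<delta> a \<or> \<delta> (b + u) \<noteq> \<delta> b"
    using diff[OF a(1-3)] diff[OF b(1-3)] a(4) b(4) ne by (auto simp: of_bool_def split: if_splits)
  then show ?thesis using V[OF a(1-3)] V[OF b(1-3)] by blast
qed

text \<open>The reversed flow is followed by \<open>c - \<delta>\<close>, where \<open>c\<close> is the well-defined function \<open>bump\<close>. At
  the corner \<open>v\<close> it vanishes by \<open>bump_side\<close>, as \<open>v\<close> lies on the support line of its tile in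
  direction \<open>u\<close>, but \<open>v - u\<close> is outside.\<close>

lemma bump_potential:
  assumes n: "honeycomb_flow n" and d: "follows n \<delta>" and ne: "flags V \<noteq> {}"
    and v: "v \<in> V" "u \<in> units" "nrm u v = supp V u" "v - u \<notin> V"
  obtains c where "\<And>w. w \<in> V \<Longrightarrow> c w \<ge> 0" "c v = 0" "follows (\<lambda>T u v. n T v u) (\<lambda>w. c w - \<delta> w)"
proof -
  define fl where "fl w = (SOME x. (w, x) \<in> flags V)" for w
  have fl: "(w, fl w) \<in> flags V" if "w \<in> V" for w
    using vertex_in_flag[OF ne that] unfolding fl_def by (metis someI)
  define c where "c w = bump n (tile V g (w, fl w)) w" for w
  have c: "c w = bump n T w" if T: "T \<in> tiles" and f: "(w, x) \<in> flags T" for w x T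
    using bump_unique[OF n fl[of w] tile_eq(1)[OF T f]] tile_eq(2)[OF T f] flagsD(2)[OF tile_eq(1)[OF T f]]
    by (simp add: c_def)
  show ?thesis
  proof (rule that)
    show "c w \<ge> 0" if "w \<in> V" for w
      unfolding c_def
      using bump_nonneg[OF n tile_mem[OF fl[OF that]]] flagsD(2)[OF flags_tile[OF fl[OF that]]] by simp
    show "c v = 0"
    proof -
      define T where "T = tile V g (v, fl v)"
      have T: "T \<in> tiles" "v \<in> T" unfolding T_def
        using tile_mem[OF fl[OF v(1)]] flagsD(2)[OF flags_tile[OF fl[OF v(1)]]] by simp_all
      have "supp T u \<le> supp V u"
        unfolding supp_def using tilesD(1,3)[OF T(1)] finite_hex by (intro Max_mono) auto
      then have "nrm u v = supp T u" using supp_ge[OF tilesD(2)[OF T(1)] T(2), of u] v(3) by simp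
      moreover have "v - u \<notin> T" using v(4) tilesD(1)[OF T(1)] by blast
      ultimately show ?thesis using bump_side[OF n T v(2)] by (simp add: c_def T_def)
    qed
    show "follows (\<lambda>T u v. n T v u) (\<lambda>w. c w - \<delta> w)"
      unfolding follows_def
    proof (intro allI impI)
      fix T z x assume T: "T \<in> tiles" and f: "(z, x) \<in> flags T"
      have "c z = bump n T z" "c (z + x) = bump n T (z + x)" using c[OF T f] c[OF T flags_rot[OF f]] by simp_all
      then show "c (z + x) - \<delta> (z + x) - (c z - \<delta> z) = Phi (\<lambda>T u v. n T v u) T (z + x) - Phi (\<lambda>T u v. n T v u) T z"
        using followsD(1)[OF d T f] by (simp add: bump_eq)
    qed
  qed
qed

lemma two_sided_move:
  assumes D: "darts \<noteq> {}" and ne: "flags V \<noteq> {}"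
    and v: "v \<in> V" "u \<in> units" "nrm u v = supp V u" "v - u \<notin> V"
  obtains n1 n2 \<delta>1 \<delta>2 where "honeycomb_flow n1" "follows n1 \<delta>1" "honeycomb_flow n2" "follows n2 \<delta>2"
    "\<delta>1 v = 0" "\<delta>2 v = 0" "\<And>w. w \<in> V \<Longrightarrow> \<delta>1 w + \<delta>2 w \<ge> 0" "\<exists>w\<in>V. \<delta>1 w \<noteq> 0"
proof -
  obtain n T x where n: "honeycomb_flow n" "(T, x) \<in> darts" "inflow n T x \<noteq> outflow n T x"
    using flow_exists[OF D] .
  obtain \<delta> where d: "follows n \<delta>" using follows_exists[OF n(1)] .
  define \<delta>1 where "\<delta>1 w = \<delta> w - \<delta> v" for w
  have d1: "follows n \<delta>1" using d by (simp add: follows_def \<delta>1_def)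
  obtain c where c: "\<And>w. w \<in> V \<Longrightarrow> c w \<ge> 0" "c v = 0" "follows (\<lambda>T u v. n T v u) (\<lambda>w. c w - \<delta>1 w)"
  proof (rule bump_potential[OF n(1) d1 ne v])
  qed (rule that)
  obtain z y where zy: "z \<in> V" "y \<in> V" "\<delta> y \<noteq> \<delta> z" using follows_nonconstant[OF n(1) d n(2,3)] by blast
  then have "\<delta>1 z \<noteq> 0 \<or> \<delta>1 y \<noteq> 0" by (auto simp: \<delta>1_def)
  then have nz: "\<exists>w\<in>V. \<delta>1 w \<noteq> 0" using zy by blast
  show ?thesis
    by (rule that[OF n(1) d1 flow_reverse[OF n(1)] c(3)]) (use c(1,2) nz in \<open>auto simp: \<delta>1_def\<close>)
qed

end

lemma corner_exists:
  assumes "w \<in> hex S" "u \<in> units"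
  obtains v where "v \<in> hex S" "nrm u v = supp (hex S) u" "v - u \<notin> hex S"
proof -
  let ?A = "{v \<in> hex S. nrm u v = supp (hex S) u}"
  have "?A \<noteq> {}" using supp_attained[OF finite_hex, of S u] assms by blast
  moreover have "finite ?A" using finite_hex by simp
  ultimately have "Min (nrm (rot u) ` ?A) \<in> nrm (rot u) ` ?A" by (intro Min_in) simp_all
  then obtain v where v: "Min (nrm (rot u) ` ?A) = nrm (rot u) v" "v \<in> ?A" by (rule imageE)
  have "v - u \<notin> hex S"
  proof
    assume "v - u \<in> hex S"
    then have vA: "v - u \<in> ?A" using v(2) by simp
    have "Min (nrm (rot u) ` ?A) \<le> nrm (rot u) (v - u)"
      by (rule Min_le[OF finite_imageI[OF \<open>finite ?A\<close>] imageI[OF vA]])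
    then show False using v(1) assms(2) by simp
  qed
  then show ?thesis using v(2) by (intro that) simp_all
qed

text \<open>This is the theorem of Tychonoff for products of intervals.\<close>

lemma compact_function_box:
  fixes R :: "'a \<Rightarrow> real"
  shows "compact {x :: 'a \<Rightarrow> real. \<forall>w. \<bar>x w\<bar> \<le> R w}"
proof -
  have "compactin (product_topology (\<lambda>i. euclidean) UNIV) (PiE UNIV (\<lambda>w. {- R w .. R w}))"
    unfolding compactin_PiE by simp
  moreover have "PiE UNIV (\<lambda>w. {- R w .. R w}) = {x. \<forall>w. \<bar>x w\<bar> \<le> R w}"
    by (simp add: PiE_UNIV_domain Pi_def abs_le_iff minus_le_iff conj_commute)
  ultimately show ?thesis unfolding euclidean_product_topology by simp
qed

lemma exp_above_tangent:
  fixes a :: real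
  assumes "a \<noteq> 0"
  shows "1 + a < exp a"
proof (cases "1 + a / 2 \<ge> 0")
  case True
  have "0 < a * a" using assms by (metis not_real_square_gt_zero)
  then have "1 + a < (1 + a / 2)\<^sup>2" by (simp add: power2_eq_square algebra_simps)
  also have "\<dots> \<le> (exp (a / 2))\<^sup>2" using True by (intro power_mono) (simp add: exp_ge_add_one_self)
  also have "\<dots> = exp a" by (simp add: power2_eq_square exp_add[symmetric])
  finally show ?thesis .
next
  case False
  then have "1 + a < 0" by simp
  then show ?thesis using exp_gt_zero[of a] by linarith
qed

text \<open>A strict inequality survives small moves, and a tight one survives if the move does not go
  the wrong way.\<close>

lemma eventually_affine_le:
  fixes a b c :: real
  assumes "a < c \<or> a = c \<and> b \<le> 0"
  shows "eventually (\<lambda>e. a + e * b \<le> c) (at_right 0)"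
  using assms
proof
  assume "a < c"
  have "((\<lambda>e. a + e * b) \<longlongrightarrow> a + 0 * b) (at_right 0)" by (intro tendsto_intros)
  then have "eventually (\<lambda>e. a + e * b < c) (at_right 0)" using \<open>a < c\<close> by (intro order_tendstoD) auto
  then show ?thesis by (rule eventually_mono) simp
next
  assume "a = c \<and> b \<le> 0"
  then show ?thesis unfolding eventually_at_right_field
    by (auto intro!: exI[of _ 1] simp: mult_le_0_iff)
qed

section \<open>The integral maximizer\<close>

text \<open>The constraints \<open>X\<close> are chosen such that they survive small moves: for each of them, a move
  is harmless where the constraint is tight. So at a maximum of the sum of \<open>exp (x w)\<close> over \<open>X\<close>
  there is no move, that is, there is no side of non-integral slope.\<close>

theorem integer_lattice_function:
  fixes g :: "lpt \<Rightarrow> real"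
  assumes conc: "lattice_concave (hex S) g" and ne: "flags (hex S) \<noteq> {}"
  obtains g' where "lattice_concave (hex S) g'"
    "\<And>z u. (z, u) \<in> flags (hex S) \<Longrightarrow> g' (z + u) - g' z \<in> \<int>"
    "\<And>z u. (z, u) \<in> flags (hex S) \<Longrightarrow> g (z + u) - g z \<in> \<int> \<Longrightarrow>
       g (z + rot u) - g z \<in> \<int> \<or> (z + u, - u) \<notin> flags (hex S) \<Longrightarrow> g' (z + u) - g' z = g (z + u) - g z"
proof -
  define V where "V = hex S"
  have finV: "finite V" unfolding V_def by (rule finite_hex)
  have flV: "flags V \<subseteq> V \<times> units" by (auto simp: flags_def)
  have finF: "finite (flags V)" by (rule finite_subset[OF flV]) (simp add: finV)
  obtain z0 u0 where f0: "(z0, u0) \<in> flags V" using ne by (auto simp: V_def)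
  obtain v where v: "v \<in> V" "nrm u0 v = supp V u0" "v - u0 \<notin> V"
    using corner_exists[of z0 S u0] flagsD[OF f0] unfolding V_def by blast
  define bd where "bd = {(z, u). (z, u) \<in> flags V \<and> (z + u, - u) \<notin> flags V}"
  \<comment> \<open>The edges on which the values have to be kept. Two integral edges of a triangle
    make the third one integral.\<close>
  define Fr where "Fr = {(z, u). (z, u) \<in> flags V \<and> g (z + u) - g z \<in> \<int> \<and>
     (g (z + rot u) - g z \<in> \<int> \<or> (z, u) \<in> bd)}"
  obtain B :: int where B: "\<And>z u. (z, u) \<in> flags V \<Longrightarrow> \<bar>g (z + u) - g z\<bar> \<le> B" "B \<ge> 0"
  proof -
    let ?M = "Max ((\<lambda>(z, u). \<bar>g (z + u) - g z\<bar>) ` flags V)"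
    have M: "\<bar>g (z + u) - g z\<bar> \<le> ?M" if "(z, u) \<in> flags V" for z u
      using finF that by (intro Max_ge) (auto intro!: image_eqI[of _ _ "(z, u)"])
    then have "\<bar>g (z + u) - g z\<bar> \<le> of_int \<lceil>?M\<rceil>" if "(z, u) \<in> flags V" for z u
      using that le_of_int_ceiling order_trans by blast
    moreover have "\<lceil>?M\<rceil> \<ge> 0" using M[OF f0] by linarith
    ultimately show ?thesis using that by blast
  qed
  \<comment> \<open>Both bounds are integers, so that an edge which attains its bound has integral
    slope. The given function satisfies the smaller bound \<open>B\<close> everywhere.\<close>
  define K :: int where "K = 2 * B + 1"
  define X where "X = {x :: lpt \<Rightarrow> real. (\<forall>w. w \<notin> V \<longrightarrow> x w = 0) \<and> x v = 0 \<and> lattice_concave V x \<and>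
     (\<forall>(z, u) \<in> Fr. x (z + u) - x z = g (z + u) - g z) \<and>
     (\<forall>(z, u) \<in> flags V. \<bar>x (z + u) - x z\<bar> \<le> K) \<and>
     (\<forall>(z, u) \<in> bd. \<bar>x (z + u) - x z\<bar> \<le> B)}"
  have cX: "compact X"
  proof -
    \<comment> \<open>The values of a concave function are bounded by its affine functions at \<open>v\<close> and
      at \<open>w\<close>, and the slopes of these are bounded by \<open>K\<close>.\<close>
    define R where "R w = 2 * real_of_int K * (\<Sum>u\<in>units. \<bar>of_int (nrm u (w - v))\<bar>)" for w
    have aff_bound: "\<bar>aff x z u w - x z\<bar> \<le> 2 * real_of_int K * (\<Sum>u\<in>units. \<bar>of_int (nrm u (w - z))\<bar>)"
      if x: "x \<in> X" and f: "(z, u) \<in> flags V" for x z u w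
    proof -
      note u = flagsD(1)[OF f]
      let ?s = "\<Sum>u\<in>units. \<bar>real_of_int (nrm u (w - z))\<bar>"
      have "(z + rot u, - rot u) \<in> flags V" using flags_rot[OF flags_rot[OF f]] by simp
      then have "\<bar>x (z + rot u + - rot u) - x (z + rot u)\<bar> \<le> K" using x unfolding X_def by blast
      then have k2: "\<bar>x (z + rot u) - x z\<bar> \<le> K" by simp
      have k1: "\<bar>x (z + u) - x z\<bar> \<le> K" using x f unfolding X_def by blast
      have s: "\<bar>real_of_int (nrm y (w - z))\<bar> \<le> ?s" if "y \<in> units" for y
        by (rule member_le_sum[OF that]) simp_all
      have "\<bar>aff x z u w - x z\<bar> \<le> \<bar>of_int (nrm (rot u) (w - z))\<bar> * \<bar>x (z + u) - x z\<bar>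
          + \<bar>of_int (nrm u (w - z))\<bar> * \<bar>x (z + rot u) - x z\<bar>"
        unfolding aff_def abs_mult[symmetric] by linarith
      also have "\<dots> \<le> ?s * K + ?s * K"
        using s[of u] s[of "rot u"] k1 k2 u by (intro add_mono mult_mono) (auto intro: sum_nonneg)
      finally show ?thesis by (simp add: algebra_simps)
    qed
    have "X \<subseteq> {x. \<forall>w. \<bar>x w\<bar> \<le> R w}"
    proof (intro subsetI CollectI allI)
      fix x w assume x: "x \<in> X"
      have cx: "lattice_concave (hex S) x" and xv: "x v = 0" using x by (auto simp: X_def V_def)
      have Rn: "R w \<ge> 0" unfolding R_def K_def using B(2) by (intro mult_nonneg_nonneg sum_nonneg) auto
      show "\<bar>x w\<bar> \<le> R w"
      proof (cases "w \<in> V")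
        case False then show ?thesis using x Rn by (simp add: X_def)
      next
        case True
        obtain a where a: "(w, a) \<in> flags V" using vertex_in_flag[OF ne] True unfolding V_def by blast
        obtain b where b: "(v, b) \<in> flags V" using vertex_in_flag[OF ne] v(1) unfolding V_def by blast
        have "x w \<le> aff x v b w" using lattice_concave_below_aff[OF cx b[unfolded V_def] True[unfolded V_def]] .
        moreover have "x v \<le> aff x w a v" using lattice_concave_below_aff[OF cx a[unfolded V_def] v(1)[unfolded V_def]] .
        moreover have "(\<Sum>u\<in>units. \<bar>real_of_int (nrm u (v - w))\<bar>) = (\<Sum>u\<in>units. \<bar>real_of_int (nrm u (w - v))\<bar>)"
          by (rule sum.cong) (auto simp: abs_minus_commute)
        ultimately show ?thesis using aff_bound[OF x b, of w] aff_bound[OF x a, of v] xv unfolding R_def by simp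
      qed
    qed
    moreover have "closed X"
    proof -
      have "X = {x. \<forall>w. w \<notin> V \<longrightarrow> x w = 0} \<inter> {x. x v = 0} \<inter>
        {x. \<forall>z u. (z, u) \<in> flags V \<and> (z + u, - u) \<in> flags V \<longrightarrow> x (z + rot u) + x (z + ror u) \<le> x z + x (z + u)} \<inter>
        {x. \<forall>f\<in>Fr. x (fst f + snd f) - x (fst f) = g (fst f + snd f) - g (fst f)} \<inter>
        {x. \<forall>f\<in>flags V. \<bar>x (fst f + snd f) - x (fst f)\<bar> \<le> K} \<inter>
        {x. \<forall>f\<in>bd. \<bar>x (fst f + snd f) - x (fst f)\<bar> \<le> B}"
        unfolding X_def lattice_concave_def by (auto simp: case_prod_beta)
      moreover have "closed \<dots>"
        unfolding Ball_def
        by (intro closed_Int closed_Collect_all closed_Collect_imp closed_Collect_eq closed_Collect_le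
            open_Collect_const continuous_intros continuous_on_product_coordinates)
      ultimately show ?thesis by simp
    qed
    ultimately show ?thesis
      using compact_Int_closed[OF compact_function_box[of R], of X] by (simp add: Int_absorb1)
  qed
  have neX: "X \<noteq> {}"
  proof -
    define x where "x w = (if w \<in> V then g w - g v else 0)" for w
    have d: "x p - x q = g p - g q" if "p \<in> V" "q \<in> V" for p q using that by (simp add: x_def)
    have conc_x: "lattice_concave V x"
      unfolding lattice_concave_def
    proof (intro allI impI)
      fix z u assume f: "(z, u) \<in> flags V \<and> (z + u, - u) \<in> flags V"
      then have "g (z + rot u) + g (z + ror u) \<le> g z + g (z + u)" using conc unfolding lattice_concave_def V_def by blast
      moreover have "z + u + rot (- u) = z + ror u" by (simp add: ror_eq)
      then have "z \<in> V" "z + u \<in> V" "z + rot u \<in> V" "z + ror u \<in> V" using f flagsD(2-4) by metis+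
      ultimately show "x (z + rot u) + x (z + ror u) \<le> x z + x (z + u)" by (simp add: x_def)
    qed
    have xd: "x (z + u) - x z = g (z + u) - g z" if "(z, u) \<in> flags V" for z u
      using d flagsD[OF that] by blast
    have gK: "\<bar>g (z + u) - g z\<bar> \<le> K" if "(z, u) \<in> flags V" for z u
      using B(1)[OF that] B(2) by (simp add: K_def)
    have "x \<in> X" unfolding X_def
    proof (intro CollectI conjI ballI)
      show "\<forall>w. w \<notin> V \<longrightarrow> x w = 0" "x v = 0" by (simp_all add: x_def)
      show "lattice_concave V x" by (rule conc_x)
      fix f :: "lpt \<times> lpt"
      obtain z u where zu: "f = (z, u)" by (cases f)
      show "case f of (z, u) \<Rightarrow> x (z + u) - x z = g (z + u) - g z" if "f \<in> Fr"
        using that xd[of z u] by (simp add: zu Fr_def)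
      show "case f of (z, u) \<Rightarrow> \<bar>x (z + u) - x z\<bar> \<le> K" if "f \<in> flags V"
        using that xd[of z u] gK[of z u] by (simp add: zu)
      show "case f of (z, u) \<Rightarrow> \<bar>x (z + u) - x z\<bar> \<le> B" if "f \<in> bd"
        using that xd[of z u] B(1)[of z u] by (simp add: zu bd_def)
    qed
    then show ?thesis by blast
  qed
  have cont: "continuous_on X (\<lambda>x. \<Sum>w\<in>V. exp (x w))"
    by (intro continuous_intros continuous_on_subset[OF continuous_on_product_coordinates]) simp
  obtain x where x: "x \<in> X" and mx0: "\<forall>y\<in>X. (\<Sum>w\<in>V. exp (y w)) \<le> (\<Sum>w\<in>V. exp (x w))"
    using continuous_attains_sup[OF cX neX cont] by (elim bexE)
  note mx = mx0[rule_format]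
  have cx: "lattice_concave (hex S) x" using x by (simp add: X_def V_def)
  interpret concave_grid S x by standard (rule cx)
  show ?thesis
  proof (cases "darts = {}")
    case True
    show ?thesis
    proof (rule that[OF cx])
      fix z u assume f: "(z, u) \<in> flags (hex S)"
      have "slope (tile (hex S) x (z, u)) u \<in> \<int>"
        using darts_nonempty[OF tile_mem[OF f] flagsD(1)[OF f]] True by blast
      then show "x (z + u) - x z \<in> \<int>"
        using slope_edge[OF tile_mem[OF f] flagsD(2,3)[OF flags_tile[OF f]]] by simp
    next
      fix z u assume "(z, u) \<in> flags (hex S)" "g (z + u) - g z \<in> \<int>"
        "g (z + rot u) - g z \<in> \<int> \<or> (z + u, - u) \<notin> flags (hex S)"
      then have "(z, u) \<in> Fr" by (auto simp: Fr_def bd_def V_def)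
      then show "x (z + u) - x z = g (z + u) - g z" using x unfolding X_def by blast
    qed
  next
    case False
    have Kint: "real_of_int K \<in> \<int>" "2 * real_of_int B < real_of_int K" by (simp_all add: K_def)
    have xK: "\<bar>x (z + u) - x z\<bar> \<le> K" if "(z, u) \<in> flags (hex S)" for z u
      using x that unfolding X_def V_def by blast
    have xB: "\<bar>x (z + u) - x z\<bar> \<le> B" if "(z, u) \<in> flags (hex S)" "(z + u, - u) \<notin> flags (hex S)" for z u
      using x that unfolding X_def bd_def V_def by blast
    have xFr: "x (z + u) - x z = g (z + u) - g z" if "(z, u) \<in> Fr" for z u
      using x that unfolding X_def by blast
    \<comment> \<open>Each move stays in \<open>X\<close> for a short time.\<close>
    have small: "eventually (\<lambda>e. (\<lambda>w. if w \<in> V then x w + e * \<delta> w else 0) \<in> X) (at_right 0)"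
      if n: "honeycomb_flow n" and d: "follows n \<delta>" and dv: "\<delta> v = 0" for n \<delta>
    proof -
      have flat: "\<delta> (z + u) = \<delta> z" if "(z, u) \<in> Fr" for z u
      proof -
        have f: "(z, u) \<in> flags (hex S)" "x (z + u) - x z \<in> \<int>"
          using that xFr[OF that] by (auto simp: Fr_def V_def)
        show ?thesis
        proof (cases "(z, u) \<in> bd")
          case True
          then show ?thesis using follows_int_boundary[OF n d f(1) _ f(2)] by (auto simp: bd_def V_def)
        next
          case nb: False
          have i: "g (z + u) - g z \<in> \<int>" "g (z + rot u) - g z \<in> \<int>" using that nb by (auto simp: Fr_def)
          have f3: "(z + rot u, - rot u) \<in> flags V" "(z + u, rot u - u) \<in> flags V"
            using flags_rot[OF flags_rot[OF f(1)]] flags_rot[OF f(1)] by (simp_all add: V_def)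
          have "g (z + rot u + - rot u) - g (z + rot u) \<in> \<int>"
            using Ints_minus[OF i(2)] by simp
          moreover have "g (z + rot u + rot (- rot u)) - g (z + rot u) \<in> \<int>"
            using Ints_diff[OF i] by (simp add: algebra_simps)
          ultimately have "(z + rot u, - rot u) \<in> Fr" using f3(1) by (simp add: Fr_def)
          from xFr[OF this] have "x (z + rot u) - x z = g (z + rot u) - g z" by simp
          then show ?thesis using follows_int_tile[OF n d f] i(2) by simp
        qed
      qed
      have mem: "x w + e * \<delta> w = (if w \<in> V then x w + e * \<delta> w else 0)" if "w \<in> V" for w e using that by simp
      have e1: "eventually (\<lambda>e. \<forall>f\<in>flags V. (fst f + snd f, - snd f) \<in> flags V \<longrightarrow>
          (x (fst f + rot (snd f)) + x (fst f + ror (snd f)) - x (fst f) - x (fst f + snd f))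
          + e * (\<delta> (fst f + rot (snd f)) + \<delta> (fst f + ror (snd f)) - \<delta> (fst f) - \<delta> (fst f + snd f)) \<le> 0) (at_right 0)"
      proof (intro eventually_ball_finite[OF finF] ballI)
        fix f assume f: "f \<in> flags V"
        obtain z u where zu: "f = (z, u)" by (cases f)
        show "eventually (\<lambda>e. (fst f + snd f, - snd f) \<in> flags V \<longrightarrow>
          (x (fst f + rot (snd f)) + x (fst f + ror (snd f)) - x (fst f) - x (fst f + snd f))
          + e * (\<delta> (fst f + rot (snd f)) + \<delta> (fst f + ror (snd f)) - \<delta> (fst f) - \<delta> (fst f + snd f)) \<le> 0) (at_right 0)"
        proof (cases "(z + u, - u) \<in> flags V")
          case True
          have "x (z + rot u) + x (z + ror u) \<le> x z + x (z + u)"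
            using cx f True unfolding lattice_concave_def zu V_def by blast
          moreover have "\<delta> (z + rot u) + \<delta> (z + ror u) \<le> \<delta> z + \<delta> (z + u)"
            if "x (z + rot u) + x (z + ror u) = x z + x (z + u)"
            using follows_concave[OF n d _ _ that] f True by (simp add: zu V_def)
          ultimately have "eventually (\<lambda>e. (x (z + rot u) + x (z + ror u) - x z - x (z + u))
              + e * (\<delta> (z + rot u) + \<delta> (z + ror u) - \<delta> z - \<delta> (z + u)) \<le> 0) (at_right 0)"
            by (intro eventually_affine_le) linarith
          then show ?thesis by (simp add: zu)
        qed (simp add: zu)
      qed
      have e2: "eventually (\<lambda>e. \<forall>f\<in>flags V.
          (x (fst f + snd f) - x (fst f)) + e * (\<delta> (fst f + snd f) - \<delta> (fst f)) \<le> K \<and>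
          - (x (fst f + snd f) - x (fst f)) + e * - (\<delta> (fst f + snd f) - \<delta> (fst f)) \<le> K) (at_right 0)"
      proof (intro eventually_ball_finite[OF finF] ballI eventually_conj eventually_affine_le)
        fix f assume f: "f \<in> flags V"
        obtain z u where zu: "f = (z, u)" by (cases f)
        have fl: "(z, u) \<in> flags (hex S)" using f by (simp add: zu V_def)
        note st = follows_steep[OF n d fl Kint xK xB]
        show "x (fst f + snd f) - x (fst f) < K \<or> x (fst f + snd f) - x (fst f) = K \<and> \<delta> (fst f + snd f) - \<delta> (fst f) \<le> 0"
          using st(1) xK[OF fl] by (auto simp: zu)
        show "- (x (fst f + snd f) - x (fst f)) < K \<or> - (x (fst f + snd f) - x (fst f)) = K \<and> - (\<delta> (fst f + snd f) - \<delta> (fst f)) \<le> 0"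
          using st(2) xK[OF fl] by (auto simp: zu)
      qed
      have finbd: "finite bd" by (rule finite_subset[OF _ finF]) (auto simp: bd_def)
      have e3: "eventually (\<lambda>e. \<forall>f\<in>bd.
          (x (fst f + snd f) - x (fst f)) + e * (\<delta> (fst f + snd f) - \<delta> (fst f)) \<le> B \<and>
          - (x (fst f + snd f) - x (fst f)) + e * - (\<delta> (fst f + snd f) - \<delta> (fst f)) \<le> B) (at_right 0)"
      proof (intro eventually_ball_finite[OF finbd] ballI eventually_conj eventually_affine_le)
        fix f assume f: "f \<in> bd"
        obtain z u where zu: "f = (z, u)" by (cases f)
        have fl: "(z, u) \<in> flags (hex S)" "(z + u, - u) \<notin> flags (hex S)" using f by (auto simp: zu V_def bd_def)
        note st = follows_int_boundary[OF n d fl]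
        have s: "\<delta> (z + u) = \<delta> z" if "\<bar>x (z + u) - x z\<bar> = B"
        proof -
          have "x (z + u) - x z = B \<or> x (z + u) - x z = - B" using that by linarith
          then have "x (z + u) - x z \<in> \<int>" by auto
          then show ?thesis by (rule st)
        qed
        show "x (fst f + snd f) - x (fst f) < B \<or> x (fst f + snd f) - x (fst f) = B \<and> \<delta> (fst f + snd f) - \<delta> (fst f) \<le> 0"
          using s xB[OF fl] by (auto simp: zu abs_if split: if_splits)
        show "- (x (fst f + snd f) - x (fst f)) < B \<or> - (x (fst f + snd f) - x (fst f)) = B \<and> - (\<delta> (fst f + snd f) - \<delta> (fst f)) \<le> 0"
          using s xB[OF fl] by (auto simp: zu abs_if split: if_splits)
      qed
      show ?thesis
        using e1 e2 e3
      proof eventually_elim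
        case (elim e)
        define y where "y w = (if w \<in> V then x w + e * \<delta> w else 0)" for w
        have y: "y w = x w + e * \<delta> w" if "w \<in> V" for w using that by (simp add: y_def)
        have yd: "y (z + u) - y z = (x (z + u) - x z) + e * (\<delta> (z + u) - \<delta> z)" if "(z, u) \<in> flags V" for z u
          using y[OF flagsD(2)[OF that]] y[OF flagsD(3)[OF that]] by (simp add: algebra_simps)
        have "y \<in> X" unfolding X_def
        proof (intro CollectI conjI)
          show "\<forall>w. w \<notin> V \<longrightarrow> y w = 0" by (simp add: y_def)
          show "y v = 0" using x dv v(1) by (simp add: y_def X_def)
          show "lattice_concave V y" unfolding lattice_concave_def
          proof (intro allI impI)
            fix z u assume f: "(z, u) \<in> flags V \<and> (z + u, - u) \<in> flags V"
            have "z + u + rot (- u) = z + ror u" by (simp add: ror_eq)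
            then have V4: "z \<in> V" "z + u \<in> V" "z + rot u \<in> V" "z + ror u \<in> V" using f flagsD(2-4) by metis+
            have "(x (z + rot u) + x (z + ror u) - x z - x (z + u))
              + e * (\<delta> (z + rot u) + \<delta> (z + ror u) - \<delta> z - \<delta> (z + u)) \<le> 0"
              using elim(1) f by force
            then show "y (z + rot u) + y (z + ror u) \<le> y z + y (z + u)"
              using y[OF V4(1)] y[OF V4(2)] y[OF V4(3)] y[OF V4(4)] by (simp add: algebra_simps)
          qed
          show "\<forall>(z, u)\<in>Fr. y (z + u) - y z = g (z + u) - g z"
            using yd flat xFr by (auto simp: Fr_def)
          show "\<forall>(z, u)\<in>flags V. \<bar>y (z + u) - y z\<bar> \<le> K"
            using elim(2) yd by (force simp: abs_le_iff algebra_simps)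
          show "\<forall>(z, u)\<in>bd. \<bar>y (z + u) - y z\<bar> \<le> B"
            using elim(3) yd by (force simp: abs_le_iff bd_def algebra_simps)
        qed
        then show ?case unfolding y_def .
      qed
    qed
    obtain n1 n2 \<delta>1 \<delta>2 where m: "honeycomb_flow n1" "follows n1 \<delta>1" "honeycomb_flow n2" "follows n2 \<delta>2"
      "\<delta>1 v = 0" "\<delta>2 v = 0" "\<And>w. w \<in> V \<Longrightarrow> \<delta>1 w + \<delta>2 w \<ge> 0" "\<exists>w\<in>V. \<delta>1 w \<noteq> 0"
      by (rule two_sided_move[OF False ne, folded V_def, OF v(1) flagsD(1)[OF f0] v(2,3)]) (rule that; assumption)
    have "eventually (\<lambda>e::real. e > 0) (at_right 0)" by (rule eventually_at_right_less)
    then have "eventually (\<lambda>e. e > 0 \<and> (\<lambda>w. if w \<in> V then x w + e * \<delta>1 w else 0) \<in> X \<and>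
        (\<lambda>w. if w \<in> V then x w + e * \<delta>2 w else 0) \<in> X) (at_right 0)"
      using small[OF m(1,2,5)] small[OF m(3,4,6)] by eventually_elim simp
    then obtain e where e: "e > 0" "(\<lambda>w. if w \<in> V then x w + e * \<delta>1 w else 0) \<in> X"
        "(\<lambda>w. if w \<in> V then x w + e * \<delta>2 w else 0) \<in> X"
      using eventually_happens[of _ "at_right (0::real)"] trivial_limit_at_right_real by blast
    have "(\<Sum>w\<in>V. exp (x w + e * \<delta>1 w)) \<le> (\<Sum>w\<in>V. exp (x w))"
      "(\<Sum>w\<in>V. exp (x w + e * \<delta>2 w)) \<le> (\<Sum>w\<in>V. exp (x w))"
      using mx[OF e(2)] mx[OF e(3)] by simp_all
    moreover have "(\<Sum>w\<in>V. exp (x w) + exp (x w)) < (\<Sum>w\<in>V. exp (x w + e * \<delta>1 w) + exp (x w + e * \<delta>2 w))"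
    proof (rule sum_strict_mono_ex1[OF finV])
      have tan: "exp (x w) + exp (x w) \<le> exp (x w + e * \<delta>1 w) + exp (x w + e * \<delta>2 w) \<and>
        (\<delta>1 w \<noteq> 0 \<longrightarrow> exp (x w) + exp (x w) < exp (x w + e * \<delta>1 w) + exp (x w + e * \<delta>2 w))" if w: "w \<in> V" for w
      proof -
        have s: "0 \<le> e * \<delta>1 w + e * \<delta>2 w" using m(7)[OF w] e(1) by (simp add: distrib_left[symmetric])
        \<comment> \<open>Here the convexity of \<open>exp\<close> meets \<open>\<delta>1 + \<delta>2 \<ge> 0\<close>.\<close>
        have "2 \<le> exp (e * \<delta>1 w) + exp (e * \<delta>2 w)"
          using s exp_ge_add_one_self[of "e * \<delta>1 w"] exp_ge_add_one_self[of "e * \<delta>2 w"] by linarith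
        then have "exp (x w) * 2 \<le> exp (x w) * (exp (e * \<delta>1 w) + exp (e * \<delta>2 w))" by (intro mult_left_mono) auto
        moreover have "exp (x w) * 2 < exp (x w) * (exp (e * \<delta>1 w) + exp (e * \<delta>2 w))" if "\<delta>1 w \<noteq> 0"
        proof -
          have "1 + e * \<delta>1 w < exp (e * \<delta>1 w)" using that e(1) by (intro exp_above_tangent) simp
          then have "2 < exp (e * \<delta>1 w) + exp (e * \<delta>2 w)"
            using s exp_ge_add_one_self[of "e * \<delta>2 w"] by linarith
          then show ?thesis by (intro mult_strict_left_mono) auto
        qed
        ultimately show ?thesis by (auto simp: exp_add distrib_left mult.commute)
      qed
      show "\<forall>w\<in>V. exp (x w) + exp (x w) \<le> exp (x w + e * \<delta>1 w) + exp (x w + e * \<delta>2 w)" using tan by blast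
      show "\<exists>w\<in>V. exp (x w) + exp (x w) < exp (x w + e * \<delta>1 w) + exp (x w + e * \<delta>2 w)" using tan m(8) by blast
    qed
    ultimately show ?thesis unfolding sum.distrib by linarith
  qed
qed

section \<open>Coordinates in the plane\<close>

text \<open>The coordinates of a point with respect to \<^term>\<open>xi1\<close> and \<^term>\<open>xi2\<close>.\<close>

definition cx :: "point \<Rightarrow> real" where "cx p = p $ 1 + p $ 2 / sqrt 3"
definition cy :: "point \<Rightarrow> real" where "cy p = 2 * p $ 2 / sqrt 3"
definition lin :: "lpt \<Rightarrow> point" where "lin w = of_int (fst w) *\<^sub>R xi1 + of_int (snd w) *\<^sub>R xi2"
definition emb :: "point \<Rightarrow> lpt \<Rightarrow> point" where "emb c z = c + lin z"
definition nrmP :: "point \<Rightarrow> lpt \<Rightarrow> point \<Rightarrow> real" where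
  "nrmP c u p = nrmR u (cx (p - c), cy (p - c))"

lemma xi_components:
  "xi1 $ 1 = 1" "xi1 $ 2 = 0" "xi2 $ 1 = - 1 / 2" "xi2 $ 2 = sqrt 3 / 2" "xi3 $ 1 = - 1 / 2" "xi3 $ 2 = - sqrt 3 / 2"
  by (simp_all add: xi1_def xi2_def xi3_def)

lemma cxy_linear:
  "cx (p + q) = cx p + cx q" "cx (p - q) = cx p - cx q" "cx (r *\<^sub>R p) = r * cx p"
  "cy (p + q) = cy p + cy q" "cy (p - q) = cy p - cy q" "cy (r *\<^sub>R p) = r * cy p"
  by (simp_all add: cx_def cy_def add_divide_distrib diff_divide_distrib algebra_simps)

lemma cxy_xi [simp]: "cx xi1 = 1" "cy xi1 = 0" "cx xi2 = 0" "cy xi2 = 1"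
  by (simp_all add: cx_def cy_def xi_components)

lemma cxy_decomp: "p = cx p *\<^sub>R xi1 + cy p *\<^sub>R xi2"
  by (simp add: vec_eq_iff forall_2 cx_def cy_def xi_components)

lemma cxy_eqI: "cx p = cx q \<Longrightarrow> cy p = cy q \<Longrightarrow> p = q"
  using cxy_decomp[of p] cxy_decomp[of q] by simp

lemma cxy_lin [simp]: "cx (lin w) = of_int (fst w)" "cy (lin w) = of_int (snd w)"
  by (simp_all add: lin_def cxy_linear)

lemma lin_add [simp]: "lin (v + w) = lin v + lin w" and lin_minus [simp]: "lin (- w) = - lin w"
  and lin_diff [simp]: "lin (v - w) = lin v - lin w" and lin_zero [simp]: "lin 0 = 0"
  by (simp_all add: lin_def algebra_simps)

lemma lin_inj: "lin v = lin w \<longleftrightarrow> v = w"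
  using cxy_lin by (metis of_int_eq_iff prod_eqI)

lemma emb_inj [simp]: "emb c v = emb c w \<longleftrightarrow> v = w"
  by (simp add: emb_def lin_inj)

lemma nrmP_emb [simp]: "nrmP c u (emb c z) = nrm u z"
  by (simp add: nrmP_def emb_def nrmR_def nrm_def)

lemma nrmP_left [simp]:
  "nrmP c (u + v) p = nrmP c u p + nrmP c v p" "nrmP c (u - v) p = nrmP c u p - nrmP c v p"
  "nrmP c (- u) p = - nrmP c u p"
  by (simp_all add: nrmP_def)

lemma nrmP_affine:
  assumes "r + s = 1"
  shows "nrmP c u (r *\<^sub>R p + s *\<^sub>R q) = r * nrmP c u p + s * nrmP c u q"
proof -
  have s: "s = 1 - r" using assms by simp
  show ?thesis unfolding s by (simp add: nrmP_def nrmR_def cxy_linear algebra_simps)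
qed

lemma nrmP_affine3:
  assumes "r + s + t = 1"
  shows "nrmP c u (r *\<^sub>R p + s *\<^sub>R q + t *\<^sub>R w) = r * nrmP c u p + s * nrmP c u q + t * nrmP c u w"
proof -
  have t: "t = 1 - r - s" using assms by simp
  show ?thesis unfolding t by (simp add: nrmP_def nrmR_def cxy_linear algebra_simps)
qed

lemma continuous_nrmP: "continuous_on UNIV (nrmP c u)"
  unfolding nrmP_def nrmR_def cx_def cy_def by (intro continuous_intros) auto

lemma nrmP_eqI:
  assumes u: "u \<in> units" and "nrmP c u p = nrmP c u q" "nrmP c (rot u) p = nrmP c (rot u) q"
  shows "p = q"
proof -
  have "cx (p - c) = cx (q - c) \<and> cy (p - c) = cy (q - c)"
    using assms unfolding nrmP_def nrmR_def units_def by (auto simp: rot_def)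
  then show ?thesis by (intro cxy_eqI) (auto simp: cxy_linear)
qed

definition tri :: "point \<Rightarrow> lpt \<Rightarrow> lpt \<Rightarrow> point set" where
  "tri c z u = convex hull {emb c z, emb c (z + u), emb c (z + rot u)}"

lemma barycentric:
  fixes c p :: point and z u :: lpt
  assumes u: "u \<in> units"
  defines "a \<equiv> nrmP c u p - nrm u z" and "b \<equiv> nrmP c (rot u) p - nrm (rot u) z"
  shows "p = (1 + a - b) *\<^sub>R emb c z + b *\<^sub>R emb c (z + u) + (- a) *\<^sub>R emb c (z + rot u)"
  by (rule nrmP_eqI[OF u, of c]; subst nrmP_affine3) (use u in \<open>simp_all add: a_def b_def algebra_simps\<close>)

text \<open>A triangle is the intersection of the three half planes bounded by the lines through its
  edges.\<close>

lemma tri_iff: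
  assumes u: "u \<in> units"
  shows "p \<in> tri c z u \<longleftrightarrow> nrmP c u p \<le> nrm u z \<and> nrmP c (rot u) p \<ge> nrm (rot u) z \<and>
    nrmP c (rot u - u) p \<le> nrm (rot u - u) z + 1"
proof
  assume "p \<in> tri c z u"
  then obtain x y w where x: "0 \<le> x" "0 \<le> y" "0 \<le> w" "x + y + w = 1"
    "p = x *\<^sub>R emb c z + y *\<^sub>R emb c (z + u) + w *\<^sub>R emb c (z + rot u)"
    unfolding tri_def convex_hull_3 by blast
  have *: "nrmP c v p = nrm v z + y * nrm v u + w * nrm v (rot u)" for v
  proof -
    have xe: "x = 1 - y - w" using x(4) by simp
    have "nrmP c v p = x * nrm v z + y * nrm v (z + u) + w * nrm v (z + rot u)"
      unfolding x(5) nrmP_affine3[OF x(4)] nrmP_emb ..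
    also have "\<dots> = nrm v z + y * nrm v u + w * nrm v (rot u)"
      unfolding xe by (simp add: algebra_simps)
    finally show ?thesis .
  qed
  show "nrmP c u p \<le> nrm u z \<and> nrmP c (rot u) p \<ge> nrm (rot u) z \<and>
    nrmP c (rot u - u) p \<le> nrm (rot u - u) z + 1"
    unfolding * using x u by simp
next
  assume h: "nrmP c u p \<le> nrm u z \<and> nrmP c (rot u) p \<ge> nrm (rot u) z \<and>
    nrmP c (rot u - u) p \<le> nrm (rot u - u) z + 1"
  define a where "a = nrmP c u p - nrm u z"
  define b where "b = nrmP c (rot u) p - nrm (rot u) z"
  have "p = (1 + a - b) *\<^sub>R emb c z + b *\<^sub>R emb c (z + u) + (- a) *\<^sub>R emb c (z + rot u)"
    unfolding a_def b_def by (rule barycentric[OF u])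
  moreover have "0 \<le> 1 + a - b" "0 \<le> b" "0 \<le> - a" "(1 + a - b) + b + (- a) = 1"
    using h by (simp_all add: a_def b_def)
  ultimately show "p \<in> tri c z u" unfolding tri_def convex_hull_3 by blast
qed

lemma tri_strict_interior:
  assumes u: "u \<in> units" and h: "nrmP c u p < nrm u z" "nrmP c (rot u) p > nrm (rot u) z"
    "nrmP c (rot u - u) p < nrm (rot u - u) z + 1"
  shows "p \<in> interior (tri c z u)"
proof (rule interiorI)
  let ?O = "{p. nrmP c u p < nrm u z} \<inter> {p. nrm (rot u) z < nrmP c (rot u) p}
    \<inter> {p. nrmP c (rot u - u) p < nrm (rot u - u) z + 1}"
  show "open ?O" by (intro open_Int open_Collect_less continuous_nrmP continuous_intros)
  show "p \<in> ?O" using h by simp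
  show "?O \<subseteq> tri c z u" by (auto simp: tri_iff[OF u] simp del: nrmP_left)
qed

lemma tri_edges:
  assumes u: "u \<in> units" and p: "p \<in> tri c z u" "p \<notin> interior (tri c z u)"
  shows "p \<in> closed_segment (emb c z) (emb c (z + u)) \<or> p \<in> closed_segment (emb c (z + u)) (emb c (z + rot u))
    \<or> p \<in> closed_segment (emb c (z + rot u)) (emb c z)"
proof -
  define a where "a = nrmP c u p - nrm u z"
  define b where "b = nrmP c (rot u) p - nrm (rot u) z"
  have bc: "p = (1 + a - b) *\<^sub>R emb c z + b *\<^sub>R emb c (z + u) + (- a) *\<^sub>R emb c (z + rot u)"
    unfolding a_def b_def by (rule barycentric[OF u])
  have ab: "a \<le> 0" "b \<ge> 0" "b - a \<le> 1" using p(1) tri_iff[OF u] by (auto simp: a_def b_def)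
  have "\<not> (a < 0 \<and> b > 0 \<and> b - a < 1)"
    using tri_strict_interior[OF u, of c p z] p(2) by (auto simp: a_def b_def)
  then consider "a = 0" | "b = 0" | "b = 1 + a" using ab by linarith
  then show ?thesis
  proof cases
    case 1
    have "p = (1 - b) *\<^sub>R emb c z + b *\<^sub>R emb c (z + u)" using bc 1 by simp
    moreover have "0 \<le> b" "b \<le> 1" using ab 1 by simp_all
    ultimately have "p \<in> closed_segment (emb c z) (emb c (z + u))" unfolding in_segment by blast
    then show ?thesis by simp
  next
    case 2
    have "p = (1 - (1 + a)) *\<^sub>R emb c (z + rot u) + (1 + a) *\<^sub>R emb c z" using bc 2 by simp
    moreover have "0 \<le> 1 + a" "1 + a \<le> 1" using ab 2 by simp_all
    ultimately have "p \<in> closed_segment (emb c (z + rot u)) (emb c z)" unfolding in_segment by blast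
    then show ?thesis by simp
  next
    case 3
    have "p = (1 - (- a)) *\<^sub>R emb c (z + u) + (- a) *\<^sub>R emb c (z + rot u)" using bc 3 by simp
    moreover have "0 \<le> - a" "- a \<le> 1" using ab 3 by simp_all
    ultimately have "p \<in> closed_segment (emb c (z + u)) (emb c (z + rot u))" unfolding in_segment by blast
    then show ?thesis by simp
  qed
qed

lemma tri_rot: "tri c (z + u) (rot u - u) = tri c z u"
  by (simp add: tri_def insert_commute)

lemma tri_vertices: "emb c z \<in> tri c z u" "emb c (z + u) \<in> tri c z u" "emb c (z + rot u) \<in> tri c z u"
  unfolding tri_def by (auto intro: hull_inc)

lemma tri_closure:
  assumes u: "u \<in> units"
  shows "closure (interior (tri c z u)) = tri c z u"
proof -
  have "interior (tri c z u) \<noteq> {}"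
  proof -
    define p where "p = (1/3) *\<^sub>R emb c z + (1/3) *\<^sub>R emb c (z + u) + (1/3) *\<^sub>R emb c (z + rot u)"
    have "nrmP c v p = nrm v z + (nrm v u + nrm v (rot u)) / 3" for v
      unfolding p_def by (subst nrmP_affine3) (simp_all add: field_simps)
    then have "p \<in> interior (tri c z u)" using u by (intro tri_strict_interior) simp_all
    then show ?thesis by auto
  qed
  then show ?thesis
    using convex_closure_interior[of "tri c z u"]
    by (simp add: tri_def compact_imp_closed compact_convex_hull finite_imp_compact)
qed

lemma lattice_point_in_tri:
  assumes u: "u \<in> units" and w: "emb c w \<in> tri c z u"
  shows "w = z \<or> w = z + u \<or> w = z + rot u"
  using w tri_iff[OF u, of "emb c w" c z]
  by (intro triangle_lattice_point[OF u]) (simp_all del: nrmP_left nrm_diff_left)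

section \<open>The faces of a convex grid\<close>

lemma triangle_units:
  assumes "u \<in> units" "v \<in> units" "w \<in> units" "u + v + w = 0"
  shows "v = rot u - u \<or> v = - rot u"
proof -
  have "- w = u + v" using minus_unique[OF assms(4)] by (metis minus_minus)
  then have "u + v \<in> units" using minus_units[OF assms(3)] by simp
  then show ?thesis using assms(1,2) unfolding units_def by (auto simp: rot_def)
qed

lemma lin_xi: "lin (1, 0) = xi1" "lin (0, 1) = xi2" "lin (-1, -1) = xi3"
  by (simp_all add: lin_def vec_eq_iff forall_2 xi_components)

locale lattice_grid =
  fixes G :: "point pair_pre_digraph" and c :: point
  assumes grid: "convex_grid G"
begin

definition sym_arc :: "point \<Rightarrow> point \<Rightarrow> bool" where
  "sym_arc p q \<longleftrightarrow> (p, q) \<in> parcs G \<union> (parcs G)\<inverse>"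

text \<open>The flags of the little triangles whose vertices lie in the lattice with origin \<open>c\<close>. A
  priori the grid might have little triangles outside this lattice; \<open>face_is_triangle\<close> excludes
  them.\<close>

definition face_flags :: "(lpt \<times> lpt) set" where
  "face_flags = {(z, u). u \<in> units \<and> interior (tri c z u) \<in> bounded_faces G \<and>
     sym_arc (emb c z) (emb c (z + u)) \<and> sym_arc (emb c (z + u)) (emb c (z + rot u)) \<and>
     sym_arc (emb c (z + rot u)) (emb c z)}"

lemma gridD:
  "finite (pverts G)" "plane_embedded G" "convex (region G)" "pverts G \<subseteq> region G"
  "\<And>F. F \<in> bounded_faces G \<Longrightarrow> triangular_face G F"
  "\<And>u v. (u, v) \<in> parcs G \<Longrightarrow> v - u \<in> {xi1, xi2, xi3}"
  "\<And>u v. (u, v) \<in> parcs G \<Longrightarrow> u \<in> pverts G \<and> v \<in> pverts G"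
proof -
  interpret pair_fin_digraph G using grid by (simp add: convex_grid_def)
  show "finite (pverts G)" by (rule pair_finite_verts)
  show "u \<in> pverts G \<and> v \<in> pverts G" if "(u, v) \<in> parcs G" for u v using in_arcsD1[OF that] in_arcsD2[OF that] by simp
  show "plane_embedded G" "pverts G \<subseteq> region G" "\<And>F. F \<in> bounded_faces G \<Longrightarrow> triangular_face G F"
    using grid by (auto simp: convex_grid_def)
  show "convex (region G)" using grid by (simp add: convex_grid_def convex_polygon_def polytope_imp_convex)
  show "v - u \<in> {xi1, xi2, xi3}" if "(u, v) \<in> parcs G" for u v
    using grid that unfolding convex_grid_def by blast
qed

lemma sym_arc_sym: "sym_arc p q \<Longrightarrow> sym_arc q p"
  by (auto simp: sym_arc_def)

lemma sym_arc_verts: "sym_arc p q \<Longrightarrow> p \<in> pverts G \<and> q \<in> pverts G"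
  using gridD(7) by (auto simp: sym_arc_def)

lemma sym_arc_unit:
  assumes "sym_arc p q"
  obtains u where "u \<in> units" "q = p + lin u"
proof -
  have pos: "\<exists>u\<in>units. b = a + lin u \<and> a = b + lin (- u)" if "(a, b) \<in> parcs G" for a b
  proof -
    have "b - a \<in> {xi1, xi2, xi3}" by (rule gridD(6)[OF that])
    then obtain u where "u \<in> units" "b - a = lin u" unfolding lin_xi[symmetric] by (auto simp: units_def)
    then show ?thesis by (auto simp: algebra_simps intro!: bexI[of _ u])
  qed
  then show ?thesis using assms that minus_units unfolding sym_arc_def by blast
qed

lemma sym_arc_drawing: "sym_arc p q \<Longrightarrow> closed_segment p q \<subseteq> drawing G"
  unfolding sym_arc_def drawing_def seg_def by (force simp: closed_segment_commute)

lemma sym_arc_unique: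
  assumes "sym_arc p q" "sym_arc p' q'" "m \<in> open_segment p q" "m \<in> open_segment p' q'"
  shows "{p, q} = {p', q'}"
proof -
  have ex: "\<exists>e\<in>parcs G. open_seg e = open_segment a b \<and> {fst e, snd e} = {a, b}" if ab: "sym_arc a b" for a b
  proof (cases "(a, b) \<in> parcs G")
    case True then show ?thesis by (intro bexI[of _ "(a, b)"]) (auto simp: open_seg_def)
  next
    case False
    then have "(b, a) \<in> parcs G" using ab by (auto simp: sym_arc_def)
    then show ?thesis by (intro bexI[of _ "(b, a)"]) (auto simp: open_seg_def open_segment_commute)
  qed
  obtain e where e: "e \<in> parcs G" "open_seg e = open_segment p q" "{fst e, snd e} = {p, q}" using ex[OF assms(1)] by blast
  obtain e' where e': "e' \<in> parcs G" "open_seg e' = open_segment p' q'" "{fst e', snd e'} = {p', q'}"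
    using ex[OF assms(2)] by blast
  have "e = e'"
    using gridD(2) e(1,2) e'(1,2) assms(3,4) unfolding plane_embedded_def by blast
  then show ?thesis using e(3) e'(3) by simp
qed

lemma sym_arc_open_vertex:
  assumes "sym_arc p q" "m \<in> open_segment p q"
  shows "m \<notin> pverts G"
proof -
  have free: "open_seg e \<inter> pverts G = {}" if "e \<in> parcs G" for e
    using gridD(2) that unfolding plane_embedded_def by blast
  have "open_segment p q \<inter> pverts G = {}"
  proof (cases "(p, q) \<in> parcs G")
    case True
    from free[OF this] show ?thesis by (simp add: open_seg_def)
  next
    case False
    then have "(q, p) \<in> parcs G" using assms(1) by (auto simp: sym_arc_def)
    from free[OF this] show ?thesis by (simp add: open_seg_def open_segment_commute)
  qed
  then show ?thesis using assms(2) by blast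
qed

lemma face_drawing: "F \<in> bounded_faces G \<Longrightarrow> F \<inter> drawing G = {}"
  using in_components_subset by (force simp: bounded_faces_def)

lemma faces_disjoint:
  assumes "F \<in> bounded_faces G" "F' \<in> bounded_faces G" "p \<in> F" "p \<in> F'"
  shows "F = F'"
  using assms components_nonoverlap[of F "- drawing G" F'] by (auto simp: bounded_faces_def)

lemma face_nonempty: "F \<in> bounded_faces G \<Longrightarrow> F \<noteq> {}"
  using in_components_nonempty by (auto simp: bounded_faces_def)

text \<open>The three edge vectors of a little triangle are unit vectors with sum zero, so they turn by
  120 degrees at each corner, in one of two possible orientations.\<close>

lemma face_flag_exists:
  assumes F: "F \<in> bounded_faces G" "F = interior (convex hull {emb c z, b, d})"
    and arcs: "sym_arc (emb c z) b" "sym_arc b d" "sym_arc d (emb c z)"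
  obtains u where "(z, u) \<in> face_flags" "F = interior (tri c z u)" "{b, d} = {emb c (z + u), emb c (z + rot u)}"
proof -
  obtain u where u: "u \<in> units" "b = emb c z + lin u" using sym_arc_unit[OF arcs(1)] .
  obtain v where v: "v \<in> units" "d = b + lin v" using sym_arc_unit[OF arcs(2)] .
  obtain w where w: "w \<in> units" "emb c z = d + lin w" using sym_arc_unit[OF arcs(3)] .
  have "emb c z = emb c z + lin u + lin v + lin w" using w(2) unfolding v(2) u(2) .
  then have "lin (u + v + w) = lin 0" by (simp add: add.assoc)
  then have "u + v + w = 0" by (simp only: lin_inj)
  from triangle_units[OF u(1) v(1) w(1) this] show ?thesis
  proof
    assume v': "v = rot u - u"
    have b: "b = emb c (z + u)" and d: "d = emb c (z + rot u)" using u(2) v(2) v' by (simp_all add: emb_def)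
    have "F = interior (tri c z u)" unfolding F(2) b d tri_def ..
    then show ?thesis using that[of u] F(1) arcs u(1) b d by (auto simp: face_flags_def)
  next
    assume v': "v = - rot u"
    define x where "x = u - rot u"
    have x: "x \<in> units" "rot x = u" using u(1) by (simp_all add: x_def)
    have b: "b = emb c (z + rot x)" and d: "d = emb c (z + x)" using u(2) v(2) v' x by (simp_all add: emb_def x_def)
    have "F = interior (tri c z x)" unfolding F(2) b d tri_def by (simp add: insert_commute)
    then show ?thesis using that[of x] F(1) arcs x(1) b d sym_arc_sym by (auto simp: face_flags_def)
  qed
qed

lemma face_flagsD:
  assumes "(z, u) \<in> face_flags"
  shows "u \<in> units" "interior (tri c z u) \<in> bounded_faces G" "sym_arc (emb c z) (emb c (z + u))"
    "sym_arc (emb c (z + u)) (emb c (z + rot u))" "sym_arc (emb c (z + rot u)) (emb c z)"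
    "tri c z u \<in> little_triangles G" "tri c z u \<subseteq> region G"
proof -
  show 1: "u \<in> units" "interior (tri c z u) \<in> bounded_faces G" "sym_arc (emb c z) (emb c (z + u))"
    "sym_arc (emb c (z + u)) (emb c (z + rot u))" "sym_arc (emb c (z + rot u)) (emb c z)"
    using assms by (auto simp: face_flags_def)
  show "tri c z u \<in> little_triangles G"
    using imageI[OF 1(2), of closure] tri_closure[OF 1(1)] by (simp add: little_triangles_def)
  then show "tri c z u \<subseteq> region G" by (auto simp: region_def)
qed

lemma face_flags_rot:
  assumes f: "(z, u) \<in> face_flags"
  shows "(z + u, rot u - u) \<in> face_flags"
  using face_flagsD(1-5)[OF f] by (simp add: face_flags_def tri_rot)

lemma face_arcs:
  assumes F: "F \<in> bounded_faces G"
  obtains a b d where "F = interior (convex hull {a, b, d})" "sym_arc a b" "sym_arc b d" "sym_arc d a"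
  using gridD(5)[OF F] unfolding triangular_face_def sym_arc_def by blast

lemma finite_faces: "finite (bounded_faces G)"
proof -
  have "bounded_faces G \<subseteq> (\<lambda>(a, b, d). interior (convex hull {a, b, d})) ` (pverts G \<times> pverts G \<times> pverts G)"
  proof
    fix F assume F: "F \<in> bounded_faces G"
    obtain a b d where "F = interior (convex hull {a, b, d})" "sym_arc a b" "sym_arc b d" "sym_arc d a"
      using face_arcs[OF F] .
    then show "F \<in> (\<lambda>(a, b, d). interior (convex hull {a, b, d})) ` (pverts G \<times> pverts G \<times> pverts G)"
      using sym_arc_verts by (intro image_eqI[of _ _ "(a, b, d)"]) auto
  qed
  then show ?thesis by (rule finite_subset) (simp add: gridD(1))
qed

text \<open>If the convex region reaches beyond an edge of a little triangle, then there is a little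
  triangle on the other side of that edge. Take a sequence of points of the region tending to the
  midpoint \<open>m\<close> of the edge from the other side. Infinitely many of them lie in the same closed
  face \<open>F\<close>, since there are finitely many faces. Then \<open>m\<close> lies on the boundary of \<open>F\<close>, hence on an
  edge of \<open>F\<close>, and as the drawing is plane, this edge is the given one.\<close>

lemma face_flags_cross:
  assumes f: "(z, u) \<in> face_flags" and p: "p \<in> region G" "nrmP c u p > nrm u z"
  shows "(z + u, - u) \<in> face_flags"
proof -
  note fl = face_flagsD[OF f]
  define A where "A = emb c z"
  define B where "B = emb c (z + u)"
  define m where "m = (1/2) *\<^sub>R A + (1/2) *\<^sub>R B"
  have AB: "A \<noteq> B" using rot_nz(3)[OF fl(1)] by (simp add: A_def B_def)
  have mo: "m \<in> open_segment A B" unfolding in_segment m_def using AB by (intro conjI exI[of _ "1/2"]) auto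
  have mAB: "sym_arc A B" using fl(3) by (simp add: A_def B_def)
  have md: "m \<in> drawing G" using sym_arc_drawing[OF mAB] mo open_closed_segment by blast
  have mv: "m \<notin> pverts G" by (rule sym_arc_open_vertex[OF mAB mo])
  have nm: "nrmP c u m = nrm u z"
    unfolding m_def A_def B_def by (subst nrmP_affine) simp_all
  have mR: "m \<in> region G"
  proof -
    have "A \<in> region G" "B \<in> region G"
      unfolding A_def B_def by (rule subsetD[OF fl(7)], rule tri_vertices)+
    then show ?thesis unfolding m_def using gridD(3) by (intro convexD) auto
  qed
  define x where "x k = (1 - 1 / (real k + 1)) *\<^sub>R m + (1 / (real k + 1)) *\<^sub>R p" for k
  have xR: "x k \<in> region G" for k
    unfolding x_def using gridD(3) mR p(1) by (intro convexD) auto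
  have "\<exists>F\<in>bounded_faces G. infinite {k \<in> UNIV. x k \<in> closure F}"
    using xR by (intro pigeonhole_infinite_rel) (auto simp: finite_faces region_def little_triangles_def)
  then obtain F where F: "F \<in> bounded_faces G" "infinite {k. x k \<in> closure F}" by auto
  have "m \<in> closure F"
  proof -
    have "\<exists>y\<in>closure F. dist y m < e" if "e > 0" for e
    proof -
      obtain N :: nat where N: "dist p m / e < real N" using reals_Archimedean2 by blast
      obtain k where k: "k > N" "x k \<in> closure F"
        using F(2) unfolding infinite_nat_iff_unbounded by blast
      have "x k - m = (1 / (real k + 1)) *\<^sub>R (p - m)" by (simp add: x_def algebra_simps)
      then have "dist (x k) m = dist p m / (real k + 1)" by (simp add: dist_norm)
      also have "\<dots> < e"
      proof -
        have "dist p m / e < real k + 1" using N k(1) by simp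
        then show ?thesis using that by (simp add: field_simps)
      qed
      finally show ?thesis using k(2) by blast
    qed
    then have "m \<in> closure (closure F)" unfolding closure_approachable by blast
    then show ?thesis by simp
  qed
  obtain k where k: "x k \<in> closure F" using F(2) by (metis (mono_tags, lifting) Collect_empty_eq finite.emptyI)
  have nk: "nrmP c u (x k) > nrm u z"
  proof -
    have "nrmP c u (x k) = (1 - 1 / (real k + 1)) * nrm u z + (1 / (real k + 1)) * nrmP c u p"
      unfolding x_def by (subst nrmP_affine) (simp_all add: nm)
    also have "\<dots> = nrm u z + (1 / (real k + 1)) * (nrmP c u p - nrm u z)" by (simp add: algebra_simps)
    finally show ?thesis using p(2) by simp
  qed
  obtain a b d where abd: "F = interior (convex hull {a, b, d})" "sym_arc a b" "sym_arc b d" "sym_arc d a"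
    using face_arcs[OF F(1)] .
  have a0: "emb a 0 = a" by (simp add: emb_def)
  \<comment> \<open>The face \<open>F\<close> is a lattice triangle with respect to one of its own corners.\<close>
  interpret A: lattice_grid G a by standard (rule grid)
  obtain v where v: "(0, v) \<in> A.face_flags" "F = interior (tri a 0 v)" "{b, d} = {emb a (0 + v), emb a (0 + rot v)}"
    using A.face_flag_exists[of F 0 b d] F(1) abd a0 by metis
  note vu = A.face_flagsD[OF v(1)]
  have "m \<in> tri a 0 v" using \<open>m \<in> closure F\<close> v(2) tri_closure[OF vu(1)] by simp
  moreover have "m \<notin> interior (tri a 0 v)" using face_drawing[OF F(1)] v(2) md by blast
  ultimately have "m \<in> closed_segment (emb a 0) (emb a (0 + v)) \<or> m \<in> closed_segment (emb a (0 + v)) (emb a (0 + rot v))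
    \<or> m \<in> closed_segment (emb a (0 + rot v)) (emb a 0)" by (rule tri_edges[OF vu(1)])
  then obtain P Q where PQ: "m \<in> closed_segment P Q" "sym_arc P Q" "{P, Q} \<subseteq> {emb a 0, emb a (0 + v), emb a (0 + rot v)}"
    using vu(3-5) by blast
  have "m \<in> open_segment P Q"
    using PQ(1) mv sym_arc_verts[OF PQ(2)] by (auto simp: open_segment_def)
  then have PQAB: "{P, Q} = {A, B}" by (rule sym_arc_unique[OF PQ(2) mAB _ mo])
  then have ABin: "A \<in> {a, b, d}" "B \<in> {a, b, d}" using PQ(3) v(3) a0 by blast+
  \<comment> \<open>It shares the edge \<open>A B\<close> with the given triangle and hence belongs to the
    lattice with origin \<open>c\<close>.\<close>
  have "\<exists>y. (z, y) \<in> face_flags \<and> F = interior (tri c z y) \<and> B \<in> {emb c (z + y), emb c (z + rot y)}"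
  proof -
    consider "A = a" | "A = b" | "A = d" using ABin by blast
    then show ?thesis
    proof cases
      case 1
      obtain y where "(z, y) \<in> face_flags" "F = interior (tri c z y)" "{b, d} = {emb c (z + y), emb c (z + rot y)}"
        using face_flag_exists[of F z b d] F(1) abd 1 unfolding A_def by metis
      then show ?thesis using ABin(2) AB 1 by blast
    next
      case 2
      have "F = interior (convex hull {b, d, a})" using abd(1) by (simp add: insert_commute)
      then obtain y where "(z, y) \<in> face_flags" "F = interior (tri c z y)" "{d, a} = {emb c (z + y), emb c (z + rot y)}"
        using face_flag_exists[of F z d a] F(1) abd 2 unfolding A_def by metis
      then show ?thesis using ABin(2) AB 2 by blast
    next
      case 3
      have "F = interior (convex hull {d, a, b})" using abd(1) by (simp add: insert_commute)
      then obtain y where "(z, y) \<in> face_flags" "F = interior (tri c z y)" "{a, b} = {emb c (z + y), emb c (z + rot y)}"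
        using face_flag_exists[of F z a b] F(1) abd 3 unfolding A_def by metis
      then show ?thesis using ABin(2) AB 3 by blast
    qed
  qed
  then obtain y where y: "(z, y) \<in> face_flags" "F = interior (tri c z y)" "B \<in> {emb c (z + y), emb c (z + rot y)}" by blast
  note yu = face_flagsD(1)[OF y(1)]
  have "u = y \<or> u = rot y" using y(3) by (auto simp: B_def)
  moreover have "u \<noteq> y"
  proof
    assume "u = y"
    then have "x k \<in> tri c z u" using k y(2) tri_closure[OF yu] by simp
    then show False using nk tri_iff[OF fl(1)] by simp
  qed
  ultimately have "u = rot y" by simp
  then show ?thesis using face_flags_rot[OF face_flags_rot[OF y(1)]] by simp
qed

end

section \<open>The grid as a lattice hexagon\<close>

lemma strip_of_units:
  assumes u: "u \<in> units" and x: "x \<in> units"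
  obtains k :: int where "nrm x z \<in> {k, k + 1}" "nrm x (z + u) \<in> {k, k + 1}" "nrm x (z + rot u) \<in> {k, k + 1}"
    "k < nrm x z + (nrm x u + nrm x (rot u)) / (3::real)" "nrm x z + (nrm x u + nrm x (rot u)) / (3::real) < of_int k + 1"
proof -
  have "nrm x u = 0 \<and> nrm x (rot u) = -1 \<or> nrm x u = 1 \<and> nrm x (rot u) = 0 \<or> nrm x u = 1 \<and> nrm x (rot u) = 1
    \<or> nrm x u = 0 \<and> nrm x (rot u) = 1 \<or> nrm x u = -1 \<and> nrm x (rot u) = 0 \<or> nrm x u = -1 \<and> nrm x (rot u) = -1"
    using u by (cases rule: units_cases[OF u x]) auto
  then show ?thesis
  proof (elim disjE)
    assume "nrm x u = 0 \<and> nrm x (rot u) = -1" then show ?thesis by (intro that[of "nrm x z - 1"]) simp_all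
  next
    assume "nrm x u = 1 \<and> nrm x (rot u) = 0" then show ?thesis by (intro that[of "nrm x z"]) simp_all
  next
    assume "nrm x u = 1 \<and> nrm x (rot u) = 1" then show ?thesis by (intro that[of "nrm x z"]) simp_all
  next
    assume "nrm x u = 0 \<and> nrm x (rot u) = 1" then show ?thesis by (intro that[of "nrm x z"]) simp_all
  next
    assume "nrm x u = -1 \<and> nrm x (rot u) = 0" then show ?thesis by (intro that[of "nrm x z - 1"]) simp_all
  next
    assume "nrm x u = -1 \<and> nrm x (rot u) = -1" then show ?thesis by (intro that[of "nrm x z - 1"]) simp_all
  qed
qed

lemma centroid_nrmP:
  "nrmP c x ((1/3) *\<^sub>R emb c z + (1/3) *\<^sub>R emb c (z + u) + (1/3) *\<^sub>R emb c (z + v))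
     = nrm x z + (nrm x u + nrm x v) / 3"
  by (subst nrmP_affine3) (simp_all add: field_simps)

text \<open>The centroid of a unit triangle lies strictly inside a strip in each direction, and the
  triangle lies in the closure of that strip. So a lattice triangle that contains the centroid
  contains the whole triangle.\<close>

lemma triangle_with_centroid:
  assumes u: "u \<in> units" and v: "v \<in> units"
    and p: "(1/3) *\<^sub>R emb c z + (1/3) *\<^sub>R emb c (z + u) + (1/3) *\<^sub>R emb c (z + rot u) \<in> tri c y v"
    (is "?p \<in> _")
  shows "emb c z \<in> tri c y v" "emb c (z + u) \<in> tri c y v" "emb c (z + rot u) \<in> tri c y v"
proof -
  have e: "nrmP c x ?p = nrm x z + (nrm x u + nrm x (rot u)) / 3" for x by (rule centroid_nrmP)
  have P: "nrm v z + (nrm v u + nrm v (rot u)) / (3::real) \<le> nrm v y"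
    "nrm (rot v) z + (nrm (rot v) u + nrm (rot v) (rot u)) / (3::real) \<ge> nrm (rot v) y"
    "nrm (rot v - v) z + (nrm (rot v - v) u + nrm (rot v - v) (rot u)) / (3::real) \<le> nrm (rot v - v) y + 1"
    using p unfolding tri_iff[OF v] e by blast+
  have r: "rot v \<in> units" "rot v - v \<in> units" using v by simp_all
  obtain k1 where k1: "nrm v z \<in> {k1, k1 + 1}" "nrm v (z + u) \<in> {k1, k1 + 1}" "nrm v (z + rot u) \<in> {k1, k1 + 1}"
    "k1 < nrm v z + (nrm v u + nrm v (rot u)) / (3::real)" using strip_of_units[OF u v, of z] by metis
  obtain k2 where k2: "nrm (rot v) z \<in> {k2, k2 + 1}" "nrm (rot v) (z + u) \<in> {k2, k2 + 1}"
    "nrm (rot v) (z + rot u) \<in> {k2, k2 + 1}"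
    "nrm (rot v) z + (nrm (rot v) u + nrm (rot v) (rot u)) / (3::real) < of_int k2 + 1"
    using strip_of_units[OF u r(1), of z] by metis
  obtain k3 where k3: "nrm (rot v - v) z \<in> {k3, k3 + 1}" "nrm (rot v - v) (z + u) \<in> {k3, k3 + 1}"
    "nrm (rot v - v) (z + rot u) \<in> {k3, k3 + 1}"
    "k3 < nrm (rot v - v) z + (nrm (rot v - v) u + nrm (rot v - v) (rot u)) / (3::real)"
    using strip_of_units[OF u r(2), of z] by metis
  have "real_of_int k1 < nrm v y" using P(1) k1(4) by linarith
  moreover have "real_of_int (nrm (rot v) y) < k2 + 1" using P(2) k2(4) by linarith
  moreover have "real_of_int k3 < nrm (rot v - v) y + 1" using P(3) k3(4) by linarith
  ultimately have K: "k1 + 1 \<le> nrm v y" "nrm (rot v) y \<le> k2" "k3 \<le> nrm (rot v - v) y" by linarith+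
  have "emb c w \<in> tri c y v" if "nrm v w \<in> {k1, k1 + 1}" "nrm (rot v) w \<in> {k2, k2 + 1}"
    "nrm (rot v - v) w \<in> {k3, k3 + 1}" for w
  proof -
    have "nrm v w \<le> nrm v y" "nrm (rot v) w \<ge> nrm (rot v) y" "nrm (rot v - v) w \<le> nrm (rot v - v) y + 1"
      using that K by auto
    then show ?thesis unfolding tri_iff[OF v] nrmP_emb by linarith
  qed
  then show "emb c z \<in> tri c y v" "emb c (z + u) \<in> tri c y v" "emb c (z + rot u) \<in> tri c y v"
    using k1 k2 k3 by blast+
qed

context lattice_grid begin

lemma walk_to:
  assumes ne: "face_flags \<noteq> {}" and p: "p \<in> region G"
  obtains z u where "(z, u) \<in> face_flags" "p \<in> tri c z u"
proof -
  obtain f where f: "f \<in> face_flags" using ne by auto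
  define t where "t = (cx (p - c), cy (p - c))"
  have t: "nrmR u t = nrmP c u p" for u by (simp add: nrmP_def t_def)
  show ?thesis
  proof (rule triangle_walk[OF f, where t = t])
    fix z u assume zu: "(z, u) \<in> face_flags"
    show "u \<in> units" by (rule face_flagsD(1)[OF zu])
    show "(z + u, rot u - u) \<in> face_flags" by (rule face_flags_rot[OF zu])
    show "(z + u, - u) \<in> face_flags" if "nrm u z < nrmR u t" using face_flags_cross[OF zu p] that by (simp only: t)
  next
    fix z u assume zu: "(z, u) \<in> face_flags" and "nrmR u t \<le> nrm u z"
      "nrmR (rot u) t \<ge> nrm (rot u) z" "nrmR (rot u - u) t \<le> nrm (rot u - u) z + 1"
    then have "p \<in> tri c z u" unfolding tri_iff[OF face_flagsD(1)[OF zu]] t by simp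
    with zu show ?thesis by (rule that)
  qed
qed

lemma tri_interior_or_drawing:
  assumes f: "(z, u) \<in> face_flags" and p: "p \<in> tri c z u"
  shows "p \<in> interior (tri c z u) \<or> p \<in> drawing G"
  using tri_edges[OF face_flagsD(1)[OF f] p] sym_arc_drawing[OF face_flagsD(3)[OF f]] sym_arc_drawing[OF face_flagsD(4)[OF f]]
    sym_arc_drawing[OF face_flagsD(5)[OF f]] by blast

text \<open>Walk to a point of the face \<open>F\<close>. The walk ends in a lattice triangle that contains this
  point; as the point is not on the drawing and faces are disjoint, the triangle is \<open>F\<close>. So all
  faces belong to the same lattice.\<close>

lemma face_is_triangle:
  assumes ne: "face_flags \<noteq> {}" and F: "F \<in> bounded_faces G"
  obtains z u where "(z, u) \<in> face_flags" "F = interior (tri c z u)"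
proof -
  obtain p where p: "p \<in> F" using face_nonempty[OF F] by auto
  then have "p \<in> region G" using F closure_subset[of F] by (auto simp: region_def little_triangles_def)
  then obtain z u where zu: "(z, u) \<in> face_flags" "p \<in> tri c z u" using walk_to[OF ne] by blast
  have "p \<notin> drawing G" using face_drawing[OF F] p by blast
  then have "p \<in> interior (tri c z u)" using tri_interior_or_drawing[OF zu] by blast
  then have "F = interior (tri c z u)" by (rule faces_disjoint[OF F face_flagsD(2)[OF zu(1)] p])
  then show ?thesis using that zu(1) by blast
qed

lemma little_triangle_tri:
  assumes ne: "face_flags \<noteq> {}" and D: "\<Delta> \<in> little_triangles G"
  obtains z u where "(z, u) \<in> face_flags" "\<Delta> = tri c z u"
proof -
  obtain F where F: "F \<in> bounded_faces G" "\<Delta> = closure F" using D by (auto simp: little_triangles_def)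
  obtain z u where zu: "(z, u) \<in> face_flags" "F = interior (tri c z u)" using face_is_triangle[OF ne F(1)] .
  then show ?thesis using that tri_closure[OF face_flagsD(1)[OF zu(1)]] F(2) by simp
qed

text \<open>Walk to the vertex. It cannot be inside the face where the walk ends, nor inside one of its
  edges.\<close>

lemma vertex_face_flag:
  assumes ne: "face_flags \<noteq> {}" and v: "v \<in> pverts G"
  obtains z u where "(z, u) \<in> face_flags" "v = emb c z"
proof -
  have "v \<in> region G" using gridD(4) v by blast
  then obtain z u where zu: "(z, u) \<in> face_flags" "v \<in> tri c z u" using walk_to[OF ne] by blast
  note d = face_flagsD[OF zu(1)]
  have r1: "(z + u, rot u - u) \<in> face_flags" by (rule face_flags_rot[OF zu(1)])
  have r2: "(z + rot u, - rot u) \<in> face_flags" using face_flags_rot[OF r1] by simp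
  have "v \<in> drawing G" using v by (simp add: drawing_def)
  then have "v \<notin> interior (tri c z u)" using face_drawing[OF d(2)] by blast
  from tri_edges[OF d(1) zu(2) this]
  have "v = emb c z \<or> v = emb c (z + u) \<or> v = emb c (z + rot u)"
    using sym_arc_open_vertex[OF d(3)] sym_arc_open_vertex[OF d(4)] sym_arc_open_vertex[OF d(5)] v
    unfolding open_segment_def by blast
  then show ?thesis using that zu(1) r1 r2 by blast
qed

definition grid_points :: "lpt set" where "grid_points = {z. emb c z \<in> pverts G}"

lemma finite_grid_points: "finite grid_points"
proof -
  have "finite (emb c -` pverts G)" by (rule finite_vimageI[OF gridD(1)]) (simp add: inj_on_def)
  then show ?thesis by (simp add: grid_points_def vimage_def)
qed

lemma face_flags_subset: "face_flags \<subseteq> flags grid_points"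
proof
  fix f assume f: "f \<in> face_flags"
  obtain z u where zu: "f = (z, u)" by (cases f)
  note d = face_flagsD[OF f[unfolded zu]]
  show "f \<in> flags grid_points" unfolding zu flags_def grid_points_def
    using d(1) sym_arc_verts[OF d(3)] sym_arc_verts[OF d(4)] by simp
qed

lemma grid_points_region: "z \<in> grid_points \<Longrightarrow> emb c z \<in> region G"
  using gridD(4) by (auto simp: grid_points_def)

text \<open>The walk to a point of the surrounding hexagon never gets stuck, because the region extends
  at least as far as the vertex that attains the support number.\<close>

lemma grid_points_hex:
  assumes ne: "face_flags \<noteq> {}"
  shows "grid_points = hex (supp grid_points)"
proof
  show "grid_points \<subseteq> hex (supp grid_points)" using supp_ge[OF finite_grid_points] by (auto simp: hex_def)
  obtain f where f: "f \<in> face_flags" using ne by auto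
  have neV: "grid_points \<noteq> {}" using face_flags_subset f by (cases f) (auto simp: flags_def)
  show "hex (supp grid_points) \<subseteq> grid_points"
  proof
    fix w assume w: "w \<in> hex (supp grid_points)"
    have "\<exists>v. (w, v) \<in> face_flags"
    proof (rule triangle_walk_lattice[OF f])
      fix z u assume zu: "(z, u) \<in> face_flags"
      show u: "u \<in> units" by (rule face_flagsD(1)[OF zu])
      show "(z + u, rot u - u) \<in> face_flags" by (rule face_flags_rot[OF zu])
      assume gt: "nrm u w > nrm u z"
      obtain y where y: "y \<in> grid_points" "nrm u y = supp grid_points u" using supp_attained[OF finite_grid_points neV] .
      have "nrm u y > nrm u z" using w u gt y(2) by (auto simp: hex_def)
      then show "(z + u, - u) \<in> face_flags" by (intro face_flags_cross[OF zu grid_points_region[OF y(1)]]) simp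
    qed
    then obtain v where "(w, v) \<in> face_flags" by blast
    then have "(w, v) \<in> flags grid_points" using face_flags_subset by blast
    then show "w \<in> grid_points" by (rule flagsD)
  qed
qed

text \<open>Each lattice triangle whose corners are vertices of the grid is a little triangle: its
  centroid lies in the convex region, hence in some little triangle, and the two coincide by
  \<open>triangle_with_centroid\<close>.\<close>

lemma flags_grid_points:
  assumes ne: "face_flags \<noteq> {}"
  shows "flags grid_points = face_flags"
proof
  show "face_flags \<subseteq> flags grid_points" by (rule face_flags_subset)
  show "flags grid_points \<subseteq> face_flags"
  proof
    fix f assume f: "f \<in> flags grid_points"
    obtain z u where zu: "f = (z, u)" by (cases f)
    note d = flagsD[OF f[unfolded zu]]
    define p where "p = (1/3) *\<^sub>R emb c z + (1/3) *\<^sub>R emb c (z + u) + (1/3) *\<^sub>R emb c (z + rot u)"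
    have "p \<in> convex hull {emb c z, emb c (z + u), emb c (z + rot u)}"
      unfolding convex_hull_3 p_def by (rule CollectI, intro exI[of _ "1/3"]) simp
    moreover have "convex hull {emb c z, emb c (z + u), emb c (z + rot u)} \<subseteq> region G"
      using d grid_points_region by (intro hull_minimal gridD(3)) auto
    ultimately have "p \<in> region G" by blast
    then obtain y v where yv: "(y, v) \<in> face_flags" "p \<in> tri c y v" using walk_to[OF ne] by blast
    note v = face_flagsD(1)[OF yv(1)]
    note t = triangle_with_centroid[OF d(1) v yv(2)[unfolded p_def]]
    have r1: "(y + v, rot v - v) \<in> face_flags" by (rule face_flags_rot[OF yv(1)])
    have r2: "(y + rot v, - rot v) \<in> face_flags" using face_flags_rot[OF r1] by simp
    have t1: "tri c (y + v) (rot v - v) = tri c y v" by (rule tri_rot)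
    have t2: "tri c (y + rot v) (- rot v) = tri c y v"
      using tri_rot[of c "y + v" "rot v - v"] t1 by simp
    have "\<exists>x. (z, x) \<in> face_flags \<and> tri c z x = tri c y v"
      using lattice_point_in_tri[OF v t(1)] by (elim disjE; hypsubst) (use yv(1) r1 r2 t1 t2 in blast)+
    then obtain x where x: "(z, x) \<in> face_flags" "tri c z x = tri c y v" by blast
    note xu = face_flagsD(1)[OF x(1)]
    have 1: "z + u = z \<or> z + u = z + x \<or> z + u = z + rot x"
      by (rule lattice_point_in_tri[OF xu, of c]) (use t x(2) in simp)
    have 2: "z + rot u = z \<or> z + rot u = z + x \<or> z + rot u = z + rot x"
      by (rule lattice_point_in_tri[OF xu, of c]) (use t x(2) in simp)
    have "u = x"
    proof (rule ccontr)
      assume "u \<noteq> x"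
      then have "u = rot x" using 1 rot_nz[OF d(1)] by simp
      then have "rot x - x = 0 \<or> rot x - x = x \<or> rot x - x = rot x" using 2 by simp
      then show False using rot_nz[OF xu] by simp
    qed
    then show "f \<in> face_flags" using x(1) zu by simp
  qed
qed

lemma arc_lattice:
  assumes ne: "face_flags \<noteq> {}" and e: "(p, q) \<in> parcs G"
  obtains z u where "u \<in> units" "p = emb c z" "q = emb c (z + u)" "(z, u) \<in> face_flags \<or> (z + u, - u) \<in> face_flags"
proof -
  have s: "sym_arc p q" using e by (simp add: sym_arc_def)
  obtain u where u: "u \<in> units" "q = p + lin u" using sym_arc_unit[OF s] .
  obtain z x where z: "(z, x) \<in> face_flags" "p = emb c z" using vertex_face_flag[OF ne] sym_arc_verts[OF s] by blast
  have q: "q = emb c (z + u)" using u z by (simp add: emb_def)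
  have V: "z \<in> hex (supp grid_points)" "z + u \<in> hex (supp grid_points)"
    using sym_arc_verts[OF s] z(2) q unfolding grid_points_hex[OF ne, symmetric] by (simp_all add: grid_points_def)
  have fl: "flags (hex (supp grid_points)) = face_flags" using flags_grid_points[OF ne] grid_points_hex[OF ne] by simp
  have "(z, u) \<in> face_flags \<or> (z + u, - u) \<in> face_flags"
    using edge_in_flag[OF _ u(1) V] ne unfolding fl by blast
  then show ?thesis using that u(1) z(2) q by blast
qed

end

lemma lattice_grid_exists:
  assumes "convex_grid G"
  obtains c where "lattice_grid G" "lattice_grid.face_flags G c \<noteq> {}"
proof -
  interpret L: lattice_grid G 0 by standard (rule assms)
  have "region G \<noteq> {}" using assms by (auto simp: convex_grid_def convex_polygon_def)
  then obtain F where F: "F \<in> bounded_faces G" by (auto simp: region_def little_triangles_def)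
  obtain a b d where abd: "F = interior (convex hull {a, b, d})" "L.sym_arc a b" "L.sym_arc b d" "L.sym_arc d a"
    using L.face_arcs[OF F] .
  interpret A: lattice_grid G a by standard (rule assms)
  have a: "emb a 0 = a" by (simp add: emb_def)
  obtain u where "(0, u) \<in> A.face_flags"
    using A.face_flag_exists[of F 0 b d] F abd a by metis
  then show ?thesis using that[of a] A.lattice_grid_axioms by blast
qed

section \<open>Concave extension to the region\<close>

definition plane :: "point \<Rightarrow> (lpt \<Rightarrow> real) \<Rightarrow> lpt \<times> lpt \<Rightarrow> point \<Rightarrow> real" where
  "plane c g f p = g (fst f)
     + (nrmP c (rot (snd f)) p - nrm (rot (snd f)) (fst f)) * (g (fst f + snd f) - g (fst f))
     - (nrmP c (snd f) p - nrm (snd f) (fst f)) * (g (fst f + rot (snd f)) - g (fst f))"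

lemma plane_emb: "plane c g (z, u) (emb c w) = aff g z u w"
  by (simp add: plane_def aff_def)

lemma plane_affine:
  assumes "r + s = 1"
  shows "plane c g f (r *\<^sub>R p + s *\<^sub>R q) = r * plane c g f p + s * plane c g f q"
proof -
  have s: "s = 1 - r" using assms by simp
  show ?thesis unfolding plane_def nrmP_affine[OF assms] unfolding s by (simp add: algebra_simps)
qed

lemma plane_affine3:
  assumes "r + s + t = 1"
  shows "plane c g f (r *\<^sub>R p + s *\<^sub>R q + t *\<^sub>R w) = r * plane c g f p + s * plane c g f q + t * plane c g f w"
proof -
  have t: "t = 1 - r - s" using assms by simp
  show ?thesis unfolding plane_def nrmP_affine3[OF assms] unfolding t by (simp add: algebra_simps)
qed

lemma affine_fun_plane: "affine_fun_on A (plane c g f)"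
  unfolding affine_fun_on_def
proof (intro exI conjI ballI)
  define d1 where "d1 = g (fst f + snd f) - g (fst f)"
  define d2 where "d2 = g (fst f + rot (snd f)) - g (fst f)"
  let ?L = "\<lambda>p. nrmR (rot (snd f)) (cx p, cy p) * d1 - nrmR (snd f) (cx p, cy p) * d2"
  show "linear ?L"
    by (rule linearI) (simp_all add: nrmR_def cxy_linear algebra_simps)
  show "plane c g f p = ?L p + plane c g f 0" for p
  proof -
    have "cx (0 :: point) = 0" "cy (0 :: point) = 0" "cx (- c) = - cx c" "cy (- c) = - cy c"
      by (simp_all add: cx_def cy_def)
    then show ?thesis
      unfolding plane_def nrmP_def nrmR_def d1_def[symmetric] d2_def[symmetric]
      by (simp add: cxy_linear algebra_simps)
  qed
qed

lemma affine_fun_midpoint: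
  assumes "affine_fun_on A \<gamma>" "p \<in> A" "q \<in> A" "(1/2) *\<^sub>R p + (1/2) *\<^sub>R q \<in> A"
  shows "\<gamma> ((1/2) *\<^sub>R p + (1/2) *\<^sub>R q) = (\<gamma> p + \<gamma> q) / 2"
proof -
  obtain L k where L: "linear L" "\<And>x. x \<in> A \<Longrightarrow> \<gamma> x = L x + k" using assms(1) by (auto simp: affine_fun_on_def)
  show ?thesis using L(2)[OF assms(2)] L(2)[OF assms(3)] L(2)[OF assms(4)]
    by (simp add: linear_add[OF L(1)] linear_scale[OF L(1)] field_simps)
qed

context lattice_grid begin

lemma finite_face_flags: "finite face_flags"
proof -
  have "face_flags \<subseteq> grid_points \<times> units" using face_flags_subset by (auto simp: flags_def)
  then show ?thesis by (rule finite_subset) (simp add: finite_grid_points)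
qed

text \<open>The two triangles at an edge form a rhombus. Its two diagonals have the same midpoint, where
  the potential is affine along the common edge and concave along the other diagonal.\<close>

lemma lattice_concave_restriction:
  assumes ne: "face_flags \<noteq> {}" and pot: "potential G h \<gamma>" and conc: "concave_on (region G) \<gamma>"
  shows "lattice_concave grid_points (\<lambda>z. \<gamma> (emb c z))"
  unfolding lattice_concave_def flags_grid_points[OF ne]
proof (intro allI impI)
  fix z u assume f: "(z, u) \<in> face_flags \<and> (z + u, - u) \<in> face_flags"
  note d = face_flagsD[OF conjunct1[OF f]] and d' = face_flagsD[OF conjunct2[OF f]]
  define m where "m = (1/2) *\<^sub>R emb c z + (1/2) *\<^sub>R emb c (z + u)"
  have ap: "z + u + rot (- u) = z + ror u" by (simp add: ror_eq)
  have "emb c (z + rot u) + emb c (z + ror u) = emb c z + emb c (z + u)"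
    by (simp add: emb_def ror_eq)
  then have m: "m = (1/2) *\<^sub>R emb c (z + rot u) + (1/2) *\<^sub>R emb c (z + ror u)"
    unfolding m_def by (simp add: scaleR_add_right[symmetric])
  have mt: "m \<in> tri c z u"
    unfolding m_def tri_def using convex_convex_hull by (intro convexD) (auto intro: hull_inc)
  have "affine_fun_on (tri c z u) \<gamma>" using pot d(6) by (simp add: potential_def)
  then have "\<gamma> m = (\<gamma> (emb c z) + \<gamma> (emb c (z + u))) / 2"
    using mt unfolding m_def by (intro affine_fun_midpoint) (auto intro: tri_vertices)
  moreover have "(1/2) * \<gamma> (emb c (z + rot u)) + (1/2) * \<gamma> (emb c (z + ror u)) \<le> \<gamma> m"
  proof -
    have R: "emb c (z + rot u) \<in> region G" "emb c (z + ror u) \<in> region G"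
      using subsetD[OF d(7) tri_vertices(3)] subsetD[OF d'(7) tri_vertices(3)] unfolding ap .
    have "\<forall>x\<in>region G. \<forall>y\<in>region G. \<forall>r\<ge>0. \<forall>s\<ge>0. r + s = 1 \<longrightarrow>
        r * \<gamma> x + s * \<gamma> y \<le> \<gamma> (r *\<^sub>R x + s *\<^sub>R y)"
      using conc by (simp add: concave_on_iff)
    from this[rule_format, OF R, of "1/2" "1/2"] show ?thesis unfolding m by simp
  qed
  ultimately show "\<gamma> (emb c (z + rot u)) + \<gamma> (emb c (z + ror u)) \<le> \<gamma> (emb c z) + \<gamma> (emb c (z + u))"
    by simp
qed

text \<open>By \<open>lattice_concave_below_aff\<close> the affine function of a little triangle is, at the vertices
  of that triangle, the smallest among those of all little triangles, and by affinity this holds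
  on the whole triangle.\<close>

lemma concave_extension:
  assumes ne: "face_flags \<noteq> {}" and conc: "lattice_concave grid_points g"
  obtains \<Gamma> where "concave_on (region G) \<Gamma>" "\<And>\<Delta>. \<Delta> \<in> little_triangles G \<Longrightarrow> affine_fun_on \<Delta> \<Gamma>"
    "\<And>z. z \<in> grid_points \<Longrightarrow> \<Gamma> (emb c z) = g z"
proof -
  \<comment> \<open>The minimum of affine functions is concave.\<close>
  define \<Gamma> where "\<Gamma> p = Min ((\<lambda>f. plane c g f p) ` face_flags)" for p
  have fin: "finite ((\<lambda>f. plane c g f p) ` face_flags)" "(\<lambda>f. plane c g f p) ` face_flags \<noteq> {}" for p
    using finite_face_flags ne by auto
  have le: "\<Gamma> p \<le> plane c g f p" if "f \<in> face_flags" for p f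
    unfolding \<Gamma>_def using fin(1) that by (intro Min_le) auto
  have below: "g w \<le> aff g z u w" if "(z, u) \<in> face_flags" "w \<in> grid_points" for z u w
    using lattice_concave_below_aff[of "supp grid_points" g z u w] that conc flags_grid_points[OF ne] grid_points_hex[OF ne] by simp
  have on_tri: "\<Gamma> p = plane c g (z, u) p" if f: "(z, u) \<in> face_flags" and p: "p \<in> tri c z u" for z u p
  proof (rule antisym)
    show "\<Gamma> p \<le> plane c g (z, u) p" by (rule le[OF f])
    obtain x y w where x: "0 \<le> x" "0 \<le> y" "0 \<le> w" "x + y + w = 1"
      "p = x *\<^sub>R emb c z + y *\<^sub>R emb c (z + u) + w *\<^sub>R emb c (z + rot u)"
      using p unfolding tri_def convex_hull_3 by blast
    have fl: "(z, u) \<in> flags grid_points" using face_flags_subset f by blast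
    note v = flagsD[OF fl]
    show "plane c g (z, u) p \<le> \<Gamma> p"
      unfolding \<Gamma>_def
    proof (rule Min.boundedI[OF fin])
      fix a assume "a \<in> (\<lambda>f. plane c g f p) ` face_flags"
      then obtain f' where f': "f' \<in> face_flags" "a = plane c g f' p" by blast
      obtain z' u' where zu': "f' = (z', u')" by (cases f')
      have "plane c g (z, u) p = x * g z + y * g (z + u) + w * g (z + rot u)"
        unfolding x(5) plane_affine3[OF x(4)] plane_emb aff_vertex[OF v(1)] ..
      also have "\<dots> \<le> x * aff g z' u' z + y * aff g z' u' (z + u) + w * aff g z' u' (z + rot u)"
        using below f'(1) zu' v x(1-3) by (intro add_mono mult_left_mono) auto
      also have "\<dots> = a"
        unfolding f'(2) zu' x(5) plane_affine3[OF x(4)] plane_emb ..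
      finally show "plane c g (z, u) p \<le> a" .
    qed
  qed
  show ?thesis
  proof (rule that)
    show "concave_on (region G) \<Gamma>"
      unfolding concave_on_iff
    proof (intro conjI ballI allI impI)
      show "convex (region G)" by (rule gridD(3))
      fix p q and r s :: real
      assume rs: "0 \<le> r" "0 \<le> s" "r + s = 1"
      show "r * \<Gamma> p + s * \<Gamma> q \<le> \<Gamma> (r *\<^sub>R p + s *\<^sub>R q)"
        unfolding \<Gamma>_def[of "r *\<^sub>R p + s *\<^sub>R q"]
      proof (rule Min.boundedI[OF fin])
        fix a assume "a \<in> (\<lambda>f. plane c g f (r *\<^sub>R p + s *\<^sub>R q)) ` face_flags"
        then obtain f where f: "f \<in> face_flags" "a = plane c g f (r *\<^sub>R p + s *\<^sub>R q)" by blast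
        show "r * \<Gamma> p + s * \<Gamma> q \<le> a"
          unfolding f(2) plane_affine[OF rs(3)] using le[OF f(1)] rs by (intro add_mono mult_left_mono)
      qed
    qed
    show "affine_fun_on \<Delta> \<Gamma>" if D: "\<Delta> \<in> little_triangles G" for \<Delta>
    proof -
      obtain z u where zu: "(z, u) \<in> face_flags" "\<Delta> = tri c z u" using little_triangle_tri[OF ne D] .
      have "affine_fun_on \<Delta> (plane c g (z, u))" by (rule affine_fun_plane)
      then show ?thesis using on_tri[OF zu(1)] unfolding zu(2) affine_fun_on_def by metis
    qed
    show "\<Gamma> (emb c z) = g z" if z: "z \<in> grid_points" for z
    proof -
      have "emb c z \<in> pverts G" using z by (simp add: grid_points_def)
      then obtain z' u where zu: "(z', u) \<in> face_flags" "emb c z = emb c z'" using vertex_face_flag[OF ne] by blast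
      then have "(z, u) \<in> face_flags" by simp
      from on_tri[OF this tri_vertices(1)] show ?thesis
        unfolding plane_emb aff_vertex(1)[OF face_flagsD(1)[OF zu(1)]] .
    qed
  qed
qed

text \<open>The midpoint of an edge between two little triangles has a neighbourhood that is covered by
  them.\<close>

lemma inner_edge_not_boundary:
  assumes f: "(z, u) \<in> face_flags" "(z + u, - u) \<in> face_flags"
  shows "\<not> closed_segment (emb c z) (emb c (z + u)) \<subseteq> frontier (region G)"
proof
  assume s: "closed_segment (emb c z) (emb c (z + u)) \<subseteq> frontier (region G)"
  note d = face_flagsD[OF f(1)] and d' = face_flagsD[OF f(2)] and u = face_flagsD(1)[OF f(1)]
  define m where "m = (1/2) *\<^sub>R emb c z + (1/2) *\<^sub>R emb c (z + u)"
  have nm: "nrmP c x m = nrm x z + nrm x u / 2" for x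
    unfolding m_def by (subst nrmP_affine) (simp_all add: field_simps)
  let ?O = "{p. nrm (rot u) z < nrmP c (rot u) p} \<inter> {p. nrmP c (rot u) p < nrm (rot u) z + 1}
    \<inter> {p. nrm (rot u - u) z < nrmP c (rot u - u) p} \<inter> {p. nrmP c (rot u - u) p < nrm (rot u - u) z + 1}"
  have "m \<in> interior (region G)"
  proof (rule interiorI)
    show "open ?O" by (intro open_Int open_Collect_less continuous_nrmP continuous_intros)
    show "m \<in> ?O" using u by (simp add: nm)
    show "?O \<subseteq> region G"
    proof
      fix p assume p: "p \<in> ?O"
      show "p \<in> region G"
      proof (cases "nrmP c u p \<le> nrm u z")
        case True
        then have "p \<in> tri c z u" using p unfolding tri_iff[OF u] by simp
        then show ?thesis using d(7) by blast
      next
        case False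
        then have "p \<in> tri c (z + u) (- u)" using p u unfolding tri_iff[OF d'(1)] by simp
        then show ?thesis using d'(7) by blast
      qed
    qed
  qed
  moreover have "m \<in> closed_segment (emb c z) (emb c (z + u))"
    unfolding in_segment m_def by (intro exI[of _ "1/2"]) simp
  ultimately show False using s by (auto simp: frontier_def)
qed

text \<open>An edge of a little triangle with three integral edges is the edge of a flag with two
  integral edges, and a boundary edge is the edge of a flag without a neighbour. So the edges on
  which \<open>h\<close> has to be kept are those that \<open>integer_lattice_function\<close> keeps.\<close>

lemma integer_cocirculation:
  assumes ne: "face_flags \<noteq> {}" and h: "concave_cocirculation G h"
  shows "\<exists>h'. concave_cocirculation G h' \<and> (\<forall>e\<in>parcs G. h' e \<in> \<int>) \<and>
    (\<forall>e\<in>O_edges G h \<union> I_edges G h. h' e = h e)"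
proof -
  obtain \<gamma> where \<gamma>: "potential G h \<gamma>" "concave_on (region G) \<gamma>" using h by (auto simp: concave_cocirculation_def)
  define g where "g z = \<gamma> (emb c z)" for z
  have Vh: "hex (supp grid_points) = grid_points" using grid_points_hex[OF ne] by simp
  have conc: "lattice_concave grid_points g" unfolding g_def by (rule lattice_concave_restriction[OF ne \<gamma>])
  have h_eq: "h (emb c z, emb c w) = g w - g z" if "(emb c z, emb c w) \<in> parcs G" for z w
    using \<gamma>(1) that by (auto simp: potential_def g_def)
  obtain g' where g': "lattice_concave grid_points g'" "\<And>z u. (z, u) \<in> face_flags \<Longrightarrow> g' (z + u) - g' z \<in> \<int>"
    "\<And>z u. (z, u) \<in> face_flags \<Longrightarrow> g (z + u) - g z \<in> \<int> \<Longrightarrow>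
       g (z + rot u) - g z \<in> \<int> \<or> (z + u, - u) \<notin> face_flags \<Longrightarrow> g' (z + u) - g' z = g (z + u) - g z"
    using integer_lattice_function[of "supp grid_points" g] conc ne unfolding Vh flags_grid_points[OF ne] by blast
  obtain \<Gamma> where \<Gamma>: "concave_on (region G) \<Gamma>" "\<And>\<Delta>. \<Delta> \<in> little_triangles G \<Longrightarrow> affine_fun_on \<Delta> \<Gamma>"
    "\<And>z. z \<in> grid_points \<Longrightarrow> \<Gamma> (emb c z) = g' z" using concave_extension[OF ne g'(1)] by blast
  define h' :: "edge \<Rightarrow> real" where "h' e = \<Gamma> (snd e) - \<Gamma> (fst e)" for e
  have h'_eq: "h' (emb c z, emb c w) = g' w - g' z" if "z \<in> grid_points" "w \<in> grid_points" for z w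
    using \<Gamma>(3) that by (simp add: h'_def)
  have FlV: "z \<in> grid_points" "z + u \<in> grid_points" "z + rot u \<in> grid_points" if "(z, u) \<in> face_flags" for z u
    using flagsD(2-4)[of z u grid_points] face_flags_subset that by blast+
  have cc: "concave_cocirculation G h'"
    unfolding concave_cocirculation_def
  proof (intro conjI exI)
    show "cocirculation G h'" by (simp add: cocirculation_def h'_def)
    show "potential G h' \<Gamma>" using \<Gamma>(2) by (auto simp: potential_def h'_def)
    show "concave_on (region G) \<Gamma>" by (rule \<Gamma>(1))
  qed
  have int: "h' e \<in> \<int>" if eG: "e \<in> parcs G" for e
  proof -
    obtain p q where pq: "e = (p, q)" by (cases e)
    obtain z u where zu: "u \<in> units" "p = emb c z" "q = emb c (z + u)" "(z, u) \<in> face_flags \<or> (z + u, - u) \<in> face_flags"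
      using arc_lattice[OF ne eG[unfolded pq]] by blast
    from zu(4) show ?thesis
    proof
      assume f: "(z, u) \<in> face_flags"
      then show ?thesis using g'(2)[OF f] FlV[OF f] by (simp add: pq zu(2,3) h'_eq)
    next
      assume f: "(z + u, - u) \<in> face_flags"
      have "g' (z + u) - g' z = - (g' (z + u + - u) - g' (z + u))" by simp
      also have "\<dots> \<in> \<int>" using g'(2)[OF f] by (rule Ints_minus)
      finally show ?thesis using FlV(1,2)[OF f] by (simp add: pq zu(2,3) h'_eq)
    qed
  qed
  have Oe: "h' e = h e" if e: "e \<in> O_edges G h" for e
  proof -
    obtain p q where pq: "e = (p, q)" by (cases e)
    have arc: "(p, q) \<in> parcs G" and fr: "closed_segment p q \<subseteq> frontier (region G)" and hi: "h (p, q) \<in> \<int>"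
      using e by (auto simp: O_edges_def boundary_edges_def edges_within_def seg_def pq)
    obtain z u where zu: "u \<in> units" "p = emb c z" "q = emb c (z + u)" "(z, u) \<in> face_flags \<or> (z + u, - u) \<in> face_flags"
      using arc_lattice[OF ne arc] by blast
    have hg: "h (p, q) = g (z + u) - g z" using h_eq arc zu(2,3) by simp
    have no: "\<not> ((z, u) \<in> face_flags \<and> (z + u, - u) \<in> face_flags)"
      using inner_edge_not_boundary fr zu(2,3) by blast
    from zu(4) show ?thesis
    proof
      assume f: "(z, u) \<in> face_flags"
      then have "g' (z + u) - g' z = g (z + u) - g z" using no hi hg by (intro g'(3)) auto
      then show ?thesis using FlV[OF f] hg by (simp add: pq zu(2,3) h'_eq)
    next
      assume f: "(z + u, - u) \<in> face_flags"
      have "g (z + u + - u) - g (z + u) \<in> \<int>" using Ints_minus[OF hi] hg by simp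
      moreover have "(z + u + - u, - (- u)) \<notin> face_flags" using no f by simp
      ultimately have "g' (z + u + - u) - g' (z + u) = g (z + u + - u) - g (z + u)" using f by (intro g'(3)) auto
      then show ?thesis using FlV(1,2)[OF f] hg by (simp add: pq zu(2,3) h'_eq)
    qed
  qed
  have Ie: "h' e = h e" if e: "e \<in> I_edges G h" for e
  proof -
    obtain \<Delta> where D: "\<Delta> \<in> little_triangles G" "\<And>e. e \<in> edges_within G \<Delta> \<Longrightarrow> h e \<in> \<int>" "e \<in> edges_within G \<Delta>"
      using e by (auto simp: I_edges_def)
    obtain z u where zu: "(z, u) \<in> face_flags" "\<Delta> = tri c z u" using little_triangle_tri[OF ne D(1)] .
    have f2: "(z + u, rot u - u) \<in> face_flags" by (rule face_flags_rot[OF zu(1)])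
    have f3: "(z + rot u, - rot u) \<in> face_flags" using face_flags_rot[OF f2] by simp
    have tr: "emb c z \<in> \<Delta>" "emb c (z + u) \<in> \<Delta>" "emb c (z + rot u) \<in> \<Delta>" unfolding zu(2) by (rule tri_vertices)+
    have cvx: "convex \<Delta>" unfolding zu(2) tri_def by (rule convex_convex_hull)
    have gi: "g w - g y \<in> \<int>" if s: "sym_arc (emb c y) (emb c w)" and i: "emb c y \<in> \<Delta>" "emb c w \<in> \<Delta>" for y w
    proof -
      have sub: "closed_segment (emb c y) (emb c w) \<subseteq> \<Delta>" by (rule closed_segment_subset[OF i cvx])
      from s consider "(emb c y, emb c w) \<in> parcs G" | "(emb c w, emb c y) \<in> parcs G" by (auto simp: sym_arc_def)
      then show ?thesis
      proof cases
        case 1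
        then have "(emb c y, emb c w) \<in> edges_within G \<Delta>" using sub by (simp add: edges_within_def seg_def)
        from D(2)[OF this] show ?thesis using h_eq[OF 1] by simp
      next
        case 2
        then have "(emb c w, emb c y) \<in> edges_within G \<Delta>"
          using sub by (simp add: edges_within_def seg_def closed_segment_commute)
        from Ints_minus[OF D(2)[OF this]] show ?thesis using h_eq[OF 2] by simp
      qed
    qed
    note d = face_flagsD[OF zu(1)]
    have i1: "g (z + u) - g z \<in> \<int>" by (rule gi[OF d(3) tr(1,2)])
    have i3: "g z - g (z + rot u) \<in> \<int>" by (rule gi[OF d(5) tr(3,1)])
    have e1: "g' (z + u) - g' z = g (z + u) - g z"
      using i1 Ints_minus[OF i3] by (intro g'(3)[OF zu(1)]) auto
    have i4: "g (z + rot u + - rot u) - g (z + rot u) \<in> \<int>" using i3 by simp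
    have "g (z + rot u + rot (- rot u)) - g (z + rot u) \<in> \<int>"
      using Ints_add[OF i1 i3] by (simp add: algebra_simps)
    then have "g' (z + rot u + - rot u) - g' (z + rot u) = g (z + rot u + - rot u) - g (z + rot u)"
      by (intro g'(3)[OF f3 i4] disjI1)
    then have e3: "g' (z + rot u) - g' z = g (z + rot u) - g z" by simp
    obtain p q where pq: "e = (p, q)" by (cases e)
    have arc: "(p, q) \<in> parcs G" and sub: "closed_segment p q \<subseteq> \<Delta>"
      using D(3) by (auto simp: edges_within_def seg_def pq)
    obtain y v where yv: "p = emb c y" "q = emb c (y + v)" using arc_lattice[OF ne arc] by blast
    have "emb c y \<in> tri c z u" "emb c (y + v) \<in> tri c z u" using sub yv zu(2) by auto
    then have mem: "y = z \<or> y = z + u \<or> y = z + rot u" "y + v = z \<or> y + v = z + u \<or> y + v = z + rot u"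
      using lattice_point_in_tri[OF d(1)] by blast+
    have dz: "g' w = g w + (g' z - g z)" if "w = z \<or> w = z + u \<or> w = z + rot u" for w
      using that e1 e3 by auto
    have "g' (y + v) - g' y = g (y + v) - g y" using dz[OF mem(1)] dz[OF mem(2)] by simp
    moreover have "w \<in> grid_points" if "w = z \<or> w = z + u \<or> w = z + rot u" for w
      using that FlV[OF zu(1)] by auto
    then have "y \<in> grid_points" "y + v \<in> grid_points" using mem by blast+
    ultimately show ?thesis using h_eq arc yv by (simp add: pq h'_eq)
  qed
  show ?thesis using cc int Oe Ie by blast
qed

end

theorem theorem1p2:
  fixes G :: "point pair_pre_digraph" and h :: "edge \<Rightarrow> real"
  assumes "convex_grid G"
    and "concave_cocirculation G h"
  shows "\<exists>h'. concave_cocirculation G h' \<and>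
           (\<forall>e\<in>parcs G. h' e \<in> \<int>) \<and>
           (\<forall>e\<in>O_edges G h \<union> I_edges G h. h' e = h e)"
proof -
  obtain c where c: "lattice_grid G" "lattice_grid.face_flags G c \<noteq> {}" using lattice_grid_exists[OF assms(1)] .
  show ?thesis by (rule lattice_grid.integer_cocirculation[OF c assms(2)])
qed

end
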